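(* Fix $t>0$ and let $C\in\mathcal S_1(H)_+$ have eigenvalues $c_1\ge c_2\ge\cdots$ with $$c_j\sim bj^{-\delta},\qquad b>0,\ \delta>1.$$ Then $$N_{K_{C,t}}(u)\sim\frac{(tb/2)^{2/\delta}}\delta u^{-2/\delta}\log(1/u)\quad(u\downarrow0),\qquad s_N(K_{C,t})\sim\frac{tb}{2^{1+\delta/2}}N^{-\delta/2}(\log N)^{\delta/2}\quad(N\to\infty).$$ On an event of probability one, $$A^C_t\in\mathcal S_{1/\delta,\infty}(H)\qquad\text{and}\qquad\frac{N_{A^C_t}(au)}{N_{K_{C,t}}(u)}\longrightarrow0\quad(u\downarrow0)$$ for every fixed $a>0$.
   Context: $H$ is a real separable Hilbert space, $(c_i,e_i)$ are the eigenpairs of $C$ and $B^C$ is an $H$-valued Brownian motion with covariance $C$. $A^C_t=\operatorname{Alt}_2\int_0^tB^C_s\otimes\mathrm dB^C_s$ with $\operatorname{Alt}_2(u\otimes v)=\frac12(u\otimes v-v\otimes u)$, $u\otimes v:w\mapsto\langle w,v\rangle u$, a random skew Hilbert–Schmidt operator on $H$. $K_{C,t}$ is the deterministic operator from the Hilbert space with orthonormal basis $f_{ij}$ ($i<j$, $c_ic_j>0$) to $\Lambda^2H$ given by $K_{C,t}f_{ij}=\frac t2\sqrt{c_ic_j}\,e_i\wedge e_j$ (with $e_i\wedge e_j$, $i<j$, orthonormal). For compact $T$, $s_n(T)$ are the singular values with multiplicity, $N_T(u)=\#\{n:s_n(T)>u\}$, and $\mathcal S_{p,\infty}=\{T:\sup_nn^{1/p}s_n(T)<\infty\}$.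 *)

theory Defs
  imports "HOL-Probability.Probability"
begin

unbundle asymp_equiv_syntax

section \<open>Compact operators and their singular values\<close>

definition compact_operator :: "('a::real_normed_vector \<Rightarrow>\<^sub>L 'b::real_normed_vector) \<Rightarrow> bool" where
  "compact_operator T \<longleftrightarrow> compact (closure (T ` cball 0 1))"

text \<open>
  \<open>s 1, s 2, \<dots>\<close> is the non-increasing enumeration of the square roots of the eigenvalues of
  \<open>T\<^sup>* T\<close>, each positive one repeated according to its multiplicity (and padded by zeros if there
  are only finitely many). The value \<open>s 0\<close> plays no role. For compact \<open>T\<close> on a Hilbert space the
  eigenspaces in question are finite-dimensional and \<open>s\<close> exists and is unique on \<open>{1..}\<close>; the
  notions below are only used for compact operators.
\<close>

definition singular_value_seq ::
    "('a::real_inner \<Rightarrow>\<^sub>L 'b::real_inner) \<Rightarrow> (nat \<Rightarrow> real) \<Rightarrow> bool" where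
  "singular_value_seq T s \<longleftrightarrow>
     (\<forall>n\<ge>1. 0 \<le> s n \<and> s (Suc n) \<le> s n) \<and>
     (\<forall>\<sigma>>0. finite {n. 1 \<le> n \<and> s n = \<sigma>} \<and>
        card {n. 1 \<le> n \<and> s n = \<sigma>} = dim {x. adjoint (blinfun_apply T) (T x) = \<sigma>\<^sup>2 *\<^sub>R x})"

definition singular_value :: "('a::real_inner \<Rightarrow>\<^sub>L 'b::real_inner) \<Rightarrow> nat \<Rightarrow> real" where
  "singular_value T n = (THE \<sigma>. \<exists>s. singular_value_seq T s \<and> s n = \<sigma>)"

definition singular_value_count :: "('a::real_inner \<Rightarrow>\<^sub>L 'b::real_inner) \<Rightarrow> real \<Rightarrow> nat" where
  "singular_value_count T u = card {n. 1 \<le> n \<and> u < singular_value T n}"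

definition weak_schatten :: "real \<Rightarrow> ('a::real_inner \<Rightarrow>\<^sub>L 'b::real_inner) set" where
  "weak_schatten p = {T. compact_operator T \<and>
     bdd_above ((\<lambda>n. real n powr (1 / p) * singular_value T n) ` {1..})}"

definition trace_class :: "('a::real_inner \<Rightarrow>\<^sub>L 'b::real_inner) set" where
  "trace_class = {T. compact_operator T \<and> summable (\<lambda>n. singular_value T (Suc n))}"

definition positive_operator :: "('a::real_inner \<Rightarrow>\<^sub>L 'a) \<Rightarrow> bool" where
  "positive_operator T \<longleftrightarrow> (\<forall>x y. T x \<bullet> y = x \<bullet> T y) \<and> (\<forall>x. 0 \<le> T x \<bullet> x)"

section \<open>Eigenpairs, orthonormal bases and the deterministic operator\<close>

definition orthonormal_family :: "'i set \<Rightarrow> ('i \<Rightarrow> 'a::real_inner) \<Rightarrow> bool" where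
  "orthonormal_family I f \<longleftrightarrow> (\<forall>i\<in>I. \<forall>j\<in>I. f i \<bullet> f j = (if i = j then 1 else 0))"

definition orthonormal_basis :: "'i set \<Rightarrow> ('i \<Rightarrow> 'a::real_inner) \<Rightarrow> bool" where
  "orthonormal_basis I f \<longleftrightarrow> orthonormal_family I f \<and> closure (span (f ` I)) = UNIV"

text \<open>
  Both sequences are indexed from 1. The list exhausts the nonzero eigenvalues with their
  multiplicities: \<open>C\<close> vanishes on the orthogonal complement of the \<open>e i\<close>. The \<open>e i\<close> are not
  required to span a dense subspace, so \<open>C\<close> may have a kernel even if all \<open>c i\<close> are positive.
\<close>

definition eigenpairs ::
    "('a::real_inner \<Rightarrow>\<^sub>L 'a) \<Rightarrow> (nat \<Rightarrow> real) \<Rightarrow> (nat \<Rightarrow> 'a) \<Rightarrow> bool" where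
  "eigenpairs C c e \<longleftrightarrow>
     (\<forall>i\<ge>1. c (Suc i) \<le> c i) \<and>
     orthonormal_family {1..} e \<and>
     (\<forall>i\<ge>1. C (e i) = c i *\<^sub>R e i) \<and>
     (\<forall>x. (\<forall>i\<ge>1. x \<bullet> e i = 0) \<longrightarrow> C x = 0)"

text \<open>
  A Hilbert space \<open>'c\<close> together with \<open>wedge\<close> is a model of the exterior square \<open>\<Lambda>\<^sup>2 H\<close>; it is
  unique up to unitary equivalence. The determinant formula makes \<open>wedge\<close> alternating and fixes
  the normalisation in which \<open>wedge (e i) (e j)\<close>, \<open>i < j\<close>, are orthonormal for orthonormal \<open>e\<close>.
\<close>

definition exterior_square :: "('a::real_inner \<Rightarrow> 'a \<Rightarrow> 'c::real_inner) \<Rightarrow> bool" where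
  "exterior_square wedge \<longleftrightarrow>
     bounded_bilinear wedge \<and>
     (\<forall>u v w z. wedge u v \<bullet> wedge w z = (u \<bullet> w) * (v \<bullet> z) - (u \<bullet> z) * (v \<bullet> w)) \<and>
     closure (span {wedge u v |u v. True}) = UNIV"

definition area_index :: "(nat \<Rightarrow> real) \<Rightarrow> (nat \<times> nat) set" where
  "area_index c = {(i, j). 1 \<le> i \<and> i < j \<and> 0 < c i * c j}"

definition area_kernel ::
    "(nat \<Rightarrow> real) \<Rightarrow> (nat \<Rightarrow> 'a::real_inner) \<Rightarrow> real \<Rightarrow> (nat \<times> nat \<Rightarrow> 'b::real_inner) \<Rightarrow>
     ('a \<Rightarrow> 'a \<Rightarrow> 'c::real_inner) \<Rightarrow> ('b \<Rightarrow>\<^sub>L 'c) \<Rightarrow> bool" where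
  "area_kernel c e t f wedge K \<longleftrightarrow>
     orthonormal_basis (area_index c) f \<and> exterior_square wedge \<and>
     (\<forall>(i, j)\<in>area_index c. K (f (i, j)) = (t / 2 * sqrt (c i * c j)) *\<^sub>R wedge (e i) (e j))"

section \<open>Tensors and antisymmetrisation\<close>

definition tensor_op :: "'a::real_inner \<Rightarrow> 'a \<Rightarrow> 'a \<Rightarrow>\<^sub>L 'a" where
  "tensor_op u v = Blinfun (\<lambda>w. (w \<bullet> v) *\<^sub>R u)"

text \<open>
  Since \<open>(u \<otimes> v)\<^sup>* = v \<otimes> u\<close>, the continuous linear extension of \<open>Alt\<^sub>2\<close> from elementary tensors is
  \<open>T \<mapsto> (T - T\<^sup>*) / 2\<close>; see \<open>Alt2_tensor_op\<close>.
\<close>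

definition Alt2 :: "('a::real_inner \<Rightarrow>\<^sub>L 'a) \<Rightarrow> 'a \<Rightarrow>\<^sub>L 'a" where
  "Alt2 T = (1 / 2) *\<^sub>R (T - Blinfun (adjoint (blinfun_apply T)))"

lemma tensor_op_apply: "tensor_op u v w = (w \<bullet> v) *\<^sub>R u"
proof -
  have "bounded_linear (\<lambda>w. (w \<bullet> v) *\<^sub>R u)"
    by (intro bounded_linear_intros)
  then show ?thesis
    unfolding tensor_op_def by (simp add: bounded_linear_Blinfun_apply)
qed

lemma Alt2_tensor_op: "Alt2 (tensor_op u v) = (1 / 2) *\<^sub>R (tensor_op u v - tensor_op v u)"
proof -
  have "adjoint (blinfun_apply (tensor_op u v)) = blinfun_apply (tensor_op v u)"
    by (rule adjoint_unique) (simp add: tensor_op_apply inner_commute)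
  then show ?thesis
    by (simp add: Alt2_def blinfun_apply_inverse)
qed

text \<open>
  The squared Hilbert--Schmidt norm, possibly infinite. The supremum is the sum of
  \<open>(norm (T x))\<^sup>2\<close> over \<open>x\<close> in any orthonormal basis.
\<close>

definition hs_norm_sq :: "('a::real_inner \<Rightarrow>\<^sub>L 'b::real_inner) \<Rightarrow> ennreal" where
  "hs_norm_sq T =
     (SUP S\<in>{S. finite S \<and> orthonormal_family S (\<lambda>x. x)}. \<Sum>x\<in>S. ennreal ((norm (T x))\<^sup>2))"

section \<open>Hilbert-space-valued Brownian motion and the stochastic integral\<close>

definition centered_normal :: "'w measure \<Rightarrow> ('w \<Rightarrow> real) \<Rightarrow> real \<Rightarrow> bool" where
  "centered_normal M X v \<longleftrightarrow>
     (if v = 0 then X \<in> borel_measurable M \<and> (AE \<omega> in M. X \<omega> = 0)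
      else 0 < v \<and> distributed M lborel X (\<lambda>x. ennreal (normal_density 0 (sqrt v) x)))"

definition brownian_motion ::
    "'w measure \<Rightarrow> ('a::{real_inner, banach, second_countable_topology} \<Rightarrow>\<^sub>L 'a) \<Rightarrow>
     (real \<Rightarrow> 'w \<Rightarrow> 'a) \<Rightarrow> bool" where
  "brownian_motion M C B \<longleftrightarrow>
     (\<forall>s\<ge>0. B s \<in> borel_measurable M) \<and>
     (AE \<omega> in M. B 0 \<omega> = 0) \<and>
     (AE \<omega> in M. continuous_on {0..} (\<lambda>s. B s \<omega>)) \<and>
     (\<forall>r s h. 0 \<le> r \<and> r \<le> s \<longrightarrow>
        centered_normal M (\<lambda>\<omega>. (B s \<omega> - B r \<omega>) \<bullet> h) ((s - r) * (C h \<bullet> h))) \<and>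
     (\<forall>n (\<tau> :: nat \<Rightarrow> real). 0 \<le> \<tau> 0 \<and> mono \<tau> \<longrightarrow>
        prob_space.indep_vars M (\<lambda>_. borel) (\<lambda>k \<omega>. B (\<tau> (Suc k)) \<omega> - B (\<tau> k) \<omega>) {..<n})"

definition past :: "'w measure \<Rightarrow> (real \<Rightarrow> 'w \<Rightarrow> 'a::topological_space) \<Rightarrow> real \<Rightarrow> 'w measure" where
  "past M B s = sigma (space M) {B r -` U \<inter> space M |r U. 0 \<le> r \<and> r \<le> s \<and> U \<in> sets borel}"

text \<open>
  Elementary integrands: on \<open>(\<tau> k, \<tau> (k + 1)]\<close>, \<open>k < n\<close>, the process equals the square-integrable
  random vector \<open>X k\<close>, measurable with respect to the past of \<open>B\<close> up to time \<open>\<tau> k\<close>.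
\<close>

definition elementary_integrand ::
    "'w measure \<Rightarrow> (real \<Rightarrow> 'w \<Rightarrow> 'a::{real_inner, banach, second_countable_topology}) \<Rightarrow> real \<Rightarrow>
     nat \<Rightarrow> (nat \<Rightarrow> real) \<Rightarrow> (nat \<Rightarrow> 'w \<Rightarrow> 'a) \<Rightarrow> bool" where
  "elementary_integrand M B t n \<tau> X \<longleftrightarrow>
     \<tau> 0 = 0 \<and> \<tau> n = t \<and> (\<forall>k<n. \<tau> k \<le> \<tau> (Suc k)) \<and>
     (\<forall>k<n. X k \<in> borel_measurable (past M B (\<tau> k)) \<and>
        (\<integral>\<^sup>+\<omega>. ennreal ((norm (X k \<omega>))\<^sup>2) \<partial>M) < \<infinity>)"

definition elementary_process ::
    "nat \<Rightarrow> (nat \<Rightarrow> real) \<Rightarrow> (nat \<Rightarrow> 'w \<Rightarrow> 'a::real_vector) \<Rightarrow> real \<Rightarrow> 'w \<Rightarrow> 'a" where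
  "elementary_process n \<tau> X s \<omega> = (\<Sum>k<n. indicator {\<tau> k<..\<tau> (Suc k)} s *\<^sub>R X k \<omega>)"

definition elementary_integral ::
    "(real \<Rightarrow> 'w \<Rightarrow> 'a::real_inner) \<Rightarrow> nat \<Rightarrow> (nat \<Rightarrow> real) \<Rightarrow> (nat \<Rightarrow> 'w \<Rightarrow> 'a) \<Rightarrow>
     'w \<Rightarrow> 'a \<Rightarrow>\<^sub>L 'a" where
  "elementary_integral B n \<tau> X \<omega> =
     (\<Sum>k<n. tensor_op (X k \<omega>) (B (\<tau> (Suc k)) \<omega> - B (\<tau> k) \<omega>))"

text \<open>
  \<open>I\<close> is a version of the Ito integral of \<open>\<Phi> \<otimes> dB\<close> over \<open>[0, t]\<close>: the limit, in the mean-square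
  Hilbert--Schmidt norm, of the integrals of elementary processes approximating \<open>\<Phi>\<close> in mean
  square. By the Ito isometry the limit does not depend on the approximation, up to null sets.
\<close>

definition ito_tensor_integral ::
    "'w measure \<Rightarrow> (real \<Rightarrow> 'w \<Rightarrow> 'a::{real_inner, banach, second_countable_topology}) \<Rightarrow> real \<Rightarrow>
     (real \<Rightarrow> 'w \<Rightarrow> 'a) \<Rightarrow> ('w \<Rightarrow> 'a \<Rightarrow>\<^sub>L 'a) \<Rightarrow> bool" where
  "ito_tensor_integral M B t \<Phi> I \<longleftrightarrow>
     (\<forall>x. (\<lambda>\<omega>. I \<omega> x) \<in> borel_measurable M) \<and>
     (\<exists>n \<tau> X.
        (\<forall>m. elementary_integrand M B t (n m) (\<tau> m) (X m)) \<and>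
        (\<lambda>m. \<integral>\<^sup>+\<omega>. (\<integral>\<^sup>+s\<in>{0..t}.
            ennreal ((norm (\<Phi> s \<omega> - elementary_process (n m) (\<tau> m) (X m) s \<omega>))\<^sup>2) \<partial>lborel) \<partial>M)
          \<longlonglongrightarrow> 0 \<and>
        (\<lambda>m. \<integral>\<^sup>+\<omega>. hs_norm_sq (I \<omega> - elementary_integral B (n m) (\<tau> m) (X m) \<omega>) \<partial>M)
          \<longlonglongrightarrow> 0)"

definition levy_area ::
    "'w measure \<Rightarrow> (real \<Rightarrow> 'w \<Rightarrow> 'a::{real_inner, banach, second_countable_topology}) \<Rightarrow> real \<Rightarrow>
     ('w \<Rightarrow> 'a \<Rightarrow>\<^sub>L 'a) \<Rightarrow> bool" where
  "levy_area M B t A \<longleftrightarrow>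
     (\<exists>I. ito_tensor_integral M B t B I \<and> (AE \<omega> in M. A \<omega> = Alt2 (I \<omega>)))"

end

theory Submission
  imports Defs "HOL-Real_Asymp.Real_Asymp"
begin

text \<open>
  The theorem compares the Levy area with the deterministic operator \<open>K\<close> that carries the same
  covariance. Two different mechanisms decide how the singular values decay.

  The operator \<open>K\<close> maps an orthonormal basis to multiples of orthonormal vectors, so its singular
  values are the numbers \<open>t / 2 * sqrt (c i * c j)\<close>, \<open>i < j\<close> (\<open>area_kernel_count\<close>). Counting those
  above \<open>u\<close> means counting pairs with \<open>i * j < X\<close>, where \<open>X\<close> is of order \<open>u powr (- 2 / \<delta>)\<close>. The
  divisor problem gives \<open>X * ln X / 2\<close> such pairs, and replacing \<open>c\<close> by its asymptotic equivalent does
  not change this to leading order (\<open>perturbed_pairs_asymp\<close>). The asymptotics of the singular values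
  follow by inverting the counting function (\<open>counting_function_inversion\<close>).

  The Levy area has the smaller singular values \<open>O(n powr (- \<delta>))\<close>, without a logarithm, because it is
  well approximated by operators of finite rank. Split the time interval into \<open>2 ^ k\<close> equal pieces.
  The Riemann sum of the stochastic integral over this partition has rank at most \<open>2 ^ k\<close>; projecting
  away the first \<open>2 ^ k\<close> eigenvectors costs another multiple of \<open>2 ^ k\<close> dimensions. What remains is the
  projection of the sum over later levels of
  \<open>D = (\<Sum>l. X l \<otimes> Y l)\<close>, where \<open>X l\<close> and \<open>Y l\<close> are the increments over the two halves of the
  \<open>l\<close>-th interval. All increments are independent, so the mean squared Hilbert--Schmidt norm of the
  remainder is of order \<open>(2 ^ k) powr (1 - 2 * \<delta>)\<close>: the factor \<open>(2 ^ k) powr (2 - 2 * \<delta>)\<close> is the squared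
  trace of the projected covariance and \<open>1 / 2 ^ k\<close> comes from the mesh. Dividing by the \<open>2 ^ k\<close>
  remaining dimensions bounds the square of the singular value with index \<open>5 * 2 ^ k\<close> by a multiple of
  \<open>(2 ^ k) powr (- 2 * \<delta>)\<close>.

  To have this almost surely for all \<open>k\<close> at once and without losing a logarithm, second moments do not
  suffice. The squared Hilbert--Schmidt norm of \<open>D\<close> concentrates around its mean: its relative variance
  is at most a multiple of \<open>1 / 2 ^ k\<close> (\<open>tensor_norm_deviation\<close>), which is summable over the levels
  (\<open>level_norm_bound\<close>).

  Three further ingredients connect this with the definitions. Singular values are only needed through
  sums of dimensions of eigenspaces, which are bounded by a variational argument
  (\<open>eigen_count_le_avoiding\<close>). The Ito isometry
  (\<open>ito_isometry\<close>), for sums over arbitrary finite families of intervals, identifies the given integral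
  with the limit of the Riemann sums (\<open>ito_dyadic_error\<close>). It rests on the independence of an increment
  from the past (\<open>past_indep_increment\<close>).
\<close>

section \<open>Singular values and dimensions of eigenspaces\<close>

text \<open>The dimension of an infinite-dimensional space is \<open>0\<close> by convention, exactly as in the definition of
a sequence of singular values.\<close>

definition eigen_dim :: "('a::real_inner \<Rightarrow>\<^sub>L 'b::real_inner) \<Rightarrow> real \<Rightarrow> nat" where
  "eigen_dim T \<sigma> = dim {x. adjoint (blinfun_apply T) (T x) = \<sigma>\<^sup>2 *\<^sub>R x}"

text \<open>The counting function of the singular values, with each level counted by its multiplicity.\<close>

definition eigen_count :: "('a::real_inner \<Rightarrow>\<^sub>L 'b::real_inner) \<Rightarrow> real \<Rightarrow> nat" where
  "eigen_count T u = (\<Sum>\<sigma> | u < \<sigma> \<and> 0 < eigen_dim T \<sigma>. eigen_dim T \<sigma>)"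

definition discrete_spectrum :: "('a::real_inner \<Rightarrow>\<^sub>L 'b::real_inner) \<Rightarrow> bool" where
  "discrete_spectrum T \<longleftrightarrow> (\<forall>u>0. finite {\<sigma>. u < \<sigma> \<and> 0 < eigen_dim T \<sigma>})"

lemma down_closed_eq_interval:
  fixes S :: "nat set"
  assumes "finite S" "0 \<notin> S" and down: "\<And>m n. n \<in> S \<Longrightarrow> 1 \<le> m \<Longrightarrow> m \<le> n \<Longrightarrow> m \<in> S"
  shows "S = {1..card S}"
proof (cases "S = {}")
  case False
  have "S = {1..Max S}"
  proof (intro set_eqI iffI)
    fix x assume "x \<in> S"
    then show "x \<in> {1..Max S}"
      using assms(1,2) by (cases "x = 0") auto
  next
    fix x assume "x \<in> {1..Max S}"
    then show "x \<in> S" using down[OF Max_in[OF assms(1) False]] by auto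
  qed
  then show ?thesis by (metis card_atLeastAtMost diff_Suc_1)
qed auto

text \<open>Since a sequence of singular values is monotone, each superlevel set is an initial segment, and its
length is the total multiplicity above the level. This makes the sequence unique.\<close>

lemma singular_value_seq_superlevel:
  assumes s: "singular_value_seq T s" and d: "discrete_spectrum T" and u: "0 < u"
  shows "{n. 1 \<le> n \<and> u < s n} = {1..eigen_count T u}"
proof -
  let ?L = "{\<sigma>. u < \<sigma> \<and> 0 < eigen_dim T \<sigma>}"
  let ?S = "{n. 1 \<le> n \<and> u < s n}"
  have fin: "finite ?L" using d u by (simp add: discrete_spectrum_def)
  have lev: "finite {n. 1 \<le> n \<and> s n = \<sigma>}" "card {n. 1 \<le> n \<and> s n = \<sigma>} = eigen_dim T \<sigma>"
    if "\<sigma> > 0" for \<sigma>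
    using s that by (auto simp: singular_value_seq_def eigen_dim_def)
  have S: "?S = (\<Union>\<sigma>\<in>?L. {n. 1 \<le> n \<and> s n = \<sigma>})"
  proof (intro set_eqI iffI)
    fix n assume n: "n \<in> ?S"
    then have "s n > 0" using u by auto
    from lev[OF this] have "0 < eigen_dim T (s n)"
      using n by (metis (mono_tags, lifting) card_gt_0_iff empty_Collect_eq mem_Collect_eq)
    with n show "n \<in> (\<Union>\<sigma>\<in>?L. {n. 1 \<le> n \<and> s n = \<sigma>})" by auto
  qed auto
  have "finite ?S" unfolding S using fin lev u by (intro finite_UN_I) auto
  moreover have "m \<in> ?S" if "n \<in> ?S" "1 \<le> m" "m \<le> n" for m n
  proof -
    have "s n \<le> s m" using that(3)
    proof (induction rule: dec_induct)
      case (step k)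
      have "1 \<le> k" using step.hyps that(2) by simp
      then have "s (Suc k) \<le> s k" using s by (auto simp: singular_value_seq_def)
      with step show ?case by linarith
    qed simp
    with that show ?thesis by auto
  qed
  moreover have "card ?S = eigen_count T u"
    unfolding S eigen_count_def using fin lev u
    by (subst card_UN_disjoint) auto
  ultimately show ?thesis
    using down_closed_eq_interval[of ?S] by simp
qed

lemma eigen_count_antimono:
  assumes "discrete_spectrum T" "0 < u" "u \<le> v"
  shows "eigen_count T v \<le> eigen_count T u"
  unfolding eigen_count_def using assms
  by (intro sum_mono2) (auto simp: discrete_spectrum_def)

text \<open>The count is a step function: discreteness keeps other levels away from a neighbourhood of \<open>v\<close>. It is
continuous from the right, and the jump at \<open>v\<close> is the multiplicity.\<close>

lemma eigen_count_gap:
  assumes d: "discrete_spectrum T" and v: "0 < v"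
  obtains l r where "0 < l" "l < v" "v < r"
    "eigen_count T r = eigen_count T v"
    "\<And>w. l \<le> w \<Longrightarrow> w < v \<Longrightarrow> eigen_count T w = eigen_count T v + eigen_dim T v"
proof -
  let ?L = "{\<sigma>. v / 2 < \<sigma> \<and> 0 < eigen_dim T \<sigma>} - {v}"
  have fin: "finite ?L"
    using d[unfolded discrete_spectrum_def, rule_format, of "v / 2"] v by simp
  obtain e where e: "e > 0" "\<And>x. x \<in> ?L \<Longrightarrow> e \<le> dist v x"
    using finite_set_avoid[OF fin, of v] by auto
  \<comment> \<open>Small enough to stay positive and to reach no other level.\<close>
  define q where "q = min e v / 2"
  have q: "0 < q" "q < e" "2 * q \<le> v" using e v by (auto simp: q_def)
  have 1: "{\<sigma>. v + q < \<sigma> \<and> 0 < eigen_dim T \<sigma>} = {\<sigma>. v < \<sigma> \<and> 0 < eigen_dim T \<sigma>}"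
    using e(2) q v by (force simp: dist_real_def)
  show thesis
  proof
    show "0 < v - q" "v - q < v" "v < v + q" using q v by auto
    show "eigen_count T (v + q) = eigen_count T v"
      unfolding eigen_count_def 1 ..
    fix w assume w: "v - q \<le> w" "w < v"
    have 2: "{\<sigma>. w < \<sigma> \<and> 0 < eigen_dim T \<sigma>} =
      {\<sigma>. v < \<sigma> \<and> 0 < eigen_dim T \<sigma>} \<union> (if 0 < eigen_dim T v then {v} else {})"
      (is "?l = ?r")
    proof (intro set_eqI iffI)
      fix x assume x: "x \<in> ?l"
      show "x \<in> ?r"
      proof (cases "x \<in> ?L")
        case True
        with e(2)[OF True] x w q show ?thesis by (auto simp: dist_real_def split: if_splits)
      next
        case False
        with x w q show ?thesis by (auto split: if_splits)
      qed
    qed (use w in \<open>auto split: if_splits\<close>)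
    have "finite {\<sigma>. v < \<sigma> \<and> 0 < eigen_dim T \<sigma>}" using d v by (simp add: discrete_spectrum_def)
    then show "eigen_count T w = eigen_count T v + eigen_dim T v"
      unfolding eigen_count_def 2 by (subst sum.union_disjoint) auto
  qed
qed

text \<open>The sequence is the generalised inverse of the counting function. That its level sets have the
right size follows from the two one-sided limits of the counting function at each level.\<close>

lemma singular_value_seq_exists:
  assumes d: "discrete_spectrum T"
  shows "\<exists>s. singular_value_seq T s"
proof -
  define s where "s n = Inf {u. 0 < u \<and> eigen_count T u < n}" for n
  have ne: "{u. 0 < u \<and> eigen_count T u < n} \<noteq> {}" if n: "1 \<le> n" for n
  proof -
    have fin: "finite {\<sigma>. 1 < \<sigma> \<and> 0 < eigen_dim T \<sigma>}" using d by (auto simp: discrete_spectrum_def)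
    define U where "U = Max (insert 1 {\<sigma>. 1 < \<sigma> \<and> 0 < eigen_dim T \<sigma>})"
    have U: "1 \<le> U" "\<And>\<sigma>. 1 < \<sigma> \<and> 0 < eigen_dim T \<sigma> \<Longrightarrow> \<sigma> \<le> U"
      using fin by (auto simp: U_def)
    have "{\<sigma>. U < \<sigma> \<and> 0 < eigen_dim T \<sigma>} = {}" using U by force
    then have "eigen_count T U = 0" unfolding eigen_count_def by (metis sum.empty)
    with U n have "U \<in> {u. 0 < u \<and> eigen_count T u < n}" by auto
    then show ?thesis by blast
  qed
  have bdd: "bdd_below {u. 0 < u \<and> eigen_count T u < n}" for n
    by (rule bdd_belowI[of _ 0]) auto
  have iff: "v < s n \<longleftrightarrow> n \<le> eigen_count T v" if n: "1 \<le> n" and v: "0 < v" for n v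
  proof
    assume "v < s n"
    show "n \<le> eigen_count T v"
    proof (rule ccontr)
      assume "\<not> ?thesis"
      with v have "s n \<le> v" unfolding s_def by (intro cInf_lower bdd) auto
      with \<open>v < s n\<close> show False by simp
    qed
  next
    assume le: "n \<le> eigen_count T v"
    obtain r where r: "v < r" "eigen_count T r = eigen_count T v"
      using eigen_count_gap[OF d v] by metis
    have "r \<le> s n" unfolding s_def
    proof (rule cInf_greatest[OF ne[OF n]])
      fix u assume u: "u \<in> {u. 0 < u \<and> eigen_count T u < n}"
      show "r \<le> u"
      proof (rule ccontr)
        assume "\<not> ?thesis"
        then have "eigen_count T r \<le> eigen_count T u"
          using u by (intro eigen_count_antimono[OF d]) auto
        with u le r show False by auto
      qed
    qed
    with r show "v < s n" by simp
  qed
  have nn: "0 \<le> s n" if "1 \<le> n" for n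
    unfolding s_def by (rule cInf_greatest[OF ne[OF that]]) auto
  have dec: "s (Suc n) \<le> s n" if "1 \<le> n" for n
    unfolding s_def by (rule cInf_superset_mono[OF ne[OF that] bdd]) auto
  have lev: "{n. 1 \<le> n \<and> s n = \<sigma>} = {eigen_count T \<sigma> + 1..eigen_count T \<sigma> + eigen_dim T \<sigma>}"
    if \<sigma>: "0 < \<sigma>" for \<sigma>
  proof -
    obtain l where l: "0 < l" "l < \<sigma>"
      "\<And>w. l \<le> w \<Longrightarrow> w < \<sigma> \<Longrightarrow> eigen_count T w = eigen_count T \<sigma> + eigen_dim T \<sigma>"
      using eigen_count_gap[OF d \<sigma>] by metis
    have ge: "\<sigma> \<le> s n \<longleftrightarrow> n \<le> eigen_count T \<sigma> + eigen_dim T \<sigma>" if n: "1 \<le> n" for n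
    proof
      assume "\<sigma> \<le> s n"
      with l have "l < s n" by simp
      with iff[OF n l(1)] l(3)[of l] l(2) show "n \<le> eigen_count T \<sigma> + eigen_dim T \<sigma>" by simp
    next
      assume le: "n \<le> eigen_count T \<sigma> + eigen_dim T \<sigma>"
      have "w \<le> s n" if "l < w" "w < \<sigma>" for w
        using iff[OF n, of w] l that le by force
      then show "\<sigma> \<le> s n" using dense_le_bounded[OF l(2)] by blast
    qed
    have "s n = \<sigma> \<longleftrightarrow> \<sigma> \<le> s n \<and> \<not> \<sigma> < s n" for n by auto
    then show ?thesis using ge iff[OF _ \<sigma>] by auto
  qed
  have "singular_value_seq T s"
    unfolding singular_value_seq_def eigen_dim_def[symmetric] using nn dec lev by auto
  then show ?thesis by (intro exI[of _ s])
qed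

lemma singular_value_eq:
  assumes d: "discrete_spectrum T" and s: "singular_value_seq T s" and n: "1 \<le> n"
  shows "singular_value T n = s n"
  unfolding singular_value_def
proof (rule the_equality)
  show "\<exists>s'. singular_value_seq T s' \<and> s' n = s n" using s by auto
  fix \<sigma> assume "\<exists>s. singular_value_seq T s \<and> s n = \<sigma>"
  then obtain s' where s': "singular_value_seq T s'" "s' n = \<sigma>" by auto
  have eq: "u < s n \<longleftrightarrow> u < s' n" if "0 < u" for u
  proof -
    have "n \<in> {n. 1 \<le> n \<and> u < s n} \<longleftrightarrow> n \<in> {n. 1 \<le> n \<and> u < s' n}"
      unfolding singular_value_seq_superlevel[OF s d that] singular_value_seq_superlevel[OF s'(1) d that] ..
    with n show ?thesis by simp
  qed
  have "0 \<le> s n" "0 \<le> s' n" using s s'(1) n by (auto simp: singular_value_seq_def)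
  have le: "x \<le> y" if "\<And>u. 0 < u \<Longrightarrow> u < x \<Longrightarrow> u < y" "0 \<le> y" for x y :: real
  proof (rule ccontr)
    assume "\<not> x \<le> y"
    then obtain u where "y < u" "u < x" using dense[of y x] by auto
    with that(1)[of u] that(2) show False by simp
  qed
  have "s n = s' n"
  proof (rule antisym)
    show "s n \<le> s' n" by (rule le) (use eq \<open>0 \<le> s' n\<close> in auto)
    show "s' n \<le> s n" by (rule le) (use eq \<open>0 \<le> s n\<close> in auto)
  qed
  with s' show "\<sigma> = s n" by simp
qed

lemma
  assumes d: "discrete_spectrum T"
  shows singular_value_greater_iff:
      "1 \<le> n \<Longrightarrow> 0 < u \<Longrightarrow> u < singular_value T n \<longleftrightarrow> n \<le> eigen_count T u"
    and singular_value_nonneg: "1 \<le> n \<Longrightarrow> 0 \<le> singular_value T n"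
    and singular_value_count_eq: "0 < u \<Longrightarrow> singular_value_count T u = eigen_count T u"
proof -
  obtain s where s: "singular_value_seq T s" using singular_value_seq_exists[OF d] ..
  note eq = singular_value_eq[OF d s]
  show iff: "u < singular_value T n \<longleftrightarrow> n \<le> eigen_count T u" if "1 \<le> n" "0 < u" for n u
  proof -
    have "n \<in> {n. 1 \<le> n \<and> u < s n} \<longleftrightarrow> n \<in> {1..eigen_count T u}"
      unfolding singular_value_seq_superlevel[OF s d that(2)] ..
    with that(1) show ?thesis by (simp add: eq)
  qed
  show "0 \<le> singular_value T n" if "1 \<le> n" for n
    using s that eq[OF that] by (auto simp: singular_value_seq_def)
  show "singular_value_count T u = eigen_count T u" if "0 < u" for u
  proof -
    have "{n. 1 \<le> n \<and> u < singular_value T n} = {1..eigen_count T u}"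
      using iff that by auto
    then show ?thesis by (simp add: singular_value_count_def)
  qed
qed

section \<open>Orthonormal sets\<close>

abbreviation orthonormal :: "'a::real_inner set \<Rightarrow> bool" where
  "orthonormal S \<equiv> orthonormal_family S (\<lambda>x. x)"

lemma orthonormalI:
  assumes "\<And>x. x \<in> S \<Longrightarrow> norm x = 1" "pairwise orthogonal S"
  shows "orthonormal S"
  using assms by (auto simp: orthonormal_family_def pairwise_def orthogonal_def norm_eq_1)

lemma orthonormal_independent:
  fixes S :: "'a::real_inner set"
  assumes "orthonormal S"
  shows "independent S"
proof (rule pairwise_orthogonal_independent)
  show "pairwise orthogonal S"
    using assms by (auto simp: pairwise_def orthogonal_def orthonormal_family_def)
  show "0 \<notin> S"
  proof
    assume "0 \<in> S"
    then have "(0::'a) \<bullet> 0 = 1" using assms unfolding orthonormal_family_def by (metis (full_types))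
    then show False by simp
  qed
qed

lemma orthonormal_span_exists:
  fixes B :: "'a::real_inner set"
  assumes "finite B"
  obtains C where "finite C" "orthonormal C" "span C = span B"
proof -
  obtain D where D: "finite D" "span D = span B" "pairwise orthogonal D"
    using basis_orthogonal[OF assms] by blast
  define C where "C = (\<lambda>x. x /\<^sub>R norm x) ` (D - {0})"
  have "orthonormal C"
  proof (rule orthonormalI)
    show "pairwise orthogonal C"
      using D(3) by (auto simp: C_def pairwise_def orthogonal_def)
    show "norm x = 1" if "x \<in> C" for x
    proof -
      obtain y where "y \<noteq> 0" "x = y /\<^sub>R norm y" using \<open>x \<in> C\<close> by (auto simp: C_def)
      then show ?thesis by simp
    qed
  qed
  moreover have "span C = span (D - {0})"
  proof (rule antisym)
    show "span C \<subseteq> span (D - {0})"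
      by (rule span_minimal) (auto simp: C_def intro: span_scale span_base)
    show "span (D - {0}) \<subseteq> span C"
    proof (rule span_minimal)
      show "D - {0} \<subseteq> span C"
      proof
        fix x assume x: "x \<in> D - {0}"
        then have "x /\<^sub>R norm x \<in> span C" by (auto simp: C_def intro: span_base)
        then have "norm x *\<^sub>R (x /\<^sub>R norm x) \<in> span C" by (rule span_scale)
        with x show "x \<in> span C" by simp
      qed
    qed simp
  qed
  ultimately show thesis
    using D by (intro that[of C]) (auto simp: C_def)
qed

lemma orthonormal_norm_sum:
  assumes "finite S" "orthonormal S"
  shows "(norm (\<Sum>x\<in>S. a x *\<^sub>R x))\<^sup>2 = (\<Sum>x\<in>S. (a x)\<^sup>2)"
proof -
  have "(\<Sum>x\<in>S. a x *\<^sub>R x) \<bullet> (\<Sum>x\<in>S. a x *\<^sub>R x) = (\<Sum>x\<in>S. \<Sum>y\<in>S. a x * (a y * (y \<bullet> x)))"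
    by (simp add: inner_sum_left inner_sum_right sum_distrib_left)
  also have "\<dots> = (\<Sum>x\<in>S. \<Sum>y\<in>S. if x = y then a x * a y else 0)"
    using assms(2) by (intro sum.cong) (auto simp: orthonormal_family_def)
  also have "\<dots> = (\<Sum>x\<in>S. (a x)\<^sup>2)"
    using assms(1) by (simp add: power2_eq_square)
  finally show ?thesis by (simp add: power2_norm_eq_inner)
qed

lemma orthonormal_expand:
  assumes "finite S" "orthonormal S" "x \<in> span S"
  shows "x = (\<Sum>s\<in>S. (x \<bullet> s) *\<^sub>R s)"
proof -
  obtain a where a: "x = (\<Sum>s\<in>S. a s *\<^sub>R s)"
    using assms(1,3) by (auto simp: span_finite)
  have "x \<bullet> s = a s" if "s \<in> S" for s
  proof -
    have "x \<bullet> s = (\<Sum>r\<in>S. a r * (r \<bullet> s))" by (simp add: a inner_sum_left)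
    also have "\<dots> = (\<Sum>r\<in>S. if r = s then a r else 0)"
      using assms(2) that by (intro sum.cong) (auto simp: orthonormal_family_def)
    finally show ?thesis using assms(1) that by simp
  qed
  with a show ?thesis by simp
qed

lemma bessel_family:
  fixes e :: "'i \<Rightarrow> 'a::real_inner"
  assumes "finite I" "orthonormal_family I e"
  shows "(\<Sum>i\<in>I. (x \<bullet> e i)\<^sup>2) + (norm (x - (\<Sum>i\<in>I. (x \<bullet> e i) *\<^sub>R e i)))\<^sup>2 = (norm x)\<^sup>2"
proof -
  define p where "p = (\<Sum>i\<in>I. (x \<bullet> e i) *\<^sub>R e i)"
  have xp: "x \<bullet> p = (\<Sum>i\<in>I. (x \<bullet> e i)\<^sup>2)"
    by (simp add: p_def inner_sum_right power2_eq_square)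
  have "p \<bullet> p = (\<Sum>i\<in>I. \<Sum>j\<in>I. (x \<bullet> e i) * ((x \<bullet> e j) * (e j \<bullet> e i)))"
    by (simp add: p_def inner_sum_left inner_sum_right sum_distrib_left)
  also have "\<dots> = (\<Sum>i\<in>I. \<Sum>j\<in>I. if i = j then (x \<bullet> e i) * (x \<bullet> e j) else 0)"
    using assms(2) by (intro sum.cong) (auto simp: orthonormal_family_def)
  also have "\<dots> = (\<Sum>i\<in>I. (x \<bullet> e i)\<^sup>2)"
    using assms(1) by (simp add: power2_eq_square)
  finally have pp: "p \<bullet> p = (\<Sum>i\<in>I. (x \<bullet> e i)\<^sup>2)" .
  show ?thesis
    unfolding p_def[symmetric]
    by (simp add: power2_norm_eq_inner inner_diff inner_commute[of p x] xp pp)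
qed

lemma bessel_inequality:
  assumes "finite I" "orthonormal_family I e"
  shows "(\<Sum>i\<in>I. (x \<bullet> e i)\<^sup>2) \<le> (norm x)\<^sup>2"
  using bessel_family[OF assms, of x] by (smt (verit) zero_le_power2)

text \<open>Subtracting multiples of one member \<open>s\<close> that is not perpendicular to \<open>v\<close> makes all other members
perpendicular to \<open>v\<close>. Together with \<open>s\<close> the new vectors still span \<open>S\<close>, so only one dimension is lost.\<close>

lemma orthonormal_avoid_vector:
  fixes S :: "'a::real_inner set"
  assumes S: "finite S" "orthonormal S"
  obtains R where "finite R" "orthonormal R" "R \<subseteq> span S" "\<And>x. x \<in> R \<Longrightarrow> x \<bullet> v = 0"
    "card S \<le> card R + 1"
proof (cases "\<forall>s\<in>S. s \<bullet> v = 0")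
  case True
  with S show ?thesis by (intro that[of S]) (auto intro: span_base)
next
  case False
  then obtain s where s: "s \<in> S" "s \<bullet> v \<noteq> 0" by blast
  define g where "g r = r - ((r \<bullet> v) / (s \<bullet> v)) *\<^sub>R s" for r
  obtain C where C: "finite C" "orthonormal C" "span C = span (g ` S)"
    using orthonormal_span_exists[of "g ` S"] S(1) by auto
  have gS: "g ` S \<subseteq> span S"
    using s by (auto simp: g_def intro!: span_diff span_scale intro: span_base)
  have "C \<subseteq> span S"
    using C(3) span_minimal[OF gS subspace_span] span_superset[of C] by blast
  moreover have "x \<bullet> v = 0" if "x \<in> C" for x
  proof -
    have "span (g ` S) \<subseteq> {x. x \<bullet> v = 0}"
      using s by (intro span_minimal)
        (auto simp: g_def subspace_def inner_diff_left inner_add_left)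
    with C(3) that show ?thesis using span_superset[of C] by blast
  qed
  moreover have "card S \<le> card C + 1"
  proof -
    have "S \<subseteq> span (insert s C)"
    proof
      fix r assume r: "r \<in> S"
      have "g r \<in> span (insert s C)"
        using C(3) r span_mono[of C "insert s C"] span_base[of "g r" "g ` S"] by blast
      then have "g r + ((r \<bullet> v) / (s \<bullet> v)) *\<^sub>R s \<in> span (insert s C)"
        by (intro span_add span_scale) (auto intro: span_base)
      then show "r \<in> span (insert s C)" by (simp add: g_def)
    qed
    then have "card S \<le> card (insert s C)"
      using C(1) orthonormal_independent[OF S(2)] by (intro independent_span_bound[THEN conjunct2]) auto
    with C(1) show ?thesis by (auto simp: card_insert_if split: if_splits)
  qed
  ultimately show ?thesis using C that by blast
qed

lemma orthonormal_avoid: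
  fixes S V :: "'a::real_inner set"
  assumes "finite V" and S: "finite S" "orthonormal S"
  obtains R where "finite R" "orthonormal R" "R \<subseteq> span S"
    "\<And>x v. x \<in> R \<Longrightarrow> v \<in> V \<Longrightarrow> x \<bullet> v = 0" "card S \<le> card R + card V"
proof -
  have "\<exists>R. finite R \<and> orthonormal R \<and> R \<subseteq> span S \<and> (\<forall>x\<in>R. \<forall>v\<in>V. x \<bullet> v = 0)
    \<and> card S \<le> card R + card V"
    using assms(1)
  proof (induction V)
    case empty
    with S show ?case by (intro exI[of _ S]) (auto intro: span_base)
  next
    case (insert v V)
    then obtain R where R: "finite R" "orthonormal R" "R \<subseteq> span S" "\<forall>x\<in>R. \<forall>v\<in>V. x \<bullet> v = 0"
      "card S \<le> card R + card V" by blast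
    obtain Q where Q: "finite Q" "orthonormal Q" "Q \<subseteq> span R" "\<And>x. x \<in> Q \<Longrightarrow> x \<bullet> v = 0"
      "card R \<le> card Q + 1"
      using orthonormal_avoid_vector[OF R(1,2)] by metis
    have "Q \<subseteq> span S"
      using Q(3) span_minimal[OF R(3) subspace_span] by blast
    moreover have "span R \<subseteq> {x. \<forall>v\<in>V. x \<bullet> v = 0}"
      using R(4) by (intro span_minimal) (auto simp: subspace_def inner_add_left)
    ultimately show ?case
      using Q R(5) insert.hyps by (intro exI[of _ Q]) auto
  qed
  then show thesis using that by blast
qed

section \<open>Adjoints\<close>

text \<open>The representing vector minimises \<open>norm x ^ 2 / 2 - \<phi> x\<close>. Minimising sequences are Cauchy by the
parallelogram law, and the first variation at the minimiser is the claim.\<close>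

lemma riesz_representation:
  fixes \<phi> :: "'a::{real_inner, banach} \<Rightarrow> real"
  assumes "bounded_linear \<phi>"
  shows "\<exists>z. \<forall>y. \<phi> y = y \<bullet> z"
proof -
  interpret bounded_linear \<phi> by fact
  define Q where "Q x = (norm x)\<^sup>2 / 2 - \<phi> x" for x
  obtain L where L: "\<And>x. \<bar>\<phi> x\<bar> \<le> norm x * L" using bounded by (auto)
  have low: "- (L\<^sup>2 / 2) \<le> Q x" for x
  proof -
    have "0 \<le> (norm x - L)\<^sup>2" by simp
    with L[of x] show ?thesis by (simp add: Q_def power2_diff)
  qed
  define m where "m = Inf (range Q)"
  have bdd: "bdd_below (range Q)" using low by (auto intro!: bdd_belowI2)
  have m: "m \<le> Q x" for x unfolding m_def by (rule cInf_lower[OF _ bdd]) simp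
  have "\<exists>x. Q x < m + 1 / real (Suc n)" for n
    using cInf_lessD[of "range Q" "m + 1 / real (Suc n)"] by (auto simp: m_def)
  then obtain x where x: "\<And>n. Q (x n) < m + 1 / real (Suc n)" by metis
  \<comment> \<open>The linear part cancels in the parallelogram law.\<close>
  have par: "(norm (a - b))\<^sup>2 / 4 = Q a + Q b - 2 * Q ((1/2) *\<^sub>R (a + b))" for a b
    by (simp add: Q_def add scale power2_norm_eq_inner inner_diff inner_add inner_commute field_simps)
  have "Cauchy x"
  proof (rule metric_CauchyI)
    fix e :: real assume e: "0 < e"
    obtain N where N: "8 / e\<^sup>2 < real N" using reals_Archimedean2 by blast
    show "\<exists>M. \<forall>k\<ge>M. \<forall>n\<ge>M. dist (x k) (x n) < e"
    proof (intro exI allI impI)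
      fix k n assume kn: "N \<le> k" "N \<le> n"
      have small: "Q (x k) < m + e\<^sup>2 / 8" if "N \<le> k" for k
      proof -
        have "8 / e\<^sup>2 < real (Suc k)" using N that by linarith
        then have "1 / real (Suc k) < e\<^sup>2 / 8" using e by (simp add: field_simps)
        with x[of k] show ?thesis by linarith
      qed
      have "(norm (x k - x n))\<^sup>2 / 4 < e\<^sup>2 / 4"
        using par[of "x k" "x n"] small[OF kn(1)] small[OF kn(2)] m[of "(1/2) *\<^sub>R (x k + x n)"] by linarith
      then have "(norm (x k - x n))\<^sup>2 < e\<^sup>2" by simp
      then show "dist (x k) (x n) < e" using e by (simp add: dist_norm power_less_imp_less_base)
    qed
  qed
  then obtain z where z: "x \<longlonglongrightarrow> z" using Cauchy_convergent_iff convergentD by blast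
  have "(\<lambda>n. Q (x n)) \<longlonglongrightarrow> Q z"
    unfolding Q_def by (intro tendsto_intros z tendsto) simp
  moreover have "(\<lambda>n. m + 1 / real (Suc n)) \<longlonglongrightarrow> m + 0"
    by (intro tendsto_intros LIMSEQ_Suc[OF lim_1_over_n])
  ultimately have "Q z \<le> m + 0"
    by (rule LIMSEQ_le) (use x less_imp_le in blast)
  then have zmin: "Q z \<le> Q y" for y using m[of y] by simp
  have "\<phi> y = y \<bullet> z" for y
  proof -
    define d where "d = z \<bullet> y - \<phi> y"
    have "Q (z + h *\<^sub>R y) = Q z + (h * d + h\<^sup>2 * ((norm y)\<^sup>2 / 2))" for h
    proof -
      have "(norm (z + h *\<^sub>R y))\<^sup>2 = (norm z)\<^sup>2 + 2 * h * (z \<bullet> y) + h\<^sup>2 * (norm y)\<^sup>2"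
        unfolding power2_norm_eq_inner inner_add_left inner_add_right inner_scaleR_left
          inner_scaleR_right by (simp only: inner_commute[of y z]) (simp add: power2_eq_square algebra_simps)
      then show ?thesis by (simp add: Q_def d_def add scale field_simps)
    qed
    then have q: "0 \<le> h * d + h\<^sup>2 * ((norm y)\<^sup>2 / 2)" for h
      using zmin[of "z + h *\<^sub>R y"] by simp
    have "d = 0"
    proof (rule ccontr)
      assume "d \<noteq> 0"
      \<comment> \<open>Almost the minimiser of the quadratic in \<open>q\<close>; adding one avoids dividing by zero.\<close>
      define h where "h = - d / ((norm y)\<^sup>2 + 1)"
      have p: "(norm y)\<^sup>2 + 1 > 0" by (smt (verit) zero_le_power2)
      have hd: "h * ((norm y)\<^sup>2 + 1) = - d" using p by (simp add: h_def)
      have "h * d + h\<^sup>2 * ((norm y)\<^sup>2 / 2) = h * (d + h * ((norm y)\<^sup>2 + 1) / 2) - h\<^sup>2 / 2"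
        by (simp add: power2_eq_square field_simps)
      also have "\<dots> = h * d / 2 - h\<^sup>2 / 2" by (simp add: hd)
      finally have "0 \<le> h * d / 2 - h\<^sup>2 / 2" using q[of h] by simp
      moreover have "h * d < 0"
      proof -
        have "h * d = - (d\<^sup>2 / ((norm y)\<^sup>2 + 1))" by (simp add: h_def power2_eq_square)
        then show ?thesis using p \<open>d \<noteq> 0\<close> by simp
      qed
      moreover have "0 \<le> h\<^sup>2" by simp
      ultimately show False by linarith
    qed
    then show ?thesis by (simp add: d_def inner_commute)
  qed
  then show ?thesis by blast
qed

lemma adjoint_inner:
  fixes T :: "'a::{real_inner, banach} \<Rightarrow>\<^sub>L 'b::real_inner"
  shows "T x \<bullet> y = x \<bullet> adjoint (blinfun_apply T) y"
proof -
  have "\<exists>z. \<forall>x. T x \<bullet> y = x \<bullet> z" for y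
    by (rule riesz_representation) (intro bounded_linear_intros)
  then have "\<exists>f'. \<forall>x y. T x \<bullet> y = x \<bullet> f' y" by metis
  from someI_ex[OF this] show ?thesis unfolding adjoint_def by blast
qed

lemma adjoint_bounded_linear:
  fixes T :: "'a::{real_inner, banach} \<Rightarrow>\<^sub>L 'b::real_inner"
  shows "bounded_linear (adjoint (blinfun_apply T))"
proof (rule bounded_linear_intro[where K = "norm T"])
  let ?A = "adjoint (blinfun_apply T)"
  show "?A (x + y) = ?A x + ?A y" for x y
    by (subst vector_eq_rdot[symmetric]) (simp add: inner_add_left inner_add_right inner_commute[of _ "?A _"] inner_commute[of "?A _"] flip: adjoint_inner)
  show "?A (r *\<^sub>R x) = r *\<^sub>R ?A x" for r x
    by (subst vector_eq_rdot[symmetric]) (simp add: inner_commute[of "?A _"] flip: adjoint_inner)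
  show "norm (?A x) \<le> norm x * norm T" for x
  proof -
    have "(norm (?A x))\<^sup>2 = T (?A x) \<bullet> x"
      by (simp add: power2_norm_eq_inner adjoint_inner)
    also have "\<dots> \<le> norm (T (?A x)) * norm x" by (rule norm_cauchy_schwarz)
    also have "\<dots> \<le> norm T * norm (?A x) * norm x"
      by (intro mult_right_mono norm_blinfun) simp
    finally have "norm (?A x) * norm (?A x) \<le> (norm x * norm T) * norm (?A x)"
      by (simp add: power2_eq_square mult_ac)
    then show ?thesis
      by (cases "?A x = 0") auto
  qed
qed


section \<open>The variational bound\<close>

lemma eigenspace_subspace:
  fixes T :: "'a::{real_inner, banach} \<Rightarrow>\<^sub>L 'b::real_inner"
  shows "subspace {x. adjoint (blinfun_apply T) (T x) = \<sigma>\<^sup>2 *\<^sub>R x}"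
proof -
  interpret bounded_linear "adjoint (blinfun_apply T)" by (rule adjoint_bounded_linear)
  show ?thesis
    by (auto simp: subspace_def zero add scale blinfun.add_right blinfun.scaleR_right scaleR_add_right)
qed

lemma orthonormal_basis_of_dim:
  fixes E :: "'a::real_inner set"
  assumes "subspace E" "0 < dim E"
  obtains S where "finite S" "orthonormal S" "span S = E" "card S = dim E"
proof -
  have ex: "\<exists>b. independent b \<and> span b = span E"
    using assms(2) by (auto simp: dim_def split: if_splits)
  then obtain b where b: "independent b" "span b = span E" by blast
  have "card b = dim E" using dim_eq_card[OF b(2,1)] by simp
  then have "finite b" using assms(2) card_gt_0_iff by metis
  then obtain C where C: "finite C" "orthonormal C" "span C = span b"
    using orthonormal_span_exists by blast
  show thesis
  proof (rule that)
    show "span C = E" using C(3) b(2) assms(1) by (simp add: span_eq_iff)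
    show "card C = dim E"
      using dim_eq_card[of C E] C(3) b(2) orthonormal_independent[OF C(2)] by simp
  qed (use C in auto)
qed

text \<open>Eigenvectors of \<open>T\<^sup>* T\<close> for different eigenvalues are orthogonal, and so are their images. On the span
of orthonormal bases of finitely many eigenspaces above \<open>u\<close>, the operator therefore expands by at
least \<open>u\<close>, and the size of any such orthonormal set bounds the sum of the multiplicities.\<close>

lemma eigen_dim_sum_le:
  fixes T :: "'a::{real_inner, banach} \<Rightarrow>\<^sub>L 'b::real_inner"
  assumes u: "0 < u"
    and bound: "\<And>S. finite S \<Longrightarrow> orthonormal S \<Longrightarrow> (\<And>x. x \<in> span S \<Longrightarrow> u * norm x \<le> norm (T x))
      \<Longrightarrow> real (card S) \<le> N"
    and F: "finite F" "\<And>\<sigma>. \<sigma> \<in> F \<Longrightarrow> u < \<sigma> \<and> 0 < eigen_dim T \<sigma>"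
  shows "real (\<Sum>\<sigma>\<in>F. eigen_dim T \<sigma>) \<le> N"
proof -
  let ?E = "\<lambda>\<sigma>. {x. adjoint (blinfun_apply T) (T x) = \<sigma>\<^sup>2 *\<^sub>R x}"
  have ex: "\<exists>S. finite S \<and> orthonormal S \<and> span S = ?E \<sigma> \<and> card S = eigen_dim T \<sigma>" (is "\<exists>S. ?P \<sigma> S") if "\<sigma> \<in> F" for \<sigma>
  proof -
    have "0 < dim (?E \<sigma>)" using F(2)[OF that] by (simp add: eigen_dim_def)
    then obtain S where "finite S" "orthonormal S" "span S = ?E \<sigma>" "card S = dim (?E \<sigma>)"
      by (rule orthonormal_basis_of_dim[OF eigenspace_subspace])
    then show ?thesis by (intro exI[of _ S]) (simp add: eigen_dim_def)
  qed
  define S where "S \<sigma> = (SOME S. ?P \<sigma> S)" for \<sigma>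
  have P: "?P \<sigma> (S \<sigma>)" if "\<sigma> \<in> F" for \<sigma>
    unfolding S_def using ex[OF that] by (rule someI_ex)
  have S: "finite (S \<sigma>)" "orthonormal (S \<sigma>)" "span (S \<sigma>) = ?E \<sigma>" "card (S \<sigma>) = eigen_dim T \<sigma>"
    if "\<sigma> \<in> F" for \<sigma>
    using P[OF that] by simp_all
  have SE: "adjoint (blinfun_apply T) (T x) = \<sigma>\<^sup>2 *\<^sub>R x" if "x \<in> S \<sigma>" "\<sigma> \<in> F" for x \<sigma>
    using S(3)[OF that(2)] span_base[OF that(1)] by blast
  have TT: "T x \<bullet> T y = \<sigma>\<^sup>2 * (x \<bullet> y)" if "x \<in> S \<sigma>" "\<sigma> \<in> F" for x y \<sigma>
  proof -
    have "T x \<bullet> T y = y \<bullet> adjoint (blinfun_apply T) (T x)"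
      by (subst inner_commute) (rule adjoint_inner)
    then show ?thesis by (simp add: SE[OF that] inner_commute)
  qed
  have orth: "x \<bullet> y = 0" if "x \<in> S \<sigma>" "\<sigma> \<in> F" "y \<in> S \<rho>" "\<rho> \<in> F" "\<sigma> \<noteq> \<rho>" for x y \<sigma> \<rho>
  proof -
    have "\<sigma>\<^sup>2 * (x \<bullet> y) = \<rho>\<^sup>2 * (x \<bullet> y)"
      using TT[OF that(1,2), of y] TT[OF that(3,4), of x] by (simp add: inner_commute)
    moreover have "\<sigma>\<^sup>2 \<noteq> \<rho>\<^sup>2"
      using F(2)[OF that(2)] F(2)[OF that(4)] u that(5) by (auto simp: power2_eq_iff)
    ultimately show ?thesis by auto
  qed
  define U where "U = (\<Union>\<sigma>\<in>F. S \<sigma>)"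
  have U: "finite U" using F S by (auto simp: U_def)
  have unit: "x \<bullet> x = 1" if "x \<in> S \<sigma>" "\<sigma> \<in> F" for x \<sigma>
    using S(2)[OF that(2)] that(1) by (auto simp: orthonormal_family_def)
  have disj: "S \<sigma> \<inter> S \<rho> = {}" if "\<sigma> \<in> F" "\<rho> \<in> F" "\<sigma> \<noteq> \<rho>" for \<sigma> \<rho>
    using orth[OF _ that(1) _ that(2,3)] unit[OF _ that(1)] by force
  have onU: "orthonormal U"
    unfolding orthonormal_family_def
  proof (intro ballI)
    fix x y assume "x \<in> U" "y \<in> U"
    then obtain \<sigma> \<rho> where *: "x \<in> S \<sigma>" "\<sigma> \<in> F" "y \<in> S \<rho>" "\<rho> \<in> F" by (auto simp: U_def)
    show "x \<bullet> y = (if x = y then 1 else 0)"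
    proof (cases "\<sigma> = \<rho>")
      case True
      with * S(2)[OF *(2)] show ?thesis by (simp add: orthonormal_family_def)
    next
      case False
      with orth[OF * False] unit[OF *(1,2)] show ?thesis by auto
    qed
  qed
  have "u * norm x \<le> norm (T x)" if "x \<in> span U" for x
  proof -
    define a where "a s = x \<bullet> s" for s
    have x: "x = (\<Sum>s\<in>U. a s *\<^sub>R s)"
      unfolding a_def by (rule orthonormal_expand[OF U onU that])
    have Ts: "u\<^sup>2 \<le> T s \<bullet> T s" "s' \<in> U \<Longrightarrow> s' \<noteq> s \<Longrightarrow> T s \<bullet> T s' = 0" if s: "s \<in> U" for s s'
    proof -
      obtain \<sigma> where \<sigma>: "s \<in> S \<sigma>" "\<sigma> \<in> F" using s by (auto simp: U_def)
      show "u\<^sup>2 \<le> T s \<bullet> T s"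
        using TT[OF \<sigma>, of s] unit[OF \<sigma>] F(2)[OF \<sigma>(2)] u by (simp add: power_mono)
      assume "s' \<in> U" "s' \<noteq> s"
      then have "s \<bullet> s' = 0" using onU s unfolding orthonormal_family_def by auto
      then show "T s \<bullet> T s' = 0" using TT[OF \<sigma>, of s'] by simp
    qed
    have "(u * norm x)\<^sup>2 = (\<Sum>s\<in>U. u\<^sup>2 * (a s)\<^sup>2)"
      by (simp add: power_mult_distrib x orthonormal_norm_sum[OF U onU] sum_distrib_left)
    also have "\<dots> \<le> (\<Sum>s\<in>U. (a s)\<^sup>2 * (T s \<bullet> T s))"
      using Ts(1) by (intro sum_mono) (simp add: mult.commute[of "u\<^sup>2"] mult_left_mono)
    also have "\<dots> = (\<Sum>s\<in>U. \<Sum>r\<in>U. if s = r then a s * a r * (T s \<bullet> T r) else 0)"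
      using U by (simp add: power2_eq_square)
    also have "\<dots> = (\<Sum>s\<in>U. \<Sum>r\<in>U. a s * a r * (T s \<bullet> T r))"
      by (intro sum.cong refl) (auto simp: Ts(2))
    also have "\<dots> = (\<Sum>r\<in>U. \<Sum>s\<in>U. a s * a r * (T s \<bullet> T r))" by (rule sum.swap)
    also have "\<dots> = T x \<bullet> T x"
      by (subst (1 2) x) (simp add: blinfun.sum_right blinfun.scaleR_right inner_sum_left
          inner_sum_right sum_distrib_left mult_ac)
    finally have "(u * norm x)\<^sup>2 \<le> (norm (T x))\<^sup>2" by (simp add: power2_norm_eq_inner)
    then show ?thesis using u by (auto intro: power2_le_imp_le)
  qed
  from bound[OF U onU this] have "real (card U) \<le> N" by blast
  moreover have "card U = (\<Sum>\<sigma>\<in>F. eigen_dim T \<sigma>)"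
    unfolding U_def using F S disj by (subst card_UN_disjoint) auto
  ultimately show ?thesis by simp
qed

text \<open>The variational bound: perpendicular to \<open>V\<close> the operator has squared Hilbert--Schmidt norm at most
\<open>\<eta>\<close>. A space on which it expands by at least \<open>u\<close> loses at most \<open>card V\<close> dimensions when it is
intersected with the orthogonal complement of \<open>V\<close>, and on the rest each dimension contributes at least
\<open>u\<^sup>2\<close> to \<open>\<eta>\<close>.\<close>

lemma eigen_count_le_avoiding:
  fixes T :: "'a::{real_inner, banach} \<Rightarrow>\<^sub>L 'b::real_inner"
  assumes u: "0 < u" and V: "finite V"
    and hs: "\<And>S. finite S \<Longrightarrow> orthonormal S \<Longrightarrow> (\<And>x v. x \<in> S \<Longrightarrow> v \<in> V \<Longrightarrow> x \<bullet> v = 0)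
      \<Longrightarrow> (\<Sum>x\<in>S. (norm (T x))\<^sup>2) \<le> \<eta>"
  shows "finite {\<sigma>. u < \<sigma> \<and> 0 < eigen_dim T \<sigma>}"
    and "real (eigen_count T u) \<le> real (card V) + \<eta> / u\<^sup>2"
proof -
  have bound: "real (card S) \<le> real (card V) + \<eta> / u\<^sup>2"
    if S: "finite S" "orthonormal S" "\<And>x. x \<in> span S \<Longrightarrow> u * norm x \<le> norm (T x)" for S
  proof -
    obtain R where R: "finite R" "orthonormal R" "R \<subseteq> span S"
      "\<And>x v. x \<in> R \<Longrightarrow> v \<in> V \<Longrightarrow> x \<bullet> v = 0" "card S \<le> card R + card V"
      using orthonormal_avoid[OF V S(1,2)] by metis
    have "real (card R) * u\<^sup>2 = (\<Sum>x\<in>R. u\<^sup>2)" by simp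
    also have "\<dots> \<le> (\<Sum>x\<in>R. (norm (T x))\<^sup>2)"
    proof (rule sum_mono)
      fix x assume x: "x \<in> R"
      have "norm x = 1" using R(2) x by (simp add: orthonormal_family_def norm_eq_1)
      with S(3)[of x] R(3) x have "u \<le> norm (T x)" by auto
      then show "u\<^sup>2 \<le> (norm (T x))\<^sup>2" using u by (intro power_mono) auto
    qed
    also have "\<dots> \<le> \<eta>" by (rule hs[OF R(1,2,4)])
    finally have "real (card R) \<le> \<eta> / u\<^sup>2" using u by (simp add: field_simps)
    with R(5) show ?thesis by linarith
  qed
  have le: "real (\<Sum>\<sigma>\<in>F. eigen_dim T \<sigma>) \<le> real (card V) + \<eta> / u\<^sup>2"
    if "finite F" "F \<subseteq> {\<sigma>. u < \<sigma> \<and> 0 < eigen_dim T \<sigma>}" for F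
    using that bound by (intro eigen_dim_sum_le[OF u]) auto
  show fin: "finite {\<sigma>. u < \<sigma> \<and> 0 < eigen_dim T \<sigma>}"
  proof (rule ccontr)
    assume inf: "infinite {\<sigma>. u < \<sigma> \<and> 0 < eigen_dim T \<sigma>}"
    obtain n :: nat where n: "real (card V) + \<eta> / u\<^sup>2 < real n" using reals_Archimedean2 by blast
    obtain F where F: "F \<subseteq> {\<sigma>. u < \<sigma> \<and> 0 < eigen_dim T \<sigma>}" "finite F" "card F = n"
      using infinite_arbitrarily_large[OF inf] by blast
    have "(\<Sum>\<sigma>\<in>F. 1) \<le> (\<Sum>\<sigma>\<in>F. eigen_dim T \<sigma>)"
      using F(1) by (intro sum_mono) (auto simp: Suc_le_eq)
    then have "n \<le> (\<Sum>\<sigma>\<in>F. eigen_dim T \<sigma>)" using F by simp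
    with le[OF F(2,1)] n show False by linarith
  qed
  show "real (eigen_count T u) \<le> real (card V) + \<eta> / u\<^sup>2"
    unfolding eigen_count_def using le[OF fin order_refl] .
qed

section \<open>Compactness\<close>

lemma compact_bounded_combinations:
  fixes v :: "'i \<Rightarrow> 'a::real_normed_vector"
  assumes "finite C"
  shows "compact {\<Sum>s\<in>C. a s *\<^sub>R v s |a. \<forall>s\<in>C. \<bar>a s\<bar> \<le> (1::real)}"
  using assms
proof (induction C)
  case (insert c C)
  let ?W = "{\<Sum>s\<in>C. a s *\<^sub>R v s |a. \<forall>s\<in>C. \<bar>a s\<bar> \<le> (1::real)}"
  have eq: "{\<Sum>s\<in>insert c C. a s *\<^sub>R v s |a. \<forall>s\<in>insert c C. \<bar>a s\<bar> \<le> 1}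
    = {x + y |x y. x \<in> (\<lambda>r. r *\<^sub>R v c) ` {-1..1} \<and> y \<in> ?W}" (is "?l = ?r")
  proof (intro antisym subsetI)
    fix z assume "z \<in> ?l"
    then obtain a where a: "z = (\<Sum>s\<in>insert c C. a s *\<^sub>R v s)" "\<forall>s\<in>insert c C. \<bar>a s\<bar> \<le> 1"
      by blast
    have "z = a c *\<^sub>R v c + (\<Sum>s\<in>C. a s *\<^sub>R v s)" using a(1) insert.hyps by simp
    moreover have "a c *\<^sub>R v c \<in> (\<lambda>r. r *\<^sub>R v c) ` {-1..1}" using a(2) by (auto simp: abs_le_iff)
    moreover have "(\<Sum>s\<in>C. a s *\<^sub>R v s) \<in> ?W" using a(2) by blast
    ultimately show "z \<in> ?r" by blast
  next
    fix z assume "z \<in> ?r"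
    then obtain r a where a: "z = r *\<^sub>R v c + (\<Sum>s\<in>C. a s *\<^sub>R v s)" "r \<in> {-1..1}"
      "\<forall>s\<in>C. \<bar>a s\<bar> \<le> 1" by blast
    have "(\<Sum>s\<in>C. a s *\<^sub>R v s) = (\<Sum>s\<in>C. (a(c := r)) s *\<^sub>R v s)"
      using insert.hyps by (intro sum.cong) auto
    then have "z = (\<Sum>s\<in>insert c C. (a(c := r)) s *\<^sub>R v s)"
      using insert.hyps a(1) by simp
    moreover have "\<forall>s\<in>insert c C. \<bar>(a(c := r)) s\<bar> \<le> 1" using a(2,3) by (auto simp: abs_le_iff)
    ultimately show "z \<in> ?l" by blast
  qed
  have "compact ((\<lambda>r. r *\<^sub>R v c) ` {-1..1::real})"
    by (intro compact_continuous_image continuous_intros) simp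
  then show ?case unfolding eq by (rule compact_sums[OF _ insert.IH])
qed simp

text \<open>Up to an error \<open>\<epsilon>\<close>, the image of the unit ball is the image of a ball in a space of finite dimension,
which is contained in a compact box. Hence the image is totally bounded.\<close>

lemma compact_operator_if_small_off_finite:
  fixes T :: "'a::{real_inner, banach} \<Rightarrow>\<^sub>L 'b::{real_inner, banach}"
  assumes small: "\<And>\<epsilon>. 0 < \<epsilon> \<Longrightarrow>
    \<exists>V. finite V \<and> (\<forall>x. (\<forall>v\<in>V. x \<bullet> v = 0) \<longrightarrow> norm (T x) \<le> \<epsilon> * norm x)"
  shows "compact_operator T"
proof -
  have "\<exists>k. finite k \<and> closure (T ` cball 0 1) \<subseteq> (\<Union>x\<in>k. ball x \<epsilon>)" if \<epsilon>: "0 < \<epsilon>" for \<epsilon>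
  proof -
    obtain V where V: "finite V" "\<And>x. (\<forall>v\<in>V. x \<bullet> v = 0) \<Longrightarrow> norm (T x) \<le> (\<epsilon> / 4) * norm x"
      using small[of "\<epsilon> / 4"] \<epsilon> by auto
    obtain C where C: "finite C" "orthonormal C" "span C = span V"
      using orthonormal_span_exists[OF V(1)] .
    define p where "p x = (\<Sum>s\<in>C. (x \<bullet> s) *\<^sub>R s)" for x
    have diff: "norm (T x - T (p x)) \<le> \<epsilon> / 4" if x: "norm x \<le> 1" for x
    proof -
      have perp: "(x - p x) \<bullet> s = 0" if s: "s \<in> C" for s
      proof -
        have "p x \<bullet> s = (\<Sum>r\<in>C. if r = s then x \<bullet> r else 0)"
          using C(2) s unfolding p_def inner_sum_left
          by (intro sum.cong) (auto simp: orthonormal_family_def)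
        then show ?thesis using C(1) s by (simp add: inner_diff_left)
      qed
      have "span C \<subseteq> {v. (x - p x) \<bullet> v = 0}"
        using perp by (intro span_minimal) (auto simp: subspace_def inner_add_right)
      then have "\<forall>v\<in>V. (x - p x) \<bullet> v = 0" using C(3) span_base[of _ V] by blast
      then have "norm (T (x - p x)) \<le> (\<epsilon> / 4) * norm (x - p x)" by (rule V(2))
      also have "norm (x - p x) \<le> 1"
      proof -
        have "0 \<le> (\<Sum>i\<in>C. (x \<bullet> i)\<^sup>2)" by (intro sum_nonneg) simp
        then have "(norm (x - p x))\<^sup>2 \<le> (norm x)\<^sup>2"
          using bessel_family[OF C(1,2), of x, folded p_def] by linarith
        then show ?thesis using x by (auto dest: power2_le_imp_le)
      qed
      finally have "norm (T (x - p x)) \<le> \<epsilon> / 4" using \<epsilon> by simp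
      then show ?thesis by (simp add: blinfun.diff_right)
    qed
    define W where "W = {\<Sum>s\<in>C. a s *\<^sub>R T s |a. \<forall>s\<in>C. \<bar>a s\<bar> \<le> 1}"
    have "compact W" unfolding W_def by (rule compact_bounded_combinations[OF C(1)])
    then obtain k where k: "finite k" "W \<subseteq> (\<Union>x\<in>k. ball x (\<epsilon> / 4))"
    proof -
      have "\<forall>e>0. \<exists>k. finite k \<and> W \<subseteq> (\<Union>x\<in>k. ball x e)"
        using \<open>compact W\<close> unfolding compact_eq_totally_bounded by (rule conjunct2)
      then show ?thesis using \<epsilon> that by (meson divide_pos_pos zero_less_numeral)
    qed
    have "T ` cball 0 1 \<subseteq> (\<Union>x\<in>k. cball x (\<epsilon> / 2))"
    proof
      fix y assume "y \<in> T ` cball 0 1"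
      then obtain x where x: "norm x \<le> 1" "y = T x" by auto
      have "\<bar>x \<bullet> s\<bar> \<le> 1" if "s \<in> C" for s
      proof -
        have "norm s = 1" using C(2) that by (simp add: orthonormal_family_def norm_eq_1)
        with Cauchy_Schwarz_ineq2[of x s] x(1) show ?thesis by simp
      qed
      moreover have "T (p x) = (\<Sum>s\<in>C. (x \<bullet> s) *\<^sub>R T s)"
        by (simp add: p_def blinfun.sum_right blinfun.scaleR_right)
      ultimately have "T (p x) \<in> W" unfolding W_def by blast
      then obtain z where z: "z \<in> k" "dist z (T (p x)) < \<epsilon> / 4" using k(2) by auto
      have "dist z y \<le> dist z (T (p x)) + dist (T (p x)) y" by (rule dist_triangle)
      also have "dist (T (p x)) y \<le> \<epsilon> / 4" using diff[OF x(1)] by (simp add: x(2) dist_norm norm_minus_commute)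
      finally have "dist z y \<le> \<epsilon> / 2" using z(2) by simp
      with z(1) show "y \<in> (\<Union>x\<in>k. cball x (\<epsilon> / 2))" by auto
    qed
    then have "closure (T ` cball 0 1) \<subseteq> (\<Union>x\<in>k. cball x (\<epsilon> / 2))"
      using k(1) by (intro closure_minimal closed_UN) auto
    also have "\<dots> \<subseteq> (\<Union>x\<in>k. ball x \<epsilon>)"
    proof (rule UN_mono[OF order_refl])
      show "cball x (\<epsilon> / 2) \<subseteq> ball x \<epsilon>" for x :: 'b
        using \<epsilon> by auto
    qed
    finally show ?thesis using k(1) by blast
  qed
  then show ?thesis
    unfolding compact_operator_def compact_eq_totally_bounded by (simp add: complete_eq_closed)
qed

section \<open>Diagonal operators\<close>

lemma orthonormal_basis_zero:
  fixes f :: "'i \<Rightarrow> 'a::real_inner"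
  assumes "orthonormal_basis I f" "\<And>p. p \<in> I \<Longrightarrow> y \<bullet> f p = 0"
  shows "y = 0"
proof -
  have "span (f ` I) \<subseteq> {x. y \<bullet> x = 0}"
    using assms(2) by (intro span_minimal) (auto simp: subspace_def inner_add_right)
  moreover have "closed {x. y \<bullet> x = 0}"
    by (intro closed_Collect_eq continuous_intros)
  ultimately have "closure (span (f ` I)) \<subseteq> {x. y \<bullet> x = 0}" by (rule closure_minimal)
  then have "y \<bullet> y = 0" using assms(1) unfolding orthonormal_basis_def by blast
  then show ?thesis by simp
qed

text \<open>
An operator mapping an orthonormal basis to orthogonal vectors of length \<open>l p\<close> has \<open>T\<^sup>* T\<close> diagonal,
and the eigenspace for \<open>\<sigma>\<^sup>2\<close> is spanned by the basis vectors with \<open>l p = \<sigma>\<close>.\<close>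

lemma
  fixes T :: "'b::{real_inner, banach} \<Rightarrow>\<^sub>L 'c::real_inner" and l :: "'i \<Rightarrow> real"
  assumes f: "orthonormal_basis I f"
    and T: "\<And>p q. p \<in> I \<Longrightarrow> q \<in> I \<Longrightarrow> T (f p) \<bullet> T (f q) = (if p = q then (l p)\<^sup>2 else 0)"
    and l: "\<And>p. p \<in> I \<Longrightarrow> 0 < l p"
    and fin: "\<And>u. 0 < u \<Longrightarrow> finite {p\<in>I. u < l p}"
  shows diagonal_discrete_spectrum: "discrete_spectrum T"
    and diagonal_eigen_count: "0 < u \<Longrightarrow> eigen_count T u = card {p\<in>I. u < l p}"
proof -
  let ?A = "adjoint (blinfun_apply T)"
  have on: "orthonormal_family I f" using f by (simp add: orthonormal_basis_def)
  have ff: "f p \<bullet> f q = (if p = q then 1 else 0)" if "p \<in> I" "q \<in> I" for p q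
    using on that by (auto simp: orthonormal_family_def)
  have inj: "inj_on f I"
  proof (rule inj_onI)
    fix p q assume "p \<in> I" "q \<in> I" "f p = f q"
    then show "p = q" using ff[of p q] ff[of q q] by (auto split: if_splits)
  qed
  have TA: "T (f p) \<bullet> T y = (l p)\<^sup>2 * (f p \<bullet> y)" if p: "p \<in> I" for p y
  proof -
    have "(?A (T (f p)) - (l p)\<^sup>2 *\<^sub>R f p) \<bullet> f q = 0" if q: "q \<in> I" for q
    proof -
      have "f q \<bullet> ?A (T (f p)) = T (f q) \<bullet> T (f p)" by (rule adjoint_inner[symmetric])
      then show ?thesis
        using T[OF q p] ff[OF q p] by (auto simp: inner_commute[of _ "f q"] inner_diff_right)
    qed
    from orthonormal_basis_zero[OF f this] have A: "?A (T (f p)) = (l p)\<^sup>2 *\<^sub>R f p" by simp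
    have "T (f p) \<bullet> T y = y \<bullet> ?A (T (f p))" by (subst inner_commute) (rule adjoint_inner)
    then show ?thesis by (simp add: A inner_commute)
  qed
  have A: "?A (T (f p)) = (l p)\<^sup>2 *\<^sub>R f p" if p: "p \<in> I" for p
  proof (subst vector_eq_ldot[symmetric], rule allI)
    fix y
    have "y \<bullet> ?A (T (f p)) = T y \<bullet> T (f p)" by (rule adjoint_inner[symmetric])
    then show "y \<bullet> ?A (T (f p)) = y \<bullet> (l p)\<^sup>2 *\<^sub>R f p"
      using TA[OF p, of y] by (simp add: inner_commute)
  qed
  have dim: "eigen_dim T \<sigma> = card {p\<in>I. l p = \<sigma>}" if \<sigma>: "0 < \<sigma>" for \<sigma>
  proof -
    let ?P = "{p\<in>I. l p = \<sigma>}" and ?E = "{x. ?A (T x) = \<sigma>\<^sup>2 *\<^sub>R x}"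
    have finP: "finite ?P" by (rule finite_subset[OF _ fin[of "\<sigma> / 2"]]) (use \<sigma> in auto)
    have S: "orthonormal (f ` ?P)"
      using ff inj by (auto simp: orthonormal_family_def dest: inj_onD)
    have "?E \<subseteq> span (f ` ?P)"
    proof
      fix x assume x: "x \<in> ?E"
      have 0: "x \<bullet> f p = 0" if p: "p \<in> I" "l p \<noteq> \<sigma>" for p
      proof -
        have "T (f p) \<bullet> T x = f p \<bullet> ?A (T x)" by (rule adjoint_inner)
        then have "((l p)\<^sup>2 - \<sigma>\<^sup>2) * (f p \<bullet> x) = 0" using x TA[OF p(1), of x] by (simp add: algebra_simps)
        moreover have "(l p)\<^sup>2 \<noteq> \<sigma>\<^sup>2" using l[OF p(1)] \<sigma> p(2) by (auto simp: power2_eq_iff)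
        ultimately show ?thesis by (simp add: inner_commute)
      qed
      define y where "y = x - (\<Sum>p\<in>?P. (x \<bullet> f p) *\<^sub>R f p)"
      have "y \<bullet> f q = 0" if q: "q \<in> I" for q
      proof -
        have "(\<Sum>p\<in>?P. (x \<bullet> f p) *\<^sub>R f p) \<bullet> f q = (\<Sum>p\<in>?P. if p = q then x \<bullet> f q else 0)"
          unfolding inner_sum_left using ff q by (intro sum.cong) auto
        then show ?thesis using finP q 0[OF q] by (auto simp: y_def inner_diff_left)
      qed
      then have "y = 0" by (rule orthonormal_basis_zero[OF f])
      then have "x = (\<Sum>p\<in>?P. (x \<bullet> f p) *\<^sub>R f p)" by (simp add: y_def)
      moreover have "(\<Sum>p\<in>?P. (x \<bullet> f p) *\<^sub>R f p) \<in> span (f ` ?P)"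
        by (intro span_sum span_scale span_base) auto
      ultimately show "x \<in> span (f ` ?P)" by simp
    qed
    moreover have "span (f ` ?P) \<subseteq> ?E"
      using A by (intro span_minimal eigenspace_subspace) auto
    ultimately have "?E = span (f ` ?P)" by auto
    then have "eigen_dim T \<sigma> = card (f ` ?P)"
      unfolding eigen_dim_def using orthonormal_independent[OF S] by (simp add: dim_eq_card_independent)
    also have "\<dots> = card ?P" using inj by (intro card_image) (auto simp: inj_on_def)
    finally show ?thesis .
  qed
  have lev: "{\<sigma>. u < \<sigma> \<and> 0 < eigen_dim T \<sigma>} = l ` {p\<in>I. u < l p}" if u: "0 < u" for u
  proof (intro set_eqI iffI)
    fix \<sigma> assume "\<sigma> \<in> {\<sigma>. u < \<sigma> \<and> 0 < eigen_dim T \<sigma>}"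
    then have "u < \<sigma>" "0 < card {p\<in>I. l p = \<sigma>}" using dim[of \<sigma>] u by auto
    then have "{p\<in>I. l p = \<sigma>} \<noteq> {}" by (metis card.empty less_irrefl)
    with \<open>u < \<sigma>\<close> show "\<sigma> \<in> l ` {p\<in>I. u < l p}" by auto
  next
    fix \<sigma> assume "\<sigma> \<in> l ` {p\<in>I. u < l p}"
    then obtain p where p: "p \<in> I" "u < l p" "\<sigma> = l p" by auto
    have "finite {p\<in>I. l p = \<sigma>}" by (rule finite_subset[OF _ fin[OF u]]) (use p in auto)
    then have "0 < card {p\<in>I. l p = \<sigma>}" using p by (auto simp: card_gt_0_iff)
    then show "\<sigma> \<in> {\<sigma>. u < \<sigma> \<and> 0 < eigen_dim T \<sigma>}" using dim[of \<sigma>] u p by auto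
  qed
  show "discrete_spectrum T" unfolding discrete_spectrum_def using lev fin by simp
  show "eigen_count T u = card {p\<in>I. u < l p}" if u: "0 < u"
  proof -
    have "eigen_count T u = (\<Sum>\<sigma>\<in>l ` {p\<in>I. u < l p}. card {p\<in>I. l p = \<sigma>})"
      unfolding eigen_count_def lev[OF u] using u by (intro sum.cong refl dim) auto
    also have "\<dots> = card (\<Union>\<sigma>\<in>l ` {p\<in>I. u < l p}. {p\<in>I. l p = \<sigma>})"
    proof (subst card_UN_disjoint)
      show "\<forall>\<sigma>\<in>l ` {p\<in>I. u < l p}. finite {p\<in>I. l p = \<sigma>}"
        by (auto intro!: finite_subset[OF _ fin[OF u]])
    qed (use fin[OF u] in auto)
    also have "(\<Union>\<sigma>\<in>l ` {p\<in>I. u < l p}. {p\<in>I. l p = \<sigma>}) = {p\<in>I. u < l p}" by auto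
    finally show ?thesis .
  qed
qed

section \<open>Skew operators that are small off finitely many directions\<close>

text \<open>The hypothesis on \<open>z\<close> says that \<open>z\<close> lies in the closed span of the \<open>e i\<close>. These need not be a basis of
the whole space, because the covariance may have a kernel.\<close>

lemma parseval_on_span:
  fixes e :: "nat \<Rightarrow> 'a::{real_inner, banach}"
  assumes e: "orthonormal_family {1..} e"
    and z: "\<And>x. (\<And>i. 1 \<le> i \<Longrightarrow> x \<bullet> e i = 0) \<Longrightarrow> z \<bullet> x = 0"
  shows "(\<lambda>N. \<Sum>i\<in>{1..N}. (z \<bullet> e i)\<^sup>2) \<longlonglongrightarrow> (norm z)\<^sup>2"
proof -
  define p where "p N = (\<Sum>i\<in>{1..N}. (z \<bullet> e i) *\<^sub>R e i)" for N
  have on: "orthonormal_family I e" if "I \<subseteq> {1..}" for I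
    using e that unfolding orthonormal_family_def by blast
  have nrm: "(norm (\<Sum>i\<in>I. (z \<bullet> e i) *\<^sub>R e i))\<^sup>2 = (\<Sum>i\<in>I. (z \<bullet> e i)\<^sup>2)" if I: "finite I" "I \<subseteq> {1..}" for I
  proof -
    let ?v = "\<Sum>i\<in>I. (z \<bullet> e i) *\<^sub>R e i"
    have "(norm ?v)\<^sup>2 = (\<Sum>i\<in>I. \<Sum>j\<in>I. (z \<bullet> e i) * ((z \<bullet> e j) * (e j \<bullet> e i)))"
      by (simp add: power2_norm_eq_inner inner_sum_left inner_sum_right sum_distrib_left)
    also have "\<dots> = (\<Sum>i\<in>I. \<Sum>j\<in>I. if i = j then (z \<bullet> e i) * (z \<bullet> e j) else 0)"
      using on[OF I(2)] by (intro sum.cong) (auto simp: orthonormal_family_def)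
    also have "\<dots> = (\<Sum>i\<in>I. (z \<bullet> e i)\<^sup>2)" using I(1) by (simp add: power2_eq_square)
    finally show ?thesis .
  qed
  define S where "S N = (\<Sum>i\<in>{1..N}. (z \<bullet> e i)\<^sup>2)" for N
  have diff: "(norm (p N - p m))\<^sup>2 = S N - S m" if "m \<le> N" for m N
  proof -
    have U: "{1..N} = {1..m} \<union> {m<..N}" using that by auto
    have "p N = p m + (\<Sum>i\<in>{m<..N}. (z \<bullet> e i) *\<^sub>R e i)" "S N = S m + (\<Sum>i\<in>{m<..N}. (z \<bullet> e i)\<^sup>2)"
      unfolding p_def S_def U by (rule sum.union_disjoint; auto)+
    moreover have "{m<..N} \<subseteq> {1..}" by (auto simp: Suc_le_eq)
    ultimately show ?thesis using nrm[of "{m<..N}"] by simp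
  qed
  have "bdd_above (range S)"
    unfolding S_def using bessel_inequality[OF _ on, of _ z]
    by (intro bdd_aboveI2[where M = "(norm z)\<^sup>2"]) auto
  moreover have "incseq S" unfolding S_def by (intro monoI sum_mono2) auto
  ultimately have "convergent S" using LIMSEQ_incseq_SUP by (auto simp: convergent_def)
  then have CS: "Cauchy S" by (rule convergent_Cauchy)
  have "Cauchy p"
  proof (rule metric_CauchyI)
    fix r :: real assume r: "0 < r"
    obtain M where M: "\<And>m n. M \<le> m \<Longrightarrow> M \<le> n \<Longrightarrow> dist (S m) (S n) < r\<^sup>2"
      using metric_CauchyD[OF CS, of "r\<^sup>2"] r by auto
    have le: "dist (p n) (p m) < r" if "M \<le> m" "m \<le> n" for m n
    proof -
      have "(norm (p n - p m))\<^sup>2 < r\<^sup>2"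
        using diff[OF that(2)] M[of n m] that by (simp add: dist_real_def)
      then show ?thesis using r by (simp add: dist_norm power_less_imp_less_base)
    qed
    show "\<exists>M. \<forall>m\<ge>M. \<forall>n\<ge>M. dist (p m) (p n) < r"
    proof (intro exI allI impI)
      fix m n assume "M \<le> m" "M \<le> n"
      then show "dist (p m) (p n) < r"
        using le[of m n] le[of n m] by (cases "m \<le> n") (auto simp: dist_commute)
    qed
  qed
  then obtain q where q: "p \<longlonglongrightarrow> q" using Cauchy_convergent_iff convergentD by blast
  have qe: "(z - q) \<bullet> e j = 0" if j: "1 \<le> j" for j
  proof -
    have "(\<lambda>N. p N \<bullet> e j) \<longlonglongrightarrow> q \<bullet> e j" by (intro tendsto_intros q)
    moreover have "\<forall>\<^sub>F N in sequentially. p N \<bullet> e j = z \<bullet> e j"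
      using eventually_ge_at_top[of j]
    proof eventually_elim
      case (elim N)
      have "p N \<bullet> e j = (\<Sum>i\<in>{1..N}. if i = j then z \<bullet> e i else 0)"
        unfolding p_def inner_sum_left using e j by (intro sum.cong) (auto simp: orthonormal_family_def)
      then show ?case using elim j by simp
    qed
    ultimately have "(\<lambda>N. z \<bullet> e j) \<longlonglongrightarrow> q \<bullet> e j" by (rule Lim_transform_eventually)
    then have "q \<bullet> e j = z \<bullet> e j" by (simp add: LIMSEQ_const_iff)
    then show ?thesis by (simp add: inner_diff_left)
  qed
  have "z \<bullet> (z - q) = 0" by (rule z) (rule qe)
  moreover have "q \<bullet> (z - q) = 0"
  proof -
    have "p N \<bullet> (z - q) = 0" for N
      unfolding p_def inner_sum_left using qe by (intro sum.neutral) (auto simp: inner_commute)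
    moreover have "(\<lambda>N. p N \<bullet> (z - q)) \<longlonglongrightarrow> q \<bullet> (z - q)" by (intro tendsto_intros q)
    ultimately show ?thesis by (simp add: LIMSEQ_const_iff)
  qed
  ultimately have "(z - q) \<bullet> (z - q) = 0" by (simp only: inner_diff_left[of z q "z - q"])
  then have "q = z" by simp
  then have "(\<lambda>N. (norm (p N))\<^sup>2) \<longlonglongrightarrow> (norm z)\<^sup>2" using q by (intro tendsto_intros) simp
  then show ?thesis using nrm[of "{1..N}" for N] by (simp add: p_def)
qed

text \<open>Only the entries beyond \<open>n\<close> in both indices matter. The column indices up to \<open>n\<close> disappear because
\<open>S\<close> is perpendicular to \<open>e i\<close>. By skewness the rows up to \<open>n\<close> disappear as well, because \<open>S\<close> is
perpendicular to \<open>T (e i)\<close>. Bessel's inequality for \<open>S\<close> bounds the rest row by row.\<close>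

lemma skew_hilbert_schmidt_bound:
  fixes e :: "nat \<Rightarrow> 'a::{real_inner, banach}" and T :: "'a \<Rightarrow>\<^sub>L 'a"
  assumes e: "orthonormal_family {1..} e"
    and skew: "\<And>x y. T x \<bullet> y = - (x \<bullet> T y)"
    and kill: "\<And>x y. (\<And>i. 1 \<le> i \<Longrightarrow> x \<bullet> e i = 0) \<Longrightarrow> T y \<bullet> x = 0"
    and S: "finite S" "orthonormal S"
    and avoid: "\<And>x i. x \<in> S \<Longrightarrow> 1 \<le> i \<Longrightarrow> i \<le> n \<Longrightarrow> x \<bullet> e i = 0 \<and> x \<bullet> T (e i) = 0"
    and bound: "\<And>N. (\<Sum>(i, j)\<in>{n<..N} \<times> {n<..N}. (T (e j) \<bullet> e i)\<^sup>2) \<le> \<eta>"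
  shows "(\<Sum>x\<in>S. (norm (T x))\<^sup>2) \<le> \<eta>"
proof -
  have on: "orthonormal_family I e" if "I \<subseteq> {1..}" for I
    using e that unfolding orthonormal_family_def by blast
  define q where "q i = T (e i) - (\<Sum>j\<in>{1..n}. (T (e i) \<bullet> e j) *\<^sub>R e j)" for i
  have q_lim: "(\<lambda>N. \<Sum>j\<in>{n<..N}. (T (e i) \<bullet> e j)\<^sup>2) \<longlonglongrightarrow> (norm (q i))\<^sup>2" for i
  proof -
    have "(\<lambda>N. (\<Sum>j\<in>{1..N}. (T (e i) \<bullet> e j)\<^sup>2) - (\<Sum>j\<in>{1..n}. (T (e i) \<bullet> e j)\<^sup>2)) \<longlonglongrightarrow>
        (norm (T (e i)))\<^sup>2 - (\<Sum>j\<in>{1..n}. (T (e i) \<bullet> e j)\<^sup>2)"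
      by (intro tendsto_diff tendsto_const parseval_on_span[OF e] kill)
    also have "(norm (T (e i)))\<^sup>2 - (\<Sum>j\<in>{1..n}. (T (e i) \<bullet> e j)\<^sup>2) = (norm (q i))\<^sup>2"
      using bessel_family[of "{1..n}" e "T (e i)"] on[of "{1..n}"] by (auto simp: q_def)
    finally show ?thesis
    proof (rule Lim_transform_eventually)
      show "\<forall>\<^sub>F N in sequentially. (\<Sum>j\<in>{1..N}. (T (e i) \<bullet> e j)\<^sup>2) - (\<Sum>j\<in>{1..n}. (T (e i) \<bullet> e j)\<^sup>2)
          = (\<Sum>j\<in>{n<..N}. (T (e i) \<bullet> e j)\<^sup>2)"
        using eventually_ge_at_top[of n]
      proof eventually_elim
        case (elim N)
        have U: "{1..N} = {1..n} \<union> {n<..N}" using elim by auto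
        show ?case unfolding U by (subst sum.union_disjoint) auto
      qed
    qed
  qed
  have xq: "(T x \<bullet> e i)\<^sup>2 = (q i \<bullet> x)\<^sup>2" if x: "x \<in> S" for x i
  proof -
    have "q i \<bullet> x = T (e i) \<bullet> x - (\<Sum>j\<in>{1..n}. (T (e i) \<bullet> e j) * (e j \<bullet> x))"
      by (simp add: q_def inner_diff_left inner_sum_left)
    also have "(\<Sum>j\<in>{1..n}. (T (e i) \<bullet> e j) * (e j \<bullet> x)) = 0"
      using avoid[OF x] by (intro sum.neutral) (auto simp: inner_commute[of _ x])
    also have "T (e i) \<bullet> x - 0 = - (T x \<bullet> e i)" using skew[of x "e i"] by (simp add: inner_commute)
    finally show ?thesis by simp
  qed
  have part: "(\<Sum>x\<in>S. \<Sum>i\<in>{1..N}. (T x \<bullet> e i)\<^sup>2) \<le> \<eta>" for N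
  proof -
    have "(\<Sum>i\<in>{1..N}. (T x \<bullet> e i)\<^sup>2) = (\<Sum>i\<in>{n<..N}. (q i \<bullet> x)\<^sup>2)" if x: "x \<in> S" for x
    proof -
      have "(\<Sum>i\<in>{1..N}. (T x \<bullet> e i)\<^sup>2) = (\<Sum>i\<in>{n<..N}. (T x \<bullet> e i)\<^sup>2)"
      proof (rule sum.mono_neutral_right)
        show "\<forall>i\<in>{1..N} - {n<..N}. (T x \<bullet> e i)\<^sup>2 = 0"
          using avoid[OF x] skew[of x] by auto
      qed auto
      then show ?thesis using xq[OF x] by simp
    qed
    then have "(\<Sum>x\<in>S. \<Sum>i\<in>{1..N}. (T x \<bullet> e i)\<^sup>2) = (\<Sum>x\<in>S. \<Sum>i\<in>{n<..N}. (q i \<bullet> x)\<^sup>2)" by simp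
    also have "\<dots> = (\<Sum>i\<in>{n<..N}. \<Sum>x\<in>S. (q i \<bullet> x)\<^sup>2)" by (rule sum.swap)
    also have "\<dots> \<le> (\<Sum>i\<in>{n<..N}. (norm (q i))\<^sup>2)"
      using bessel_inequality[OF S] by (intro sum_mono) auto
    also have "\<dots> \<le> \<eta>"
    proof (rule LIMSEQ_le_const2)
      show "(\<lambda>N'. \<Sum>i\<in>{n<..N}. \<Sum>j\<in>{n<..N'}. (T (e i) \<bullet> e j)\<^sup>2) \<longlonglongrightarrow> (\<Sum>i\<in>{n<..N}. (norm (q i))\<^sup>2)"
        by (intro tendsto_sum q_lim)
      show "\<exists>K. \<forall>N'\<ge>K. (\<Sum>i\<in>{n<..N}. \<Sum>j\<in>{n<..N'}. (T (e i) \<bullet> e j)\<^sup>2) \<le> \<eta>"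
      proof (intro exI allI impI)
        fix N' assume "N \<le> N'"
        have "(\<Sum>i\<in>{n<..N}. \<Sum>j\<in>{n<..N'}. (T (e i) \<bullet> e j)\<^sup>2) \<le> (\<Sum>i\<in>{n<..N'}. \<Sum>j\<in>{n<..N'}. (T (e i) \<bullet> e j)\<^sup>2)"
          using \<open>N \<le> N'\<close> by (intro sum_mono2 sum_nonneg) auto
        also have "\<dots> = (\<Sum>j\<in>{n<..N'}. \<Sum>i\<in>{n<..N'}. (T (e i) \<bullet> e j)\<^sup>2)" by (rule sum.swap)
        also have "\<dots> = (\<Sum>(i, j)\<in>{n<..N'} \<times> {n<..N'}. (T (e j) \<bullet> e i)\<^sup>2)" by (simp add: sum.cartesian_product)
        also have "\<dots> \<le> \<eta>" by (rule bound)
        finally show "(\<Sum>i\<in>{n<..N}. \<Sum>j\<in>{n<..N'}. (T (e i) \<bullet> e j)\<^sup>2) \<le> \<eta>" .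
      qed
    qed
    finally show ?thesis .
  qed
  have "(\<lambda>N. \<Sum>x\<in>S. \<Sum>i\<in>{1..N}. (T x \<bullet> e i)\<^sup>2) \<longlonglongrightarrow> (\<Sum>x\<in>S. (norm (T x))\<^sup>2)"
    by (intro tendsto_sum parseval_on_span[OF e] kill)
  then show ?thesis by (rule LIMSEQ_le_const2) (use part in auto)
qed

lemma Alt2_apply:
  fixes T :: "'a::{real_inner, banach} \<Rightarrow>\<^sub>L 'a"
  shows "Alt2 T x \<bullet> y = (T x \<bullet> y - T y \<bullet> x) / 2"
proof -
  have "Alt2 T x = (1 / 2) *\<^sub>R (T x - adjoint (blinfun_apply T) x)"
    by (simp add: Alt2_def blinfun.scaleR_left blinfun.diff_left bounded_linear_Blinfun_apply adjoint_bounded_linear)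
  moreover have "adjoint (blinfun_apply T) x \<bullet> y = T y \<bullet> x"
    by (simp add: inner_commute[of _ y] adjoint_inner)
  ultimately show ?thesis by (simp add: inner_diff_left)
qed

lemma Alt2_skew:
  fixes T :: "'a::{real_inner, banach} \<Rightarrow>\<^sub>L 'a"
  shows "Alt2 T x \<bullet> y = - (x \<bullet> Alt2 T y)"
  using Alt2_apply[of T x y] Alt2_apply[of T y x] by (simp add: inner_commute[of x])

text \<open>Antisymmetrisation is an orthogonal projection in the Hilbert--Schmidt norm.\<close>

lemma antisymmetrised_square_sum_le:
  fixes r :: "nat \<Rightarrow> nat \<Rightarrow> real"
  assumes "finite J"
  shows "(\<Sum>(i, j)\<in>J \<times> J. ((r i j - r j i) / 2)\<^sup>2) \<le> (\<Sum>(i, j)\<in>J \<times> J. (r i j)\<^sup>2)"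
proof -
  have "(\<Sum>(i, j)\<in>J \<times> J. ((r i j - r j i) / 2)\<^sup>2) \<le> (\<Sum>(i, j)\<in>J \<times> J. (r i j)\<^sup>2 / 2 + (r j i)\<^sup>2 / 2)"
  proof (intro sum_mono, clarify)
    fix i j
    have "0 \<le> ((r i j + r j i) / 2)\<^sup>2" by simp
    also have "\<dots> = (r i j)\<^sup>2 / 2 + (r j i)\<^sup>2 / 2 - ((r i j - r j i) / 2)\<^sup>2"
      by (simp add: power2_eq_square field_simps)
    finally show "((r i j - r j i) / 2)\<^sup>2 \<le> (r i j)\<^sup>2 / 2 + (r j i)\<^sup>2 / 2" by simp
  qed
  also have "\<dots> = (\<Sum>i\<in>J. \<Sum>j\<in>J. (r i j)\<^sup>2 / 2) + (\<Sum>i\<in>J. \<Sum>j\<in>J. (r j i)\<^sup>2 / 2)"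
    by (simp add: sum.distrib flip: sum.cartesian_product)
  also have "(\<Sum>i\<in>J. \<Sum>j\<in>J. (r j i)\<^sup>2 / 2) = (\<Sum>i\<in>J. \<Sum>j\<in>J. (r i j)\<^sup>2 / 2)" by (rule sum.swap)
  also have "(\<Sum>i\<in>J. \<Sum>j\<in>J. (r i j)\<^sup>2 / 2) + (\<Sum>i\<in>J. \<Sum>j\<in>J. (r i j)\<^sup>2 / 2) = (\<Sum>(i, j)\<in>J \<times> J. (r i j)\<^sup>2)"
    by (simp add: sum.cartesian_product flip: sum_divide_distrib)
  finally show ?thesis .
qed

text \<open>Perpendicular to all \<open>u k\<close> and \<open>v k\<close> the antisymmetrisation of \<open>J\<close> vanishes, so there the
antisymmetrisation of \<open>T\<close> is that of the remainder \<open>T - J\<close>. Avoiding also \<open>e i\<close> and its image for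
\<open>i \<le> n\<close> leaves only the entries that \<open>bound\<close> controls.\<close>

lemma Alt2_small_off_directions:
  fixes e :: "nat \<Rightarrow> 'a::{real_inner, banach}" and T J :: "'a \<Rightarrow>\<^sub>L 'a"
  assumes e: "orthonormal_family {1..} e"
    and J: "\<And>x y. J x \<bullet> y = (\<Sum>k<m. (u k \<bullet> y) * (v k \<bullet> x))"
    and kill: "\<And>x y. (\<And>i. 1 \<le> i \<Longrightarrow> x \<bullet> e i = 0) \<Longrightarrow> T x \<bullet> y = 0 \<and> T y \<bullet> x = 0"
      "\<And>x k. (\<And>i. 1 \<le> i \<Longrightarrow> x \<bullet> e i = 0) \<Longrightarrow> k < m \<Longrightarrow> u k \<bullet> x = 0 \<and> v k \<bullet> x = 0"
    and bound: "\<And>N. (\<Sum>(i, j)\<in>{n<..N} \<times> {n<..N}. ((T (e j) - J (e j)) \<bullet> e i)\<^sup>2) \<le> \<eta>"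
  obtains V where "finite V" "card V \<le> 2 * m + 2 * n"
    "\<And>S. finite S \<Longrightarrow> orthonormal S \<Longrightarrow> (\<And>x w. x \<in> S \<Longrightarrow> w \<in> V \<Longrightarrow> x \<bullet> w = 0)
      \<Longrightarrow> (\<Sum>x\<in>S. (norm (Alt2 T x))\<^sup>2) \<le> \<eta>"
proof -
  define R where "R = T - J"
  define V where "V = u ` {..<m} \<union> v ` {..<m} \<union> e ` {1..n} \<union> (\<lambda>i. Alt2 R (e i)) ` {1..n}"
  have Jk: "J x \<bullet> y = 0 \<and> J y \<bullet> x = 0" if "\<And>i. 1 \<le> i \<Longrightarrow> x \<bullet> e i = 0" for x y
    using kill(2)[OF that] by (simp add: J)
  have Rk: "Alt2 R y \<bullet> x = 0" if "\<And>i. 1 \<le> i \<Longrightarrow> x \<bullet> e i = 0" for x y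
    using kill(1)[OF that] Jk[OF that] by (simp add: Alt2_apply R_def blinfun.diff_left inner_diff_left)
  have Rb: "(\<Sum>(i, j)\<in>{n<..N} \<times> {n<..N}. (Alt2 R (e j) \<bullet> e i)\<^sup>2) \<le> \<eta>" for N
    using antisymmetrised_square_sum_le[of "{n<..N}" "\<lambda>i j. R (e j) \<bullet> e i"] bound[of N]
    by (simp add: Alt2_apply R_def blinfun.diff_left)
  show thesis
  proof (rule that)
    show "finite V" by (simp add: V_def)
    have "card V \<le> card (u ` {..<m}) + card (v ` {..<m}) + card (e ` {1..n}) + card ((\<lambda>i. Alt2 R (e i)) ` {1..n})"
      unfolding V_def by (intro order_trans[OF card_Un_le] add_right_mono order_refl)
    also have "\<dots> \<le> m + m + n + n"
      using card_image_le[of "{..<m}" u] card_image_le[of "{..<m}" v] card_image_le[of "{1..n}" e]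
        card_image_le[of "{1..n}" "\<lambda>i. Alt2 R (e i)"] by simp
    finally show "card V \<le> 2 * m + 2 * n" by simp
    fix S assume S: "finite S" "orthonormal S" "\<And>x w. x \<in> S \<Longrightarrow> w \<in> V \<Longrightarrow> x \<bullet> w = 0"
    have eq: "Alt2 T x = Alt2 R x" if x: "x \<in> S" for x
    proof -
      have "u k \<bullet> x = 0" "v k \<bullet> x = 0" if "k < m" for k
        using S(3)[OF x, of "u k"] S(3)[OF x, of "v k"] that by (auto simp: V_def inner_commute)
      then have "J x \<bullet> y = 0" "J y \<bullet> x = 0" for y by (simp_all add: J)
      then have "Alt2 T x \<bullet> y = Alt2 R x \<bullet> y" for y
        by (simp add: Alt2_apply R_def blinfun.diff_left inner_diff_left)
      then show ?thesis using vector_eq_rdot by blast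
    qed
    have "(\<Sum>x\<in>S. (norm (Alt2 R x))\<^sup>2) \<le> \<eta>"
    proof (rule skew_hilbert_schmidt_bound[OF e Alt2_skew Rk S(1,2) _ Rb])
      fix x i assume "x \<in> S" "1 \<le> i" "i \<le> n"
      then show "x \<bullet> e i = 0 \<and> x \<bullet> Alt2 R (e i) = 0"
        using S(3)[of x "e i"] S(3)[of x "Alt2 R (e i)"] by (auto simp: V_def)
    qed
    then show "(\<Sum>x\<in>S. (norm (Alt2 T x))\<^sup>2) \<le> \<eta>" using eq by simp
  qed
qed

section \<open>Counting pairs with bounded product\<close>

definition hyperbola_pairs :: "nat \<Rightarrow> (nat \<times> nat) set" where
  "hyperbola_pairs m = {(i, j). 1 \<le> i \<and> 1 \<le> j \<and> i * j \<le> m}"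

lemma hyperbola_pairs_Sigma: "hyperbola_pairs m = (SIGMA i:{1..m}. {1..m div i})"
proof (intro set_eqI iffI)
  fix p assume "p \<in> hyperbola_pairs m"
  then obtain i j where p: "p = (i, j)" "1 \<le> i" "1 \<le> j" "i * j \<le> m" by (auto simp: hyperbola_pairs_def)
  have "i * 1 \<le> i * j" using p(3) by (intro mult_le_mono2)
  then have "i \<le> m" using p(4) by linarith
  moreover have "j \<le> m div i" using p(2,4) by (simp add: less_eq_div_iff_mult_less_eq mult.commute)
  ultimately show "p \<in> (SIGMA i:{1..m}. {1..m div i})" using p by simp
next
  fix p assume "p \<in> (SIGMA i:{1..m}. {1..m div i})"
  then obtain i j where p: "p = (i, j)" "1 \<le> i" "1 \<le> j" "j \<le> m div i" by auto
  then have "i * j \<le> m" by (simp add: less_eq_div_iff_mult_less_eq mult.commute)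
  with p show "p \<in> hyperbola_pairs m" by (simp add: hyperbola_pairs_def)
qed

lemma finite_hyperbola_pairs: "finite (hyperbola_pairs m)"
  by (simp add: hyperbola_pairs_Sigma)

lemma harm_ln_bounds:
  assumes "1 \<le> m"
  shows "ln (real m) \<le> (\<Sum>i=1..m. 1 / real i)" "(\<Sum>i=1..m. 1 / real i) \<le> ln (real m) + 1"
proof -
  show "(\<Sum>i=1..m. 1 / real i) \<le> ln (real m) + 1"
    using assms
  proof (induction m rule: dec_induct)
    case (step m)
    have "ln (real m / real (Suc m)) \<le> real m / real (Suc m) - 1"
      using step by (intro ln_le_minus_one) auto
    also have "\<dots> = - (1 / real (Suc m))" by (simp add: field_simps)
    finally have "1 / real (Suc m) \<le> ln (real (Suc m)) - ln (real m)" using step by (simp add: ln_div)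
    with step show ?case by simp
  qed simp
  show "ln (real m) \<le> (\<Sum>i=1..m. 1 / real i)"
  proof -
    have "ln (real m + 1) \<le> (\<Sum>i=1..m. 1 / real i)"
    proof (induction m)
      case (Suc m)
      have "ln (real (Suc m) + 1) - ln (real m + 1) = ln (1 + 1 / real (Suc m))"
      proof -
        have "1 + 1 / real (Suc m) = (real (Suc m) + 1) / (real m + 1)" by (simp add: field_simps)
        then show ?thesis by (simp only:) (subst ln_div; simp)
      qed
      also have "\<dots> \<le> 1 / real (Suc m)" by (intro ln_add_one_self_le_self) simp
      finally show ?case using Suc by simp
    qed simp
    then show ?thesis using assms by (smt (verit) ln_le_cancel_iff of_nat_1 of_nat_le_iff)
  qed
qed

text \<open>Summing \<open>m div i\<close> over \<open>i\<close> gives \<open>m\<close> times a harmonic number, with an error below one for each \<open>i\<close>.\<close>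

lemma card_hyperbola_pairs:
  assumes "1 \<le> m"
  shows "\<bar>real (card (hyperbola_pairs m)) - real m * ln (real m)\<bar> \<le> real m"
proof -
  have card: "real (card (hyperbola_pairs m)) = (\<Sum>i=1..m. real (m div i))"
    by (simp add: hyperbola_pairs_Sigma)
  have "real (card (hyperbola_pairs m)) \<le> (\<Sum>i=1..m. real m * (1 / real i))"
    unfolding card by (intro sum_mono) (simp add: of_nat_div_le_of_nat)
  also have "\<dots> \<le> real m * (ln (real m) + 1)"
    unfolding sum_distrib_left[symmetric] by (intro mult_left_mono harm_ln_bounds assms) simp
  finally have up: "real (card (hyperbola_pairs m)) \<le> real m * ln (real m) + real m" by (simp add: distrib_left)
  have "real m * ln (real m) - real m \<le> real m * (\<Sum>i=1..m. 1 / real i) - real m"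
    using harm_ln_bounds(1)[OF assms] by (simp add: mult_left_mono)
  also have "\<dots> = (\<Sum>i=1..m. real m * (1 / real i) - 1)"
    by (simp add: sum_subtractf sum_distrib_left)
  also have "\<dots> \<le> (\<Sum>i=1..m. real (m div i))"
  proof (intro sum_mono)
    fix i assume "i \<in> {1..m}"
    then show "real m * (1 / real i) - 1 \<le> real (m div i)" using real_of_int_floor_gt_diff_one[of "real m / real i"]
      by (simp add: floor_divide_of_nat_eq)
  qed
  finally show ?thesis using up card by linarith
qed

definition ordered_pairs :: "real \<Rightarrow> (nat \<times> nat) set" where
  "ordered_pairs Y = {(i, j). 1 \<le> i \<and> i < j \<and> real i * real j < Y}"

lemma finite_ordered_pairs: "finite (ordered_pairs Y)"
proof (rule finite_subset)
  show "ordered_pairs Y \<subseteq> hyperbola_pairs (nat \<lfloor>Y\<rfloor>)"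
    by (auto simp: ordered_pairs_def hyperbola_pairs_def le_nat_floor simp flip: of_nat_mult)
qed (rule finite_hyperbola_pairs)

text \<open>Swapping shows that the ordered pairs are half of the pairs off the diagonal, and the diagonal
contributes at most \<open>Y\<close>. Replacing the strict bound \<open>Y\<close> by the largest integer \<open>m\<close> below it changes
\<open>Y * ln Y\<close> only by a multiple of \<open>Y\<close>.\<close>

lemma card_ordered_pairs:
  assumes Y: "2 \<le> Y"
  shows "\<bar>real (card (ordered_pairs Y)) - Y * ln Y / 2\<bar> \<le> 3 * Y"
proof -
  define m where "m = nat \<lceil>Y\<rceil> - 1"
  have m: "real m < Y" "Y \<le> real m + 1" "1 \<le> m"
    using Y by (auto simp: m_def of_nat_diff) linarith+
  have le: "real n < Y \<longleftrightarrow> n \<le> m" for n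
    using m by (metis Suc_eq_plus1 less_Suc_eq_le less_le_not_le linorder_le_less_linear nat_less_real_le of_nat_le_iff order_less_le_trans order_trans)
  have O: "ordered_pairs Y = {(i, j). 1 \<le> i \<and> i < j \<and> i * j \<le> m}"
    unfolding ordered_pairs_def of_nat_mult[symmetric] le ..
  have fin: "finite (ordered_pairs Y)" by (rule finite_ordered_pairs)
  let ?D = "(\<lambda>i. (i, i)) ` {i. 1 \<le> i \<and> i * i \<le> m}"
  have fD: "finite {i. 1 \<le> i \<and> i * i \<le> m}" "card {i. 1 \<le> i \<and> i * i \<le> m} \<le> m"
  proof -
    have sub: "{i. 1 \<le> i \<and> i * i \<le> m} \<subseteq> {1..m}" by (auto intro: order_trans[OF le_square])
    show "finite {i. 1 \<le> i \<and> i * i \<le> m}" by (rule finite_subset[OF sub]) simp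
    show "card {i. 1 \<le> i \<and> i * i \<le> m} \<le> m" using card_mono[OF _ sub] by simp
  qed
  have split: "hyperbola_pairs m = (ordered_pairs Y \<union> prod.swap ` ordered_pairs Y) \<union> ?D"
  proof (intro set_eqI iffI)
    fix p assume "p \<in> hyperbola_pairs m"
    then obtain i j where p: "p = (i, j)" "1 \<le> i" "1 \<le> j" "i * j \<le> m" by (auto simp: hyperbola_pairs_def)
    show "p \<in> (ordered_pairs Y \<union> prod.swap ` ordered_pairs Y) \<union> ?D"
    proof (cases i j rule: linorder_cases)
      case greater
      then have "(j, i) \<in> ordered_pairs Y" using p by (simp add: O mult.commute)
      then have "prod.swap (j, i) \<in> prod.swap ` ordered_pairs Y" by (rule imageI)
      then show ?thesis using p by simp
    qed (use p in \<open>auto simp: O\<close>)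
  qed (auto simp: O hyperbola_pairs_def mult.commute)
  have "card (hyperbola_pairs m) = card (ordered_pairs Y \<union> prod.swap ` ordered_pairs Y) + card ?D"
    unfolding split using fin fD by (intro card_Un_disjoint) (auto simp: O)
  also have "card (ordered_pairs Y \<union> prod.swap ` ordered_pairs Y) = card (ordered_pairs Y) + card (prod.swap ` ordered_pairs Y)"
    using fin by (intro card_Un_disjoint) (auto simp: O)
  also have "card (prod.swap ` ordered_pairs Y) = card (ordered_pairs Y)"
    by (intro card_image) auto
  also have "card ?D = card {i. 1 \<le> i \<and> i * i \<le> m}" by (intro card_image) (auto simp: inj_on_def)
  finally have c: "real (card (hyperbola_pairs m)) = 2 * real (card (ordered_pairs Y)) + real (card {i. 1 \<le> i \<and> i * i \<le> m})"
    by simp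
  have d: "real (card {i. 1 \<le> i \<and> i * i \<le> m}) \<le> real m" using fD(2) by simp
  have "\<bar>real m * ln (real m) - Y * ln Y\<bar> \<le> 2 * Y"
  proof -
    have a: "ln (real m) \<le> ln Y" "0 \<le> ln (real m)" using m by auto
    have b: "ln Y - ln (real m) \<le> 1 / real m"
    proof -
      have "ln (Y / real m) \<le> Y / real m - 1" using m Y by (intro ln_le_minus_one) auto
      also have "Y / real m \<le> (real m + 1) / real m" using m by (intro divide_right_mono) auto
      also have "(real m + 1) / real m - 1 = 1 / real m" using m by (simp add: add_divide_distrib)
      finally show ?thesis using m Y by (simp add: ln_div)
    qed
    have "real m * ln (real m) \<le> Y * ln Y" using a m by (intro mult_mono) auto
    moreover have "Y * ln Y \<le> (real m + 1) * ln Y" using a m by (intro mult_right_mono) auto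
    moreover have "(real m + 1) * ln Y = real m * ln (real m) + real m * (ln Y - ln (real m)) + ln Y"
      by (simp add: algebra_simps)
    moreover have "real m * (ln Y - ln (real m)) \<le> 1" using b m by (simp add: field_simps)
    moreover have "ln Y \<le> Y - 1" using Y by (intro ln_le_minus_one) auto
    ultimately show ?thesis using Y by linarith
  qed
  with card_hyperbola_pairs[OF m(3)] c d m show ?thesis by linarith
qed

definition perturbed_pairs :: "(nat \<Rightarrow> real) \<Rightarrow> real \<Rightarrow> (nat \<times> nat) set" where
  "perturbed_pairs d X = {(i, j). 1 \<le> i \<and> i < j \<and> d i * d j < X}"

text \<open>Once both indices are large, \<open>d i\<close> and \<open>d j\<close> equal \<open>i\<close> and \<open>j\<close> up to factors \<open>1 \<plusminus> \<epsilon>\<close>. Pairs with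
\<open>i\<close> below a fixed threshold number only \<open>O(X)\<close>, because \<open>d\<close> is bounded below by a multiple of the index.\<close>

lemma perturbed_pairs_bounds:
  assumes pos: "\<And>j. 1 \<le> j \<Longrightarrow> 0 < d j" and lim: "(\<lambda>j. d j / real j) \<longlonglongrightarrow> 1"
    and \<epsilon>: "0 < \<epsilon>" "\<epsilon> < 1"
  obtains K where "0 \<le> K" "\<And>X. 0 < X \<Longrightarrow> finite (perturbed_pairs d X)"
    "\<And>X. 0 < X \<Longrightarrow> real (card (perturbed_pairs d X)) \<le> real (card (ordered_pairs (X / (1 - \<epsilon>)\<^sup>2))) + K * X"
    "\<And>X. 0 < X \<Longrightarrow> real (card (ordered_pairs (X / (1 + \<epsilon>)\<^sup>2))) \<le> real (card (perturbed_pairs d X)) + K * X"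
proof -
  obtain J0 where J0: "\<And>j. J0 \<le> j \<Longrightarrow> \<bar>d j / real j - 1\<bar> < \<epsilon>"
    using LIMSEQ_D[OF lim \<epsilon>(1)] by auto
  define J where "J = max 1 J0"
  have J: "1 \<le> J" by (simp add: J_def)
  have dJ: "(1 - \<epsilon>) * real j \<le> d j" "d j \<le> (1 + \<epsilon>) * real j" if "J \<le> j" for j
  proof -
    have j: "0 < real j" using that J by simp
    have "\<bar>d j / real j - 1\<bar> < \<epsilon>" using J0[of j] that by (simp add: J_def)
    then have "1 - \<epsilon> < d j / real j" "d j / real j < 1 + \<epsilon>" by auto
    then show "(1 - \<epsilon>) * real j \<le> d j" "d j \<le> (1 + \<epsilon>) * real j"
      using j by (auto simp: field_simps)
  qed
  \<comment> \<open>A lower bound for \<open>d j / j\<close>: a finite minimum up to \<open>J\<close>, and the limit beyond.\<close>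
  define w where "w = Min (insert (1 - \<epsilon>) ((\<lambda>j. d j / real j) ` {1..J}))"
  have w: "0 < w" "w \<le> 1 - \<epsilon>" using pos \<epsilon> by (auto simp: w_def)
  have wj: "w \<le> d j / real j" if "1 \<le> j" "j \<le> J" for j
    unfolding w_def by (rule Min_le) (use that in auto)
  have dw: "w * real j \<le> d j" if "1 \<le> j" for j
  proof (cases "j \<le> J")
    case True
    then show ?thesis using wj[of j] that by (simp add: field_simps)
  next
    case False
    then have "(1 - \<epsilon>) * real j \<le> d j" by (intro dJ) simp
    moreover have "w * real j \<le> (1 - \<epsilon>) * real j" using w by (intro mult_right_mono) auto
    ultimately show ?thesis by simp
  qed
  \<comment> \<open>The pairs with first index below the threshold \<open>J\<close>.\<close>
  define strip where "strip Y = {1..<J} \<times> {1..nat \<lfloor>Y\<rfloor>}" for Y :: real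
  have strip: "finite (strip Y)" "0 \<le> Y \<Longrightarrow> real (card (strip Y)) \<le> real J * Y" for Y :: real
  proof -
    assume "0 \<le> Y"
    then have "real (nat \<lfloor>Y\<rfloor>) \<le> Y" by simp
    then have "real (J - 1) * real (nat \<lfloor>Y\<rfloor>) \<le> real J * Y" by (intro mult_mono) auto
    then show "real (card (strip Y)) \<le> real J * Y" by (simp add: strip_def)
  qed (simp add: strip_def)
  have up: "perturbed_pairs d X \<subseteq> ordered_pairs (X / (1 - \<epsilon>)\<^sup>2) \<union> strip (X / w\<^sup>2)" if X: "0 < X" for X
  proof
    fix p assume "p \<in> perturbed_pairs d X"
    then obtain i j where p: "p = (i, j)" "1 \<le> i" "i < j" "d i * d j < X" by (auto simp: perturbed_pairs_def)
    show "p \<in> ordered_pairs (X / (1 - \<epsilon>)\<^sup>2) \<union> strip (X / w\<^sup>2)"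
    proof (cases "J \<le> i")
      case True
      have "((1 - \<epsilon>) * real i) * ((1 - \<epsilon>) * real j) \<le> d i * d j"
        using True p \<epsilon> by (intro mult_mono dJ less_imp_le[OF pos]) auto
      also have "((1 - \<epsilon>) * real i) * ((1 - \<epsilon>) * real j) = real i * real j * (1 - \<epsilon>)\<^sup>2"
        by (simp only: power2_eq_square mult_ac)
      finally have "real i * real j * (1 - \<epsilon>)\<^sup>2 < X" using p(4) by simp
      then have "real i * real j < X / (1 - \<epsilon>)\<^sup>2" using \<epsilon> by (subst pos_less_divide_eq) auto
      with p show ?thesis by (simp add: ordered_pairs_def)
    next
      case False
      have "(w * real i) * (w * real j) \<le> d i * d j"
        using p w by (intro mult_mono dw less_imp_le[OF pos]) auto
      then have "real i * real j < X / w\<^sup>2"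
        using p(4) w by (simp add: field_simps power2_eq_square)
      moreover have "1 * real j \<le> real i * real j" using p(2) by (intro mult_right_mono) auto
      ultimately have "real j \<le> X / w\<^sup>2" by simp
      then have "j \<le> nat \<lfloor>X / w\<^sup>2\<rfloor>" by (simp add: le_nat_floor)
      with p False show ?thesis by (simp add: strip_def)
    qed
  qed
  have low: "ordered_pairs (X / (1 + \<epsilon>)\<^sup>2) \<subseteq> perturbed_pairs d X \<union> strip (X / (1 + \<epsilon>)\<^sup>2)" for X
  proof
    fix p assume "p \<in> ordered_pairs (X / (1 + \<epsilon>)\<^sup>2)"
    then obtain i j where p: "p = (i, j)" "1 \<le> i" "i < j" "real i * real j < X / (1 + \<epsilon>)\<^sup>2"
      by (auto simp: ordered_pairs_def)
    show "p \<in> perturbed_pairs d X \<union> strip (X / (1 + \<epsilon>)\<^sup>2)"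
    proof (cases "J \<le> i")
      case True
      have "d i * d j \<le> ((1 + \<epsilon>) * real i) * ((1 + \<epsilon>) * real j)"
        using True p \<epsilon> by (intro mult_mono dJ less_imp_le[OF pos]) auto
      also have "\<dots> = real i * real j * (1 + \<epsilon>)\<^sup>2" by (simp only: power2_eq_square mult_ac)
      also have "\<dots> < X" using p(4) \<epsilon> by (subst (asm) pos_less_divide_eq) auto
      finally show ?thesis using p by (simp add: perturbed_pairs_def)
    next
      case False
      have "1 * real j \<le> real i * real j" using p(2) by (intro mult_right_mono) auto
      then have "real j \<le> X / (1 + \<epsilon>)\<^sup>2" using p(4) by simp
      then have "j \<le> nat \<lfloor>X / (1 + \<epsilon>)\<^sup>2\<rfloor>" by (simp add: le_nat_floor)
      with p False show ?thesis by (simp add: strip_def)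
    qed
  qed
  define K where "K = real J / w\<^sup>2"
  have K0: "0 \<le> K" by (simp add: K_def)
  have fin: "finite (perturbed_pairs d X)" if "0 < X" for X
    by (rule finite_subset[OF up[OF that]]) (simp add: finite_ordered_pairs strip)
  show thesis
  proof (rule that[OF K0 fin])
    fix X :: real assume X: "0 < X"
    have "card (perturbed_pairs d X) \<le> card (ordered_pairs (X / (1 - \<epsilon>)\<^sup>2)) + card (strip (X / w\<^sup>2))"
      using card_mono[OF _ up[OF X]] finite_ordered_pairs strip(1) card_Un_le order_trans by (metis finite_UnI)
    then show "real (card (perturbed_pairs d X)) \<le> real (card (ordered_pairs (X / (1 - \<epsilon>)\<^sup>2))) + K * X"
      using strip(2)[of "X / w\<^sup>2"] X by (simp add: K_def)
    have "card (ordered_pairs (X / (1 + \<epsilon>)\<^sup>2)) \<le> card (perturbed_pairs d X) + card (strip (X / (1 + \<epsilon>)\<^sup>2))"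
      using card_mono[OF _ low[of X]] fin[OF X] strip(1) card_Un_le order_trans by (metis finite_UnI)
    moreover have "real (card (strip (X / (1 + \<epsilon>)\<^sup>2))) \<le> K * X"
    proof -
      have "real (card (strip (X / (1 + \<epsilon>)\<^sup>2))) \<le> real J * (X / (1 + \<epsilon>)\<^sup>2)" using X by (intro strip(2)) simp
      also have "\<dots> \<le> real J * (X / w\<^sup>2)"
        using X w \<epsilon> by (intro mult_left_mono divide_left_mono power_mono) auto
      finally show ?thesis by (simp add: K_def)
    qed
    ultimately show "real (card (ordered_pairs (X / (1 + \<epsilon>)\<^sup>2))) \<le> real (card (perturbed_pairs d X)) + K * X" by simp
  qed
qed

text \<open>The error \<open>O(X)\<close> is negligible against \<open>X * ln X\<close>, and the factor lost by \<open>\<epsilon>\<close> tends to one.\<close>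

lemma perturbed_pairs_asymp:
  assumes pos: "\<And>j. 1 \<le> j \<Longrightarrow> 0 < d j" and lim: "(\<lambda>j. d j / real j) \<longlonglongrightarrow> 1"
  shows "((\<lambda>X. real (card (perturbed_pairs d X)) / (X * ln X / 2)) \<longlongrightarrow> 1) at_top"
proof (rule tendstoI)
  fix r :: real assume r: "0 < r"
  have "((\<lambda>\<epsilon>. 1 / (1 - \<epsilon>)\<^sup>2) \<longlongrightarrow> 1 / (1 - 0)\<^sup>2) (at_right (0::real))"
    by (intro tendsto_intros) auto
  moreover have "((\<lambda>\<epsilon>. 1 / (1 + \<epsilon>)\<^sup>2) \<longlongrightarrow> 1 / (1 + 0)\<^sup>2) (at_right (0::real))"
    by (intro tendsto_intros) auto
  ultimately have "\<forall>\<^sub>F \<epsilon> in at_right (0::real). 1 / (1 - \<epsilon>)\<^sup>2 < 1 + r \<and> 1 - r < 1 / (1 + \<epsilon>)\<^sup>2 \<and> 0 < \<epsilon> \<and> \<epsilon> < 1"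
    using r eventually_at_right_less[of "0::real"] eventually_at_right_real[of 0 "1::real"]
    by (intro eventually_conj) (auto intro: order_tendstoD elim: eventually_mono)
  then obtain \<epsilon> :: real where \<epsilon>: "1 / (1 - \<epsilon>)\<^sup>2 < 1 + r" "1 - r < 1 / (1 + \<epsilon>)\<^sup>2" "0 < \<epsilon>" "\<epsilon> < 1"
    using eventually_happens[of _ "at_right (0::real)"] trivial_limit_at_right_real by fastforce
  obtain K where K: "0 \<le> K"
    "\<And>X. 0 < X \<Longrightarrow> real (card (perturbed_pairs d X)) \<le> real (card (ordered_pairs (X / (1 - \<epsilon>)\<^sup>2))) + K * X"
    "\<And>X. 0 < X \<Longrightarrow> real (card (ordered_pairs (X / (1 + \<epsilon>)\<^sup>2))) \<le> real (card (perturbed_pairs d X)) + K * X"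
    using perturbed_pairs_bounds[OF pos lim \<epsilon>(3,4)] by metis
  define p where "p = 1 / (1 - \<epsilon>)\<^sup>2"
  define q where "q = 1 / (1 + \<epsilon>)\<^sup>2"
  have p: "0 < p" "p < 1 + r" and q: "0 < q" "1 - r < q" using \<epsilon> by (auto simp: p_def q_def)
  have "((\<lambda>X. ((p * X) * ln (p * X) / 2 + 3 * (p * X) + K * X) / (X * ln X / 2)) \<longlongrightarrow> p) at_top"
    using p(1) by real_asymp
  then have 1: "\<forall>\<^sub>F X in at_top. ((p * X) * ln (p * X) / 2 + 3 * (p * X) + K * X) / (X * ln X / 2) < 1 + r"
    using p(2) by (rule order_tendstoD)
  have "((\<lambda>X. ((q * X) * ln (q * X) / 2 - 3 * (q * X) - K * X) / (X * ln X / 2)) \<longlongrightarrow> q) at_top"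
    using q(1) by real_asymp
  then have 2: "\<forall>\<^sub>F X in at_top. 1 - r < ((q * X) * ln (q * X) / 2 - 3 * (q * X) - K * X) / (X * ln X / 2)"
    using q(2) by (rule order_tendstoD)
  have 3: "\<forall>\<^sub>F X in at_top. max (2 / p) (2 / q) \<le> X" "\<forall>\<^sub>F X::real in at_top. 1 < X"
    by (rule eventually_ge_at_top, rule eventually_gt_at_top)
  show "\<forall>\<^sub>F X in at_top. dist (real (card (perturbed_pairs d X)) / (X * ln X / 2)) 1 < r"
    using 1 2 3
  proof eventually_elim
    case (elim X)
    have X: "0 < X" "0 < X * ln X / 2" "2 \<le> p * X" "2 \<le> q * X"
      using elim(3,4) p(1) q(1) by (auto simp: field_simps)
    have "real (card (perturbed_pairs d X)) \<le> (p * X) * ln (p * X) / 2 + 3 * (p * X) + K * X"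
      using K(2)[OF X(1)] card_ordered_pairs[OF X(3)] by (simp add: p_def)
    then have u: "real (card (perturbed_pairs d X)) / (X * ln X / 2) \<le> ((p * X) * ln (p * X) / 2 + 3 * (p * X) + K * X) / (X * ln X / 2)"
      using X(2) by (intro divide_right_mono) auto
    have "(q * X) * ln (q * X) / 2 - 3 * (q * X) - K * X \<le> real (card (perturbed_pairs d X))"
      using K(3)[OF X(1)] card_ordered_pairs[OF X(4)] by (simp add: q_def)
    then have l: "((q * X) * ln (q * X) / 2 - 3 * (q * X) - K * X) / (X * ln X / 2) \<le> real (card (perturbed_pairs d X)) / (X * ln X / 2)"
      using X(2) by (intro divide_right_mono) auto
    show ?case using u l elim(1,2) by (auto simp: dist_real_def)
  qed
qed


section \<open>Asymptotics and inversion of counting functions\<close>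

lemma asymp_equiv_ratio:
  fixes f g :: "'a \<Rightarrow> real"
  assumes "f \<sim>[F] g" "\<forall>\<^sub>F x in F. g x \<noteq> 0"
  shows "((\<lambda>x. f x / g x) \<longlongrightarrow> 1) F"
proof -
  have "((\<lambda>x. if f x = 0 \<and> g x = 0 then 1 else f x / g x) \<longlongrightarrow> 1) F"
    using assms(1) by (rule asymp_equivD)
  moreover have "\<forall>\<^sub>F x in F. (if f x = 0 \<and> g x = 0 then 1 else f x / g x) = f x / g x"
    using assms(2) by eventually_elim simp
  ultimately show ?thesis by (simp add: tendsto_cong)
qed

lemma powr_neg_less_iff:
  fixes x y a :: real
  assumes "0 < x" "0 < y" "a < 0"
  shows "y powr a < x powr a \<longleftrightarrow> x < y"
  using powr_less_mono2_neg[OF assms(3,1), of y] powr_less_mono2_neg[OF assms(3,2), of x]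
  by (cases x y rule: linorder_cases) auto

text \<open>With \<open>d j = (c j / b) powr (- 1 / \<delta>)\<close>, asymptotic to \<open>j\<close>, the condition on the pair becomes
\<open>d i * d j < X u\<close> for \<open>X u = (t * b / (2 * u)) powr (2 / \<delta>)\<close>.\<close>

lemma pair_count_asymp:
  fixes c :: "nat \<Rightarrow> real"
  assumes t: "0 < t" and b: "0 < b" and \<delta>: "0 < \<delta>"
    and pos: "\<And>j. 1 \<le> j \<Longrightarrow> 0 < c j"
    and c: "c \<sim>[at_top] (\<lambda>j. b * real j powr (- \<delta>))"
  defines "P \<equiv> \<lambda>u. {(i, j). 1 \<le> i \<and> i < j \<and> u < t / 2 * sqrt (c i * c j)}"
  shows "0 < u \<Longrightarrow> finite (P u)"
    and "(\<lambda>u. real (card (P u))) \<sim>[at_right 0]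
      (\<lambda>u. (t * b / 2) powr (2 / \<delta>) / \<delta> * u powr (- 2 / \<delta>) * ln (1 / u))"
proof -
  define d where "d j = (c j / b) powr (- 1 / \<delta>)" for j
  define X where "X u = (t * b / (2 * u)) powr (2 / \<delta>)" for u
  have d: "0 < d j" if "1 \<le> j" for j using pos[OF that] b by (simp add: d_def)
  have lim: "(\<lambda>j. d j / real j) \<longlonglongrightarrow> 1"
  proof -
    have "(\<lambda>j. c j / (b * real j powr (- \<delta>))) \<longlonglongrightarrow> 1"
      using b eventually_gt_at_top[of 0] by (intro asymp_equiv_ratio[OF c]) (auto elim!: eventually_mono)
    then have "(\<lambda>j. (c j / (b * real j powr (- \<delta>))) powr (- 1 / \<delta>)) \<longlonglongrightarrow> 1 powr (- 1 / \<delta>)"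
      by (intro tendsto_powr tendsto_const) auto
    moreover have "\<forall>\<^sub>F j in sequentially. (c j / (b * real j powr (- \<delta>))) powr (- 1 / \<delta>) = d j / real j"
      using eventually_ge_at_top[of 1]
    proof eventually_elim
      case (elim j)
      have "(c j / (b * real j powr (- \<delta>))) powr (- 1 / \<delta>) = ((c j / b) / real j powr (- \<delta>)) powr (- 1 / \<delta>)"
        by simp
      also have "\<dots> = d j / (real j powr (- \<delta>)) powr (- 1 / \<delta>)"
        using pos[OF elim] b by (subst powr_divide) (auto simp: d_def)
      also have "(real j powr (- \<delta>)) powr (- 1 / \<delta>) = real j"
        using elim \<delta> by (simp add: powr_powr)
      finally show ?case .
    qed
    ultimately have "(\<lambda>j. d j / real j) \<longlonglongrightarrow> 1 powr (- 1 / \<delta>)" by (rule Lim_transform_eventually)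
    then show ?thesis by simp
  qed
  have P: "P u = perturbed_pairs d (X u)" if u: "0 < u" for u
  proof -
    have "u < t / 2 * sqrt (c i * c j) \<longleftrightarrow> d i * d j < X u" if ij: "1 \<le> i" "1 \<le> j" for i j
    proof -
      have cc: "0 < c i" "0 < c j" using pos ij by auto
      have "u < t / 2 * sqrt (c i * c j) \<longleftrightarrow> 2 * u / t < sqrt (c i * c j)"
        using t by (simp add: field_simps)
      also have "\<dots> \<longleftrightarrow> (2 * u / t)\<^sup>2 < c i * c j"
        using t u real_sqrt_less_iff[of "(2 * u / t)\<^sup>2" "c i * c j"] by simp
      also have "\<dots> \<longleftrightarrow> (2 * u / (t * b))\<^sup>2 < c i / b * (c j / b)"
        using b t by (simp add: field_simps power2_eq_square)
      also have "\<dots> \<longleftrightarrow> (c i / b * (c j / b)) powr (- 1 / \<delta>) < ((2 * u / (t * b))\<^sup>2) powr (- 1 / \<delta>)"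
        using cc b t u \<delta> by (intro powr_neg_less_iff[symmetric]) auto
      also have "(c i / b * (c j / b)) powr (- 1 / \<delta>) = d i * d j"
        unfolding d_def by (rule powr_mult)
      also have "((2 * u / (t * b))\<^sup>2) powr (- 1 / \<delta>) = X u"
      proof -
        have "((2 * u / (t * b))\<^sup>2) powr (- 1 / \<delta>) = (2 * u / (t * b)) powr (- (2 / \<delta>))"
          using t b u by (simp add: powr_powr flip: powr_numeral)
        also have "\<dots> = X u"
          using t b u by (simp add: X_def powr_minus_divide powr_divide)
        finally show ?thesis .
      qed
      finally show ?thesis .
    qed
    then show ?thesis by (auto simp: P_def perturbed_pairs_def)
  qed
  have Xpos: "0 < X u" if "0 < u" for u using t b that by (simp add: X_def)
  show "finite (P u)" if "0 < u" for u
  proof -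
    obtain K :: real where "\<And>X. 0 < X \<Longrightarrow> finite (perturbed_pairs d X)"
      using perturbed_pairs_bounds[OF d lim, of "1 / 2"] by auto
    then show ?thesis using P[OF that] Xpos[OF that] by simp
  qed
  have X: "filterlim X at_top (at_right 0)"
    unfolding X_def[abs_def] using t b \<delta> by real_asymp
  have "((\<lambda>u. real (card (perturbed_pairs d (X u))) / (X u * ln (X u) / 2)) \<longlongrightarrow> 1) (at_right 0)"
    by (rule filterlim_compose[OF perturbed_pairs_asymp[OF d lim] X])
  moreover have "\<forall>\<^sub>F u in at_right 0. real (card (perturbed_pairs d (X u))) / (X u * ln (X u) / 2) = real (card (P u)) / (X u * ln (X u) / 2)"
    using eventually_at_right_less[of "0::real"] by eventually_elim (simp add: P)
  ultimately have 1: "((\<lambda>u. real (card (P u)) / (X u * ln (X u) / 2)) \<longlongrightarrow> 1) (at_right 0)"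
    by (rule Lim_transform_eventually)
  have "(\<lambda>u. real (card (P u))) \<sim>[at_right 0] (\<lambda>u. X u * ln (X u) / 2)"
    by (rule asymp_equivI'[OF 1])
  also have "(\<lambda>u. X u * ln (X u) / 2) \<sim>[at_right 0] (\<lambda>u. (t * b / 2) powr (2 / \<delta>) / \<delta> * u powr (- 2 / \<delta>) * ln (1 / u))"
    unfolding X_def[abs_def] using t b \<delta> by real_asymp
  finally show "(\<lambda>u. real (card (P u))) \<sim>[at_right 0]
      (\<lambda>u. (t * b / 2) powr (2 / \<delta>) / \<delta> * u powr (- 2 / \<delta>) * ln (1 / u))" .
qed

text \<open>The counting function just below and at \<open>s n\<close> encloses \<open>n\<close>, and \<open>F\<close> changes little between
\<open>q * s n\<close> and \<open>s n\<close> for \<open>q\<close> near one; hence \<open>n\<close> is asymptotic to \<open>F (s n)\<close>. Taking logarithms,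
\<open>ln n\<close> is asymptotic to \<open>p * ln (1 / s n)\<close>, which allows the equation to be solved for \<open>s n\<close>.\<close>

lemma counting_function_inversion:
  fixes s :: "nat \<Rightarrow> real" and N :: "real \<Rightarrow> nat"
  assumes iff: "\<And>n u. 1 \<le> n \<Longrightarrow> 0 < u \<Longrightarrow> u < s n \<longleftrightarrow> n \<le> N u"
    and A: "0 < A" and p: "0 < p"
    and N: "(\<lambda>u. real (N u)) \<sim>[at_right 0] (\<lambda>u. A * u powr (- p) * ln (1 / u))"
  shows "s \<sim>[at_top] (\<lambda>n. (A / p) powr (1 / p) * real n powr (- 1 / p) * ln (real n) powr (1 / p))"
proof -
  define F where "F u = A * u powr (- p) * ln (1 / u)" for u
  have Ftop: "filterlim F at_top (at_right 0)" unfolding F_def[abs_def] using A p by real_asymp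
  have Fpos: "0 < F u" if "0 < u" "u < 1" for u
    using that A by (simp add: F_def)
  have NF: "((\<lambda>u. real (N u) / F u) \<longlongrightarrow> 1) (at_right 0)"
  proof (rule asymp_equiv_ratio)
    show "(\<lambda>u. real (N u)) \<sim>[at_right 0] F" using N by (simp add: F_def[abs_def])
    show "\<forall>\<^sub>F u in at_right 0. F u \<noteq> 0"
      by (rule eventually_mono[OF eventually_at_right_real[OF zero_less_one]]) (use Fpos in force)
  qed
  have Ntop: "filterlim (\<lambda>u. real (N u)) at_top (at_right 0)"
    using asymp_equiv_at_top_transfer[OF asymp_equiv_symI[OF N]] Ftop by (simp add: F_def[abs_def])
  have spos: "0 < s n" if n: "1 \<le> n" for n
  proof -
    have "\<forall>\<^sub>F u in at_right 0. real n \<le> real (N u) \<and> 0 < u"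
      by (rule eventually_conj[OF Ntop[unfolded filterlim_at_top, rule_format] eventually_at_right_less])
    then obtain u where "real n \<le> real (N u)" "0 < u"
      using eventually_happens[of _ "at_right (0::real)"] trivial_limit_at_right_real by fastforce
    with iff[OF n, of u] show ?thesis by simp
  qed
  have s0: "s \<longlonglongrightarrow> 0"
  proof (rule LIMSEQ_I)
    fix r :: real assume r: "0 < r"
    show "\<exists>no. \<forall>n\<ge>no. norm (s n - 0) < r"
    proof (intro exI[of _ "Suc (N (r / 2))"] allI impI)
      fix n assume n: "Suc (N (r / 2)) \<le> n"
      then have "\<not> r / 2 < s n" using iff[of n "r / 2"] r by simp
      moreover have "0 < s n" using spos n by simp
      ultimately show "norm (s n - 0) < r" using r by simp
    qed
  qed
  have sev: "\<forall>\<^sub>F n in sequentially. 0 < s n"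
    by (rule eventually_mono[OF eventually_ge_at_top[of 1]]) (rule spos)
  have s_right: "filterlim s (at_right 0) sequentially"
    unfolding filterlim_at using s0 sev by (auto elim!: eventually_mono)
  have nF: "(\<lambda>n. real n / F (s n)) \<longlonglongrightarrow> 1"
  proof (rule tendstoI)
    fix r :: real assume r: "0 < r"
    have "((\<lambda>\<epsilon>. (1 - \<epsilon>) powr (- p)) \<longlongrightarrow> (1 - 0) powr (- p)) (at_right (0::real))"
      by (intro tendsto_intros) auto
    then have "\<forall>\<^sub>F \<epsilon> in at_right (0::real). (1 - \<epsilon>) powr (- p) < 1 + r"
      by (rule order_tendstoD) (use r in auto)
    then have "\<forall>\<^sub>F \<epsilon> in at_right (0::real). (1 - \<epsilon>) powr (- p) < 1 + r \<and> 0 < \<epsilon> \<and> \<epsilon> < 1"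
      using eventually_at_right_real[OF zero_less_one[where 'a = real]] by eventually_elim auto
    then obtain \<epsilon> where \<epsilon>: "(1 - \<epsilon>) powr (- p) < 1 + r" "0 < \<epsilon>" "\<epsilon> < 1"
      using eventually_happens[of _ "at_right (0::real)"] trivial_limit_at_right_real by fastforce
    define q where "q = 1 - \<epsilon>"
    have q: "0 < q" "q < 1" "q powr (- p) < 1 + r" using \<epsilon> by (auto simp: q_def)
    have s_right_q: "filterlim (\<lambda>n. q * s n) (at_right 0) sequentially"
      unfolding filterlim_at
      using tendsto_mult_right_zero[OF s0, of q] sev q by (auto elim!: eventually_mono)
    have 1: "(\<lambda>n. real (N (s n)) / F (s n)) \<longlonglongrightarrow> 1" by (rule filterlim_compose[OF NF s_right])
    have 2: "(\<lambda>n. real (N (q * s n)) / F (q * s n)) \<longlonglongrightarrow> 1" by (rule filterlim_compose[OF NF s_right_q])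
    have "((\<lambda>u. F (q * u) / F u) \<longlongrightarrow> q powr (- p)) (at_right 0)"
      unfolding F_def using q A p by real_asymp
    then have 3: "(\<lambda>n. F (q * s n) / F (s n)) \<longlonglongrightarrow> q powr (- p)" by (rule filterlim_compose[OF _ s_right])
    have "(\<lambda>n. real (N (q * s n)) / F (q * s n) * (F (q * s n) / F (s n))) \<longlonglongrightarrow> 1 * q powr (- p)"
      by (rule tendsto_mult[OF 2 3])
    then have 4: "\<forall>\<^sub>F n in sequentially. real (N (q * s n)) / F (q * s n) * (F (q * s n) / F (s n)) < 1 + r"
      by (rule order_tendstoD) (use q in simp)
    have 5: "\<forall>\<^sub>F n in sequentially. 1 - r < real (N (s n)) / F (s n)"
      using 1 by (rule order_tendstoD) (use r in simp)
    have 6: "\<forall>\<^sub>F n in sequentially. s n < 1" using s0 by (rule order_tendstoD) simp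
    show "\<forall>\<^sub>F n in sequentially. dist (real n / F (s n)) 1 < r"
      using 4 5 6 eventually_ge_at_top[of 1]
    proof eventually_elim
      case (elim n)
      note sn = spos[OF elim(4)]
      have "q * s n < 1 * 1" using sn elim(3) q by (intro mult_strict_mono) auto
      then have F: "0 < F (s n)" "0 < F (q * s n)"
        using sn elim(3) q by (auto intro!: Fpos)
      have "N (s n) < n" using iff[OF elim(4) sn] by simp
      then have "real (N (s n)) / F (s n) \<le> real n / F (s n)" using F by (intro divide_right_mono) auto
      moreover have "n \<le> N (q * s n)" using iff[OF elim(4), of "q * s n"] sn q by simp
      then have "real n / F (s n) \<le> real (N (q * s n)) / F (s n)" using F by (intro divide_right_mono) auto
      ultimately show ?case using elim(1,2) F by (auto simp: dist_real_def)
    qed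
  qed
  have ln0: "(\<lambda>n. ln (real n / F (s n))) \<longlonglongrightarrow> 0"
    using tendsto_ln[OF nF] by simp
  have lnF: "((\<lambda>u. ln (F u) / ln (1 / u)) \<longlongrightarrow> p) (at_right 0)"
    unfolding F_def using A p by real_asymp
  have inv: "((\<lambda>u. 1 / ln (1 / u)) \<longlongrightarrow> 0) (at_right (0::real))" by real_asymp
  have "(\<lambda>n. ln (real n / F (s n)) * (1 / ln (1 / s n)) + ln (F (s n)) / ln (1 / s n)) \<longlonglongrightarrow> 0 * 0 + p"
    by (intro tendsto_add tendsto_mult ln0 filterlim_compose[OF inv s_right] filterlim_compose[OF lnF s_right])
  moreover have "\<forall>\<^sub>F n in sequentially. ln (real n / F (s n)) * (1 / ln (1 / s n)) + ln (F (s n)) / ln (1 / s n) = ln (real n) / ln (1 / s n)"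
    using order_tendstoD(2)[OF s0 zero_less_one] eventually_ge_at_top[of 1]
  proof eventually_elim
    case (elim n)
    have "0 < F (s n)" using Fpos[OF spos[OF elim(2)]] elim(1) by simp
    with elim(2) show ?case by (simp add: ln_div diff_divide_distrib)
  qed
  ultimately have "(\<lambda>n. ln (real n) / ln (1 / s n)) \<longlonglongrightarrow> 0 * 0 + p" by (rule Lim_transform_eventually)
  then have lnn: "(\<lambda>n. ln (real n) / ln (1 / s n)) \<longlonglongrightarrow> p" by simp
  have "(\<lambda>n. (real n / F (s n) * (p / (ln (real n) / ln (1 / s n)))) powr (1 / p)) \<longlonglongrightarrow> (1 * (p / p)) powr (1 / p)"
    using p by (intro tendsto_powr tendsto_mult tendsto_divide tendsto_const nF lnn) auto
  moreover have "\<forall>\<^sub>F n in sequentially. (real n / F (s n) * (p / (ln (real n) / ln (1 / s n)))) powr (1 / p) =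
      s n / ((A / p) powr (1 / p) * real n powr (- 1 / p) * ln (real n) powr (1 / p))"
    using order_tendstoD(2)[OF s0 zero_less_one] eventually_ge_at_top[of 2]
  proof eventually_elim
    case (elim n)
    have sn: "0 < s n" "s n < 1" using spos[of n] elim by auto
    have l: "0 < ln (1 / s n)" "0 < ln (real n)" using sn elim(2) by auto
    have "real n / F (s n) * (p / (ln (real n) / ln (1 / s n))) = s n powr p / ((A / p) * (1 / real n) * ln (real n))"
      using l sn A p elim(2) by (simp add: F_def powr_minus field_simps del: ln_div)
    also have "\<dots> powr (1 / p) = s n / (((A / p) * (1 / real n) * ln (real n)) powr (1 / p))"
      using sn l A p elim(2) by (subst powr_divide) (auto simp: powr_powr)
    also have "((A / p) * (1 / real n) * ln (real n)) powr (1 / p) = (A / p) powr (1 / p) * real n powr (- 1 / p) * ln (real n) powr (1 / p)"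
      using l A p elim(2) by (simp add: powr_mult powr_divide powr_minus_divide)
    finally show ?case .
  qed
  ultimately have "(\<lambda>n. s n / ((A / p) powr (1 / p) * real n powr (- 1 / p) * ln (real n) powr (1 / p))) \<longlonglongrightarrow> (1 * (p / p)) powr (1 / p)"
    by (rule Lim_transform_eventually)
  then have "(\<lambda>n. s n / ((A / p) powr (1 / p) * real n powr (- 1 / p) * ln (real n) powr (1 / p))) \<longlonglongrightarrow> 1"
    using p by simp
  then show ?thesis by (rule asymp_equivI')
qed

text \<open>Comparison with a telescoping sum through the mean value theorem.\<close>

lemma powr_tail_sum:
  assumes s: "1 < s" and n: "1 \<le> n"
  shows "(\<Sum>i\<in>{n<..N}. real i powr (- s)) \<le> real n powr (1 - s) / (s - 1)"
proof -
  have mvt: "real (Suc i) powr (- s) \<le> (real i powr (1 - s) - real (Suc i) powr (1 - s)) / (s - 1)" if "1 \<le> i" for i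
  proof -
    have "\<exists>z>real i. z < real (Suc i) \<and> real (Suc i) powr (1 - s) - real i powr (1 - s) = (real (Suc i) - real i) * ((1 - s) * z powr (1 - s - 1))"
      using that by (intro MVT2) (auto intro!: derivative_eq_intros)
    then obtain z where z: "real i < z" "z < real (Suc i)"
      "real (Suc i) powr (1 - s) - real i powr (1 - s) = (1 - s) * z powr (- s)" by auto
    have "real (Suc i) powr (- s) \<le> z powr (- s)"
      using z that s by (intro powr_mono2') auto
    also have "z powr (- s) = (real i powr (1 - s) - real (Suc i) powr (1 - s)) / (s - 1)"
      using z(3) s by (simp add: field_simps)
    finally show ?thesis .
  qed
  show ?thesis
  proof (cases "n \<le> N")
    case True
    then have "(\<Sum>i\<in>{n<..N}. real i powr (- s)) \<le> (real n powr (1 - s) - real N powr (1 - s)) / (s - 1)"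
    proof (induction N rule: dec_induct)
      case (step N)
      have "{n<..Suc N} = insert (Suc N) {n<..N}" using step.hyps by auto
      then have "(\<Sum>i\<in>{n<..Suc N}. real i powr (- s)) = real (Suc N) powr (- s) + (\<Sum>i\<in>{n<..N}. real i powr (- s))" by simp
      also have "\<dots> \<le> (real N powr (1 - s) - real (Suc N) powr (1 - s)) / (s - 1) + (real n powr (1 - s) - real N powr (1 - s)) / (s - 1)"
        using step.IH step.hyps n by (intro add_mono mvt) auto
      finally show ?case by (simp add: add_divide_distrib diff_divide_distrib)
    qed simp
    also have "\<dots> \<le> real n powr (1 - s) / (s - 1)" using s by (intro divide_right_mono) auto
    finally show ?thesis .
  qed (use s in simp)
qed

section \<open>Increments of the Brownian motion\<close>

context prob_space
begin

lemma centered_normal_moments: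
  assumes X: "centered_normal M X v" and v: "0 \<le> v"
  shows "X \<in> borel_measurable M" "integrable M (\<lambda>\<omega>. X \<omega> ^ 4)"
    "expectation X = 0" "expectation (\<lambda>\<omega>. (X \<omega>)\<^sup>2) = v" "expectation (\<lambda>\<omega>. X \<omega> ^ 4) = 3 * v\<^sup>2"
proof -
  have "X \<in> borel_measurable M \<and> integrable M (\<lambda>\<omega>. X \<omega> ^ 4) \<and> expectation X = 0 \<and>
    expectation (\<lambda>\<omega>. (X \<omega>)\<^sup>2) = v \<and> expectation (\<lambda>\<omega>. X \<omega> ^ 4) = 3 * v\<^sup>2"
  proof (cases "v = 0")
    case True
    then have X: "X \<in> borel_measurable M" and 0: "AE \<omega> in M. X \<omega> = 0"
      using assms by (auto simp: centered_normal_def)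
    have z: "integrable M (\<lambda>\<omega>. f (X \<omega>)) \<and> expectation (\<lambda>\<omega>. f (X \<omega>)) = 0"
      if [measurable]: "f \<in> borel_measurable borel" and f: "f 0 = 0" for f :: "real \<Rightarrow> real"
    proof -
      have ae: "AE \<omega> in M. f (X \<omega>) = 0" using 0 by eventually_elim (simp add: f)
      have m: "(\<lambda>\<omega>. f (X \<omega>)) \<in> borel_measurable M" using X by simp
      have "integrable M (\<lambda>\<omega>. f (X \<omega>)) \<longleftrightarrow> integrable M (\<lambda>\<omega>. 0 :: real)"
        by (rule integrable_cong_AE[OF m _ ae]) simp
      moreover have "expectation (\<lambda>\<omega>. f (X \<omega>)) = expectation (\<lambda>\<omega>. 0)"
        by (rule integral_cong_AE[OF m _ ae]) simp
      ultimately show ?thesis by simp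
    qed
    show ?thesis
      using z[of "\<lambda>x. x ^ 4"] z[of "\<lambda>x. x"] z[of "\<lambda>x. x\<^sup>2"] X True by simp
  next
    case False
    define \<sigma> where "\<sigma> = sqrt v"
    have \<sigma>: "0 < \<sigma>" "\<sigma>\<^sup>2 = v" using False v by (auto simp: \<sigma>_def)
    have D: "distributed M lborel X (\<lambda>x. ennreal (normal_density 0 \<sigma> x))"
      using X False by (simp add: centered_normal_def \<sigma>_def)
    have nn: "0 \<le> normal_density 0 \<sigma> x" for x by simp
    note int = distributed_integral[OF D _ nn, symmetric]
    have m: "X \<in> borel_measurable M" using distributed_measurable[OF D] by simp
    have 1: "expectation X = 0"
      using int[of "\<lambda>x. x"] integral_normal_moment_odd[OF \<sigma>(1), of 0 0] by simp
    have 2: "expectation (\<lambda>\<omega>. (X \<omega>)\<^sup>2) = v"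
      using int[of "\<lambda>x. x\<^sup>2"] integral_normal_moment_even[OF \<sigma>(1), of 0 1] \<sigma> by (simp add: fact_numeral)
    have 4: "expectation (\<lambda>\<omega>. X \<omega> ^ 4) = 3 * v\<^sup>2"
      using int[of "\<lambda>x. x ^ 4"] integral_normal_moment_even[OF \<sigma>(1), of 0 2] \<sigma>
      by (simp add: fact_numeral power_divide)
    have "integrable lborel (\<lambda>x. normal_density 0 \<sigma> x * x ^ 4)"
      using integrable.intros[OF normal_moment_even[OF \<sigma>(1), of 0 2]] by simp
    then have "integrable M (\<lambda>\<omega>. X \<omega> ^ 4)"
      using distributed_integrable[OF D _ nn, of "\<lambda>x. x ^ 4"] by simp
    with 1 2 4 m show ?thesis by simp
  qed
  then show "X \<in> borel_measurable M" "integrable M (\<lambda>\<omega>. X \<omega> ^ 4)"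
    "expectation X = 0" "expectation (\<lambda>\<omega>. (X \<omega>)\<^sup>2) = v" "expectation (\<lambda>\<omega>. X \<omega> ^ 4) = 3 * v\<^sup>2"
    by auto
qed

text \<open>Membership in \<open>L\<^sup>4\<close> and \<open>L\<^sup>2\<close>, as predicates closed under the operations that occur below. The square of
an \<open>L4\<close> variable is \<open>L2\<close>, and products of two \<open>L2\<close> variables are integrable.\<close>

definition L4 :: "('a \<Rightarrow> real) \<Rightarrow> bool" where
  "L4 X \<longleftrightarrow> X \<in> borel_measurable M \<and> integrable M (\<lambda>\<omega>. X \<omega> ^ 4)"

definition L2 :: "('a \<Rightarrow> real) \<Rightarrow> bool" where
  "L2 X \<longleftrightarrow> X \<in> borel_measurable M \<and> integrable M (\<lambda>\<omega>. (X \<omega>)\<^sup>2)"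

lemma L2_mult:
  assumes "L2 X" "L2 Y"
  shows "integrable M (\<lambda>\<omega>. X \<omega> * Y \<omega>)"
proof (rule Bochner_Integration.integrable_bound[where f = "\<lambda>\<omega>. (X \<omega>)\<^sup>2 + (Y \<omega>)\<^sup>2"])
  show "integrable M (\<lambda>\<omega>. (X \<omega>)\<^sup>2 + (Y \<omega>)\<^sup>2)" "(\<lambda>\<omega>. X \<omega> * Y \<omega>) \<in> borel_measurable M"
    using assms by (auto simp: L2_def)
  have "\<bar>x * y\<bar> \<le> x\<^sup>2 + y\<^sup>2" for x y :: real
    using sum_squares_bound[of "\<bar>x\<bar>" "\<bar>y\<bar>"] zero_le_power2[of x] zero_le_power2[of y]
    unfolding abs_mult power2_abs by linarith
  then show "AE \<omega> in M. norm (X \<omega> * Y \<omega>) \<le> norm ((X \<omega>)\<^sup>2 + (Y \<omega>)\<^sup>2)"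
    by (auto simp: abs_mult)
qed

lemma L2_add:
  assumes "L2 X" "L2 Y"
  shows "L2 (\<lambda>\<omega>. X \<omega> + Y \<omega>)"
  using assms L2_mult[OF assms] by (auto simp: L2_def power2_sum mult.assoc)

lemma L2_const: "L2 (\<lambda>_. c)" by (simp add: L2_def)

lemma L2_cmult: "L2 X \<Longrightarrow> L2 (\<lambda>\<omega>. c * X \<omega>)"
  by (auto simp: L2_def power_mult_distrib)

lemma L2_diff: "L2 X \<Longrightarrow> L2 Y \<Longrightarrow> L2 (\<lambda>\<omega>. X \<omega> - Y \<omega>)"
  using L2_add[of X "\<lambda>\<omega>. (-1) * Y \<omega>"] L2_cmult[of Y "-1"] by simp

lemma L2_sum: "(\<And>i. i \<in> I \<Longrightarrow> L2 (X i)) \<Longrightarrow> L2 (\<lambda>\<omega>. \<Sum>i\<in>I. X i \<omega>)"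
proof (induction I rule: infinite_finite_induct)
  case (insert i I)
  then show ?case using L2_add[of "X i" "\<lambda>\<omega>. \<Sum>i\<in>I. X i \<omega>"] by auto
qed (auto simp: L2_const)

lemma L2_integrable: "L2 X \<Longrightarrow> integrable M X"
  using L2_mult[of X "\<lambda>_. 1"] L2_const by simp

lemma L4_square: "L4 X \<Longrightarrow> L2 (\<lambda>\<omega>. (X \<omega>)\<^sup>2)"
  by (auto simp: L2_def L4_def)

lemma L4_L2: "L4 X \<Longrightarrow> L2 X"
  using L2_integrable[OF L4_square] by (auto simp: L2_def L4_def)

lemma L4_mult:
  assumes "L4 X" "L4 Y"
  shows "L2 (\<lambda>\<omega>. X \<omega> * Y \<omega>)"
  using L2_mult[OF L4_square[OF assms(1)] L4_square[OF assms(2)]] assms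
  by (auto simp: L2_def L4_def power_mult_distrib)

lemma L4_add:
  assumes "L4 X" "L4 Y"
  shows "L4 (\<lambda>\<omega>. X \<omega> + Y \<omega>)"
proof -
  have "L2 (\<lambda>\<omega>. (X \<omega>)\<^sup>2 + 2 * (X \<omega> * Y \<omega>) + (Y \<omega>)\<^sup>2)"
    using assms by (intro L2_add L2_cmult L4_square L4_mult)
  also have "(\<lambda>\<omega>. (X \<omega>)\<^sup>2 + 2 * (X \<omega> * Y \<omega>) + (Y \<omega>)\<^sup>2) = (\<lambda>\<omega>. (X \<omega> + Y \<omega>)\<^sup>2)"
    by (simp add: power2_sum fun_eq_iff)
  finally show ?thesis using assms by (auto simp: L4_def L2_def)
qed

lemma indep_expectation_mult:
  fixes X Y :: "'a \<Rightarrow> real"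
  assumes "indep_var borel X borel Y" "integrable M X" "integrable M Y"
  shows "integrable M (\<lambda>\<omega>. X \<omega> * Y \<omega>)" "expectation (\<lambda>\<omega>. X \<omega> * Y \<omega>) = expectation X * expectation Y"
  using indep_var_integrable[OF assms(1-3)] indep_var_lebesgue_integral[OF assms(1-3)] by auto

end

locale hilbert_brownian_motion = prob_space M
  for M :: "'w measure" +
  fixes C :: "'a::{real_inner, banach, second_countable_topology} \<Rightarrow>\<^sub>L 'a"
    and B :: "real \<Rightarrow> 'w \<Rightarrow> 'a"
  assumes bm: "brownian_motion M C B" and positive: "positive_operator C"
begin

lemma
  shows B_measurable: "0 \<le> s \<Longrightarrow> B s \<in> borel_measurable M"
    and B_zero: "AE \<omega> in M. B 0 \<omega> = 0"
    and B_continuous: "AE \<omega> in M. continuous_on {0..} (\<lambda>s. B s \<omega>)"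
    and B_normal: "0 \<le> r \<Longrightarrow> r \<le> s \<Longrightarrow>
      centered_normal M (\<lambda>\<omega>. (B s \<omega> - B r \<omega>) \<bullet> h) ((s - r) * (C h \<bullet> h))"
    and B_indep: "0 \<le> \<tau> 0 \<Longrightarrow> mono \<tau> \<Longrightarrow>
      indep_vars (\<lambda>_. borel) (\<lambda>k \<omega>. B (\<tau> (Suc k)) \<omega> - B (\<tau> k) \<omega>) {..<n::nat}"
  using bm unfolding brownian_motion_def by auto

lemma C_symmetric: "C x \<bullet> y = x \<bullet> C y" and C_nonneg: "0 \<le> C x \<bullet> x"
  using positive by (auto simp: positive_operator_def)

definition incr :: "real \<Rightarrow> real \<Rightarrow> 'a \<Rightarrow> 'w \<Rightarrow> real" where
  "incr r s x \<omega> = (B s \<omega> - B r \<omega>) \<bullet> x"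

lemma
  assumes "0 \<le> r" "r \<le> s"
  shows incr_L4: "L4 (incr r s x)"
    and incr_mean: "expectation (incr r s x) = 0"
    and incr_square: "expectation (\<lambda>\<omega>. (incr r s x \<omega>)\<^sup>2) = (s - r) * (C x \<bullet> x)"
    and incr_fourth: "expectation (\<lambda>\<omega>. incr r s x \<omega> ^ 4) = 3 * ((s - r) * (C x \<bullet> x))\<^sup>2"
proof -
  have v: "0 \<le> (s - r) * (C x \<bullet> x)" using assms C_nonneg by simp
  note m = centered_normal_moments[OF B_normal[OF assms] v, folded incr_def]
  show "L4 (incr r s x)" using m(1,2) by (simp add: L4_def)
  show "expectation (incr r s x) = 0" using m(3) by simp
  show "expectation (\<lambda>\<omega>. (incr r s x \<omega>)\<^sup>2) = (s - r) * (C x \<bullet> x)" by (rule m(4))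
  show "expectation (\<lambda>\<omega>. incr r s x \<omega> ^ 4) = 3 * ((s - r) * (C x \<bullet> x))\<^sup>2" by (rule m(5))
qed

text \<open>Polarisation of the variance, using that \<open>C\<close> is symmetric.\<close>

lemma incr_covariance:
  assumes "0 \<le> r" "r \<le> s"
  shows "expectation (\<lambda>\<omega>. incr r s x \<omega> * incr r s y \<omega>) = (s - r) * (C x \<bullet> y)"
proof -
  have L: "L2 (incr r s x)" "L2 (incr r s y)" using incr_L4[OF assms] L4_L2 by auto
  have "incr r s (x + y) \<omega> = incr r s x \<omega> + incr r s y \<omega>" for \<omega>
    by (simp add: incr_def inner_add_right)
  then have "expectation (\<lambda>\<omega>. (incr r s x \<omega> + incr r s y \<omega>)\<^sup>2) = (s - r) * (C (x + y) \<bullet> (x + y))"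
    using incr_square[OF assms, of "x + y"] by simp
  moreover have "expectation (\<lambda>\<omega>. (incr r s x \<omega> + incr r s y \<omega>)\<^sup>2) =
    expectation (\<lambda>\<omega>. (incr r s x \<omega>)\<^sup>2) + expectation (\<lambda>\<omega>. (incr r s y \<omega>)\<^sup>2)
    + 2 * expectation (\<lambda>\<omega>. incr r s x \<omega> * incr r s y \<omega>)"
    using L L2_mult[OF L] by (simp add: power2_sum L2_def mult.assoc)
  moreover have "C (x + y) \<bullet> (x + y) = C x \<bullet> x + C y \<bullet> y + 2 * (C x \<bullet> y)"
    using C_symmetric[of y x] by (simp add: blinfun.add_right inner_add_left inner_add_right inner_commute)
  ultimately show ?thesis
    using incr_square[OF assms, of x] incr_square[OF assms, of y] by (simp add: distrib_left)
qed

section \<open>Independence of the past\<close>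

lemma space_past [simp]: "space (past M B s) = space M"
  unfolding past_def by (rule space_measure_of) auto

lemma sets_past:
  "sets (past M B s) = sigma_sets (space M) {B r -` U \<inter> space M |r U. 0 \<le> r \<and> r \<le> s \<and> U \<in> sets borel}"
  unfolding past_def by (rule sets_measure_of) auto

lemma sets_past_subset: "sets (past M B s) \<subseteq> sets M"
  unfolding sets_past using B_measurable by (intro sets.sigma_sets_subset) (auto simp: measurable_def)

lemma past_mono:
  assumes "r \<le> s"
  shows "sets (past M B r) \<subseteq> sets (past M B s)"
  unfolding sets_past
  by (rule sigma_sets_mono, rule order_trans[OF _ sigma_sets_superset_generator]) (use assms in force)

lemma measurable_past_mono: "r \<le> s \<Longrightarrow> X \<in> borel_measurable (past M B r) \<Longrightarrow> X \<in> borel_measurable (past M B s)"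
  using past_mono[of r s] unfolding measurable_def by auto

lemma measurable_past_M: "X \<in> borel_measurable (past M B s) \<Longrightarrow> X \<in> borel_measurable M"
  using sets_past_subset[of s] unfolding measurable_def by auto

lemma B_measurable_past:
  assumes "0 \<le> r" "r \<le> s"
  shows "B r \<in> borel_measurable (past M B s)"
proof (rule measurableI)
  fix U :: "'a set" assume "U \<in> sets borel"
  then show "B r -` U \<inter> space (past M B s) \<in> sets (past M B s)"
    unfolding sets_past space_past using assms by (intro sigma_sets.Basic) auto
qed simp

lemma incr_measurable_past:
  assumes "0 \<le> r" "r \<le> r'" "r' \<le> s"
  shows "incr r r' x \<in> borel_measurable (past M B s)"
  unfolding incr_def using B_measurable_past[of r s] B_measurable_past[of r' s] assms
  by (intro borel_measurable_inner borel_measurable_diff) auto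

text \<open>A generator of the past that is closed under intersections, as the extension of independence to
generated \<open>\<sigma>\<close>-algebras requires.\<close>

definition cylinders :: "real \<Rightarrow> 'w set set" where
  "cylinders s = {{\<omega>\<in>space M. \<forall>r\<in>R. B r \<omega> \<in> U r} |R U. finite R \<and> R \<subseteq> {0..s} \<and> (\<forall>r. U r \<in> sets borel)}"

lemma cylinders_Int_stable: "Int_stable (cylinders s)"
proof (rule Int_stableI)
  fix a b assume "a \<in> cylinders s" "b \<in> cylinders s"
  then obtain R U R' U' where ab: "a = {\<omega>\<in>space M. \<forall>r\<in>R. B r \<omega> \<in> U r}" "b = {\<omega>\<in>space M. \<forall>r\<in>R'. B r \<omega> \<in> U' r}"
    and RU: "finite R" "R \<subseteq> {0..s}" "\<forall>r. U r \<in> sets borel" "finite R'" "R' \<subseteq> {0..s}" "\<forall>r. U' r \<in> sets borel"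
    unfolding cylinders_def by auto
  define V where "V r = (if r \<in> R then U r else UNIV) \<inter> (if r \<in> R' then U' r else UNIV)" for r
  have "a \<inter> b = {\<omega>\<in>space M. \<forall>r\<in>R \<union> R'. B r \<omega> \<in> V r}"
    unfolding ab V_def by auto
  moreover have "\<forall>r. V r \<in> sets borel" using RU by (auto simp: V_def)
  ultimately show "a \<inter> b \<in> cylinders s"
    unfolding cylinders_def using RU by (intro CollectI exI[of _ "R \<union> R'"] exI[of _ V]) auto
qed

lemma cylinders_events: "cylinders s \<subseteq> events"
proof
  fix a assume "a \<in> cylinders s"
  then obtain R U where a: "a = {\<omega>\<in>space M. \<forall>r\<in>R. B r \<omega> \<in> U r}"
    and RU: "finite R" "R \<subseteq> {0..s}" "\<forall>r. U r \<in> sets borel"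
    unfolding cylinders_def by auto
  have "{\<omega>\<in>space M. B r \<omega> \<in> U r} \<in> events" if "r \<in> R" for r
    using measurable_sets[OF B_measurable, of r "U r"] RU that
    by (auto simp: vimage_def Int_def conj_commute)
  then show "a \<in> events" unfolding a using RU(1) by (intro sets.sets_Collect_finite_All) auto
qed

lemma past_cylinders: "sets (past M B s) \<subseteq> sigma_sets (space M) (cylinders s)"
  unfolding sets_past
proof (rule sigma_sets_mono', safe)
  fix r :: real and U :: "'a set" assume *: "0 \<le> r" "r \<le> s" "U \<in> sets borel"
  have "B r -` U \<inter> space M = {\<omega>\<in>space M. \<forall>r'\<in>{r}. B r' \<omega> \<in> U}" by auto
  then show "B r -` U \<inter> space M \<in> cylinders s"
    unfolding cylinders_def using * by (intro CollectI exI[of _ "{r}"] exI[of _ "\<lambda>_. U"]) auto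
qed

text \<open>Sort the finitely many times in \<open>R\<close> together with \<open>0\<close> and \<open>s\<close>, and append \<open>s'\<close>. Almost surely \<open>B 0 = 0\<close>,
so \<open>B r\<close> is the sum of the increments up to \<open>r\<close>. Up to a null set the cylinder is thus an event \<open>a'\<close> of
the increments before \<open>s\<close>, which are jointly independent of the last one.\<close>

lemma cylinders_indep_increment:
  assumes s: "0 \<le> s" "s \<le> s'" and a: "a \<in> cylinders s" and A: "A \<in> sets borel"
  defines "b \<equiv> (\<lambda>\<omega>. B s' \<omega> - B s \<omega>) -` A \<inter> space M"
  shows "prob (a \<inter> b) = prob a * prob b"
proof -
  obtain R U where a: "a = {\<omega>\<in>space M. \<forall>r\<in>R. B r \<omega> \<in> U r}"
    and R: "finite R" "R \<subseteq> {0..s}" and U: "\<And>r. U r \<in> sets borel"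
    using a unfolding cylinders_def by auto
  define xs where "xs = sorted_list_of_set (insert 0 (insert s R))"
  have "finite (insert 0 (insert s R))" using R(1) by simp
  then have xs: "set xs = insert 0 (insert s R)" "sorted xs"
    unfolding xs_def by (rule set_sorted_list_of_set, intro sorted_sorted_list_of_set)
  define p where "p = length xs - 1"
  have ne: "xs \<noteq> []" using xs(1) by auto
  have len: "length xs = Suc p" using ne by (simp add: p_def)
  define \<tau> where "\<tau> k = (if k \<le> p then xs ! k else s')" for k
  have "xs ! k \<in> insert 0 (insert s R)" if "k \<le> p" for k
    using xs(1) nth_mem[of k xs] len that by auto
  then have bnd: "0 \<le> xs ! k \<and> xs ! k \<le> s" if "k \<le> p" for k
    using that R(2) s by fastforce
  have mono: "mono \<tau>"
    using xs(2) bnd s len by (intro monoI) (fastforce simp: \<tau>_def sorted_iff_nth_mono)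
  have ex: "\<exists>k\<le>p. xs ! k = r" if "r \<in> insert 0 (insert s R)" for r
    using that xs(1) len by (metis in_set_conv_nth less_Suc_eq_le)
  have \<tau>0: "\<tau> 0 = 0"
  proof -
    obtain k where "k \<le> p" "xs ! k = 0" using ex[of 0] by auto
    then have "xs ! 0 \<le> 0" using sorted_nth_mono[OF xs(2), of 0 k] len by simp
    with bnd[of 0] show ?thesis by (simp add: \<tau>_def)
  qed
  have \<tau>p: "\<tau> p = s"
  proof -
    obtain k where "k \<le> p" "xs ! k = s" using ex[of s] by auto
    then have "s \<le> xs ! p" using sorted_nth_mono[OF xs(2), of k p] len by simp
    with bnd[of p] show ?thesis by (simp add: \<tau>_def)
  qed
  have \<tau>Sp: "\<tau> (Suc p) = s'" by (simp add: \<tau>_def)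
  define d where "d k \<omega> = B (\<tau> (Suc k)) \<omega> - B (\<tau> k) \<omega>" for k \<omega>
  have "indep_vars (\<lambda>_. borel) d {..<Suc p}"
    unfolding d_def[abs_def] using \<tau>0 by (intro B_indep mono) simp
  then have ind: "indep_var (PiM {..<p} (\<lambda>_. borel)) (\<lambda>\<omega>. restrict (\<lambda>i. d i \<omega>) {..<p})
      (PiM {p} (\<lambda>_. borel)) (\<lambda>\<omega>. restrict (\<lambda>i. d i \<omega>) {p})"
    by (rule indep_var_restrict) auto
  define Q where "Q = {g \<in> space (PiM {..<p} (\<lambda>_. borel :: 'a measure)). \<forall>k\<in>{k. k \<le> p \<and> xs ! k \<in> R}. (\<Sum>j<k. g j) \<in> U (xs ! k)}"
  have Q: "Q \<in> sets (PiM {..<p} (\<lambda>_. borel))"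
    unfolding Q_def
  proof (intro sets.sets_Collect_finite_All)
    fix k assume k: "k \<in> {k. k \<le> p \<and> xs ! k \<in> R}"
    have "(\<lambda>g. \<Sum>j<k. g j) \<in> borel_measurable (PiM {..<p} (\<lambda>_. borel :: 'a measure))"
      using k by (intro borel_measurable_sum measurable_component_singleton) auto
    from measurable_sets[OF this U[of "xs ! k"]]
    show "{g \<in> space (PiM {..<p} (\<lambda>_. borel :: 'a measure)). (\<Sum>j<k. g j) \<in> U (xs ! k)} \<in> sets (PiM {..<p} (\<lambda>_. borel))"
      by (simp add: vimage_def Int_def conj_commute)
  qed auto
  define a' where "a' = (\<lambda>\<omega>. restrict (\<lambda>i. d i \<omega>) {..<p}) -` Q \<inter> space M"
  have rv: "(\<lambda>\<omega>. restrict (\<lambda>i. d i \<omega>) {..<p}) \<in> measurable M (PiM {..<p} (\<lambda>_. borel))"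
    by (rule indep_var_rv1[OF ind])
  have a': "a' \<in> events" unfolding a'_def by (rule measurable_sets[OF rv Q])
  have A': "{g \<in> space (PiM {p} (\<lambda>_. borel :: 'a measure)). g p \<in> A} \<in> sets (PiM {p} (\<lambda>_. borel))"
    using measurable_sets[OF measurable_component_singleton[of p "{p}" "\<lambda>_. borel :: 'a measure"] A]
    by (simp add: vimage_def Int_def conj_commute)
  have b: "b = (\<lambda>\<omega>. restrict (\<lambda>i. d i \<omega>) {p}) -` {g \<in> space (PiM {p} (\<lambda>_. borel :: 'a measure)). g p \<in> A} \<inter> space M"
    unfolding b_def by (auto simp: space_PiM d_def \<tau>p \<tau>Sp)
  have "indep_set
      (sigma_sets (space M) {(\<lambda>\<omega>. restrict (\<lambda>i. d i \<omega>) {..<p}) -` S \<inter> space M |S. S \<in> sets (PiM {..<p} (\<lambda>_. borel))})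
      (sigma_sets (space M) {(\<lambda>\<omega>. restrict (\<lambda>i. d i \<omega>) {p}) -` S \<inter> space M |S. S \<in> sets (PiM {p} (\<lambda>_. borel))})"
    using ind unfolding indep_var_eq by blast
  then have pr: "prob (a' \<inter> b) = prob a' * prob b"
  proof (rule indep_setD)
    show "a' \<in> sigma_sets (space M) {(\<lambda>\<omega>. restrict (\<lambda>i. d i \<omega>) {..<p}) -` S \<inter> space M |S. S \<in> sets (PiM {..<p} (\<lambda>_. borel))}"
      unfolding a'_def using Q by (intro sigma_sets.Basic CollectI exI[of _ Q] conjI refl)
    show "b \<in> sigma_sets (space M) {(\<lambda>\<omega>. restrict (\<lambda>i. d i \<omega>) {p}) -` S \<inter> space M |S. S \<in> sets (PiM {p} (\<lambda>_. borel))}"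
      unfolding b
      by (rule sigma_sets.Basic, rule CollectI, rule exI, rule conjI[OF refl A'])
  qed
  have ae: "AE \<omega> in M. \<omega> \<in> a \<longleftrightarrow> \<omega> \<in> a'"
    using B_zero AE_space
  proof eventually_elim
    fix \<omega> assume \<omega>: "B 0 \<omega> = 0" "\<omega> \<in> space M"
    have sum: "(\<Sum>j<k. d j \<omega>) = B (xs ! k) \<omega>" if "k \<le> p" for k
    proof -
      have "(\<Sum>j<k. d j \<omega>) = B (\<tau> k) \<omega> - B (\<tau> 0) \<omega>"
        unfolding d_def by (rule sum_lessThan_telescope)
      then show ?thesis using that \<omega> \<tau>0 by (simp add: \<tau>_def)
    qed
    have "\<omega> \<in> a' \<longleftrightarrow> (\<forall>k\<in>{k. k \<le> p \<and> xs ! k \<in> R}. (\<Sum>j<k. d j \<omega>) \<in> U (xs ! k))"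
      using \<omega>(2) by (auto simp: a'_def Q_def space_PiM)
    also have "\<dots> \<longleftrightarrow> (\<forall>k\<in>{k. k \<le> p \<and> xs ! k \<in> R}. B (xs ! k) \<omega> \<in> U (xs ! k))"
      using sum by auto
    also have "\<dots> \<longleftrightarrow> (\<forall>r\<in>R. B r \<omega> \<in> U r)" using ex by blast
    also have "\<dots> \<longleftrightarrow> \<omega> \<in> a" using \<omega>(2) by (simp add: a)
    finally show "\<omega> \<in> a \<longleftrightarrow> \<omega> \<in> a'" by simp
  qed
  have aM: "a \<in> events" using \<open>a \<in> cylinders s\<close> cylinders_events by auto
  have bM: "b \<in> events" unfolding b by (rule measurable_sets[OF indep_var_rv2[OF ind] A'])
  have "prob a = prob a'"
    using ae aM a' by (intro finite_measure_eq_AE) auto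
  moreover have "prob (a \<inter> b) = prob (a' \<inter> b)"
  proof (rule finite_measure_eq_AE)
    show "AE \<omega> in M. \<omega> \<in> a \<inter> b \<longleftrightarrow> \<omega> \<in> a' \<inter> b" using ae by eventually_elim auto
  qed (use aM a' bM in auto)
  ultimately show ?thesis using pr by simp
qed

lemma past_indep_increment:
  fixes Z :: "'w \<Rightarrow> real" and g :: "'a \<Rightarrow> real"
  assumes s: "0 \<le> s" "s \<le> s'" and Z: "Z \<in> borel_measurable (past M B s)"
    and g: "g \<in> borel_measurable borel"
  shows "indep_var borel Z borel (\<lambda>\<omega>. g (B s' \<omega> - B s \<omega>))"
proof -
  let ?D = "\<lambda>\<omega>. B s' \<omega> - B s \<omega>"
  let ?I = "{?D -` A \<inter> space M |A. A \<in> sets borel}"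
  have D: "?D \<in> borel_measurable M"
    using B_measurable[of s] B_measurable[of s'] s by (intro borel_measurable_diff) auto
  have "indep_set (cylinders s) ?I"
    using cylinders_events[of s] measurable_sets[OF D] cylinders_indep_increment[OF s]
    by (intro indep_setI) auto
  moreover have "Int_stable ?I"
  proof (rule Int_stableI)
    fix a b assume "a \<in> ?I" "b \<in> ?I"
    then obtain A A' where "a = ?D -` A \<inter> space M" "b = ?D -` A' \<inter> space M" "A \<in> sets borel" "A' \<in> sets borel"
      by blast
    then show "a \<inter> b \<in> ?I" by (intro CollectI exI[of _ "A \<inter> A'"]) auto
  qed
  ultimately have ind: "indep_set (sigma_sets (space M) (cylinders s)) (sigma_sets (space M) ?I)"
    by (intro indep_set_sigma_sets cylinders_Int_stable)
  have gD: "(\<lambda>\<omega>. g (?D \<omega>)) \<in> borel_measurable M" using measurable_compose[OF D g] .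
  have ZM: "Z \<in> borel_measurable M" by (rule measurable_past_M[OF Z])
  have "indep_set (sigma_sets (space M) {Z -` A \<inter> space M |A. A \<in> sets borel})
      (sigma_sets (space M) {(\<lambda>\<omega>. g (?D \<omega>)) -` A \<inter> space M |A. A \<in> sets borel})"
  proof (rule indep_setI)
    have *: "sigma_sets (space M) {Z -` A \<inter> space M |A. A \<in> sets borel} \<subseteq> sigma_sets (space M) (cylinders s)"
    proof (rule sigma_sets_mono, safe)
      fix A :: "real set" assume "A \<in> sets borel"
      then have "Z -` A \<inter> space M \<in> sets (past M B s)" using measurable_sets[OF Z, of A] by simp
      then show "Z -` A \<inter> space M \<in> sigma_sets (space M) (cylinders s)" using past_cylinders by blast
    qed
    have **: "sigma_sets (space M) {(\<lambda>\<omega>. g (?D \<omega>)) -` A \<inter> space M |A. A \<in> sets borel} \<subseteq> sigma_sets (space M) ?I"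
    proof (rule sigma_sets_mono, safe)
      fix A :: "real set" assume "A \<in> sets borel"
      then have "g -` A \<in> sets borel" using measurable_sets[OF g, of A] by simp
      moreover have "(\<lambda>\<omega>. g (?D \<omega>)) -` A \<inter> space M = ?D -` (g -` A) \<inter> space M" by auto
      ultimately show "(\<lambda>\<omega>. g (?D \<omega>)) -` A \<inter> space M \<in> sigma_sets (space M) ?I"
        by (intro sigma_sets.Basic) auto
    qed
    show "sigma_sets (space M) {Z -` A \<inter> space M |A. A \<in> sets borel} \<subseteq> events"
      using * indep_setD_ev1[OF ind] by blast
    show "sigma_sets (space M) {(\<lambda>\<omega>. g (?D \<omega>)) -` A \<inter> space M |A. A \<in> sets borel} \<subseteq> events"
      using ** indep_setD_ev2[OF ind] by blast
    show "prob (a \<inter> b) = prob a * prob b"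
      if "a \<in> sigma_sets (space M) {Z -` A \<inter> space M |A. A \<in> sets borel}"
        "b \<in> sigma_sets (space M) {(\<lambda>\<omega>. g (?D \<omega>)) -` A \<inter> space M |A. A \<in> sets borel}" for a b
      using indep_setD[OF ind] that * ** by blast
  qed
  with gD ZM show ?thesis unfolding indep_var_eq by simp
qed

end

section \<open>The Ito isometry\<close>

context hilbert_brownian_motion
begin

lemma past_expectation_mult:
  fixes Z :: "'w \<Rightarrow> real" and g :: "'a \<Rightarrow> real"
  assumes "0 \<le> s" "s \<le> s'" "Z \<in> borel_measurable (past M B s)" "integrable M Z"
    and "g \<in> borel_measurable borel" "integrable M (\<lambda>\<omega>. g (B s' \<omega> - B s \<omega>))"
  shows "integrable M (\<lambda>\<omega>. Z \<omega> * g (B s' \<omega> - B s \<omega>))"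
    "expectation (\<lambda>\<omega>. Z \<omega> * g (B s' \<omega> - B s \<omega>)) = expectation Z * expectation (\<lambda>\<omega>. g (B s' \<omega> - B s \<omega>))"
  using indep_expectation_mult[OF past_indep_increment[OF assms(1-3,5)] assms(4,6)] by auto

lemma past_L2_incr:
  assumes s: "0 \<le> s" "s \<le> s'" and Z: "Z \<in> borel_measurable (past M B s)" "L2 Z"
  shows "L2 (\<lambda>\<omega>. Z \<omega> * incr s s' x \<omega>)"
proof -
  have "integrable M (\<lambda>\<omega>. (Z \<omega>)\<^sup>2 * ((B s' \<omega> - B s \<omega>) \<bullet> x)\<^sup>2)"
    using Z L4_L2[OF incr_L4[OF s, of x]]
    by (intro past_expectation_mult(1)[OF s, where g = "\<lambda>v. (v \<bullet> x)\<^sup>2"])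
      (auto simp: L2_def incr_def[abs_def])
  moreover have "incr s s' x \<in> borel_measurable M" using incr_L4[OF s] by (simp add: L4_def)
  ultimately show ?thesis using Z(2) by (auto simp: L2_def power_mult_distrib simp flip: incr_def)
qed

lemma past_incr_mean_zero:
  assumes s: "0 \<le> s" "s \<le> s'" and Z: "Z \<in> borel_measurable (past M B s)" "integrable M Z"
  shows "integrable M (\<lambda>\<omega>. Z \<omega> * incr s s' x \<omega>)" "expectation (\<lambda>\<omega>. Z \<omega> * incr s s' x \<omega>) = 0"
proof -
  have i: "integrable M (\<lambda>\<omega>. (B s' \<omega> - B s \<omega>) \<bullet> x)"
    using L2_integrable[OF L4_L2[OF incr_L4[OF s, of x]]] by (simp add: incr_def[abs_def])
  note * = past_expectation_mult[OF s Z _ i]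
  show "integrable M (\<lambda>\<omega>. Z \<omega> * incr s s' x \<omega>)" "expectation (\<lambda>\<omega>. Z \<omega> * incr s s' x \<omega>) = 0"
    using * incr_mean[OF s, of x] by (simp_all add: incr_def[abs_def])
qed

lemma past_incr_square:
  assumes s: "0 \<le> s" "s \<le> s'" and Z: "Z \<in> borel_measurable (past M B s)" "integrable M Z"
  shows "integrable M (\<lambda>\<omega>. Z \<omega> * (incr s s' x \<omega>)\<^sup>2)"
    "expectation (\<lambda>\<omega>. Z \<omega> * (incr s s' x \<omega>)\<^sup>2) = expectation Z * ((s' - s) * (C x \<bullet> x))"
proof -
  have i: "integrable M (\<lambda>\<omega>. ((B s' \<omega> - B s \<omega>) \<bullet> x)\<^sup>2)"
    using L4_L2[OF incr_L4[OF s, of x]] by (simp add: incr_def[abs_def] L2_def)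
  note * = past_expectation_mult[OF s Z _ i]
  show "integrable M (\<lambda>\<omega>. Z \<omega> * (incr s s' x \<omega>)\<^sup>2)"
    "expectation (\<lambda>\<omega>. Z \<omega> * (incr s s' x \<omega>)\<^sup>2) = expectation Z * ((s' - s) * (C x \<bullet> x))"
    using * incr_square[OF s, of x] by (simp_all add: incr_def[abs_def])
qed

lemma incr_split: "incr r s' x \<omega> = incr r s x \<omega> + incr s s' x \<omega>"
  by (simp add: incr_def inner_diff_left)

lemma incr_refl [simp]: "incr r r x \<omega> = 0"
  by (simp add: incr_def)

text \<open>If the first interval ends before the second begins, the second increment is independent of
everything else and has mean zero. Otherwise both increments are split at the ends of the common
part: its square contributes the length of the overlap, and every other product contains a factor of
mean zero that is independent of the remaining ones.\<close>

lemma ito_cross_aux: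
  assumes p: "0 \<le> p" "p \<le> q" "p \<le> p'" "p' \<le> q'"
    and a: "a \<in> borel_measurable (past M B p)" "L2 a"
    and a': "a' \<in> borel_measurable (past M B p')" "L2 a'"
  shows "expectation (\<lambda>\<omega>. (a \<omega> * incr p q x \<omega>) * (a' \<omega> * incr p' q' x \<omega>)) =
    (C x \<bullet> x) * (expectation (\<lambda>\<omega>. a \<omega> * a' \<omega>) * max 0 (min q q' - max p p'))"
proof (cases "q \<le> p'")
  case True
  have "L2 (\<lambda>\<omega>. a \<omega> * incr p q x \<omega>)" by (rule past_L2_incr[OF p(1,2) a])
  from L2_mult[OF this a'(2)]
  have i: "integrable M (\<lambda>\<omega>. a \<omega> * incr p q x \<omega> * a' \<omega>)" .
  have m: "(\<lambda>\<omega>. a \<omega> * incr p q x \<omega> * a' \<omega>) \<in> borel_measurable (past M B p')"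
    using measurable_past_mono[OF p(3) a(1)] incr_measurable_past[OF p(1,2) True] a'(1) by simp
  have "expectation (\<lambda>\<omega>. a \<omega> * incr p q x \<omega> * a' \<omega> * incr p' q' x \<omega>) = 0"
    using p by (intro past_incr_mean_zero(2)[OF _ _ m i]) auto
  then show ?thesis using True p by (simp add: mult.assoc)
next
  case False
  define m where "m = min q q'"
  have m: "p' \<le> m" "m \<le> q" "m \<le> q'" using False p by (auto simp: m_def)
  have p0: "0 \<le> p'" "0 \<le> m" using p m by auto
  have ap': "a \<in> borel_measurable (past M B p')" by (rule measurable_past_mono[OF p(3) a(1)])
  have aa: "integrable M (\<lambda>\<omega>. a \<omega> * a' \<omega>)" by (rule L2_mult[OF a(2) a'(2)])
  have aam: "(\<lambda>\<omega>. a \<omega> * a' \<omega>) \<in> borel_measurable (past M B p')" using ap' a'(1) by simp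
  let ?w = "incr p p' x" and ?u = "incr p' m x" and ?v = "incr m q x" and ?v' = "incr m q' x"
  have 1: "integrable M (\<lambda>\<omega>. a \<omega> * ?w \<omega> * a' \<omega>)"
    by (rule L2_mult[OF past_L2_incr[OF p(1,3) a] a'(2)])
  have m1: "(\<lambda>\<omega>. a \<omega> * ?w \<omega> * a' \<omega>) \<in> borel_measurable (past M B p')"
    using ap' incr_measurable_past[OF p(1,3) order_refl] a'(1) by simp
  note E1 = past_incr_mean_zero[OF p0(1) p(4) m1 1, of x]
  note E2 = past_incr_square[OF p0(1) m(1) aam aa, of x]
  note E3 = past_incr_mean_zero[OF p0(1) m(1) aam aa, of x]
  have m3: "(\<lambda>\<omega>. a \<omega> * a' \<omega> * ?u \<omega>) \<in> borel_measurable (past M B m)"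
    using measurable_past_mono[OF m(1) aam] incr_measurable_past[OF p0(1) m(1) order_refl] by simp
  note E4 = past_incr_mean_zero[OF p0(2) m(2) m3 E3(1), of x]
  note E5 = past_incr_mean_zero[OF p0(2) m(3) m3 E3(1), of x]
  have vv: "?v \<omega> * ?v' \<omega> = 0" for \<omega> by (cases "q \<le> q'") (auto simp: m_def)
  have "(a \<omega> * incr p q x \<omega>) * (a' \<omega> * incr p' q' x \<omega>) =
      a \<omega> * ?w \<omega> * a' \<omega> * incr p' q' x \<omega> + a \<omega> * a' \<omega> * (?u \<omega>)\<^sup>2
      + a \<omega> * a' \<omega> * ?u \<omega> * ?v \<omega> + a \<omega> * a' \<omega> * ?u \<omega> * ?v' \<omega>" (is "?l = ?r") for \<omega>
  proof -
    have "?l = a \<omega> * a' \<omega> * ((?w \<omega> + ?u \<omega> + ?v \<omega>) * incr p' q' x \<omega>)"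
      using incr_split[of p q x \<omega> p'] incr_split[of p' q x \<omega> m] by (simp add: mult_ac)
    also have "(?w \<omega> + ?u \<omega> + ?v \<omega>) * incr p' q' x \<omega> = ?w \<omega> * incr p' q' x \<omega> + (?u \<omega> + ?v \<omega>) * (?u \<omega> + ?v' \<omega>)"
      using incr_split[of p' q' x \<omega> m] by (simp add: algebra_simps)
    also have "(?u \<omega> + ?v \<omega>) * (?u \<omega> + ?v' \<omega>) = (?u \<omega>)\<^sup>2 + ?u \<omega> * ?v \<omega> + ?u \<omega> * ?v' \<omega>"
      using vv[of \<omega>] by (simp add: power2_eq_square algebra_simps)
    finally show ?thesis by (simp add: algebra_simps)
  qed
  then have "expectation (\<lambda>\<omega>. (a \<omega> * incr p q x \<omega>) * (a' \<omega> * incr p' q' x \<omega>)) =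
    expectation (\<lambda>\<omega>. a \<omega> * ?w \<omega> * a' \<omega> * incr p' q' x \<omega> + a \<omega> * a' \<omega> * (?u \<omega>)\<^sup>2
      + a \<omega> * a' \<omega> * ?u \<omega> * ?v \<omega> + a \<omega> * a' \<omega> * ?u \<omega> * ?v' \<omega>)" by simp
  also have "\<dots> = expectation (\<lambda>\<omega>. a \<omega> * a' \<omega>) * ((m - p') * (C x \<bullet> x))"
    using E1 E2 E4 E5 by simp
  finally show ?thesis using p m False by (simp add: m_def max_def mult_ac)
qed

lemma ito_cross:
  assumes p: "0 \<le> p" "p \<le> q" "0 \<le> p'" "p' \<le> q'"
    and a: "a \<in> borel_measurable (past M B p)" "L2 a"
    and a': "a' \<in> borel_measurable (past M B p')" "L2 a'"
  shows "expectation (\<lambda>\<omega>. (a \<omega> * incr p q x \<omega>) * (a' \<omega> * incr p' q' x \<omega>)) =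
    (C x \<bullet> x) * (expectation (\<lambda>\<omega>. a \<omega> * a' \<omega>) * max 0 (min q q' - max p p'))"
proof (cases "p \<le> p'")
  case True
  then show ?thesis using assms by (intro ito_cross_aux)
next
  case False
  then have "expectation (\<lambda>\<omega>. (a' \<omega> * incr p' q' x \<omega>) * (a \<omega> * incr p q x \<omega>)) =
    (C x \<bullet> x) * (expectation (\<lambda>\<omega>. a' \<omega> * a \<omega>) * max 0 (min q' q - max p' p))"
    using assms by (intro ito_cross_aux) auto
  then show ?thesis by (simp add: mult.commute min.commute max.commute)
qed

lemma integral_indicator_overlap:
  fixes p q p' q' :: real
  assumes "p \<le> q" "p' \<le> q'"
  shows "integrable lborel (\<lambda>s. indicator {p<..q} s * indicator {p'<..q'} s :: real)"
    "(\<integral>s. indicator {p<..q} s * indicator {p'<..q'} s \<partial>lborel) = max 0 (min q q' - max p p')"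
proof -
  have "(\<lambda>s. indicator {p<..q} s * indicator {p'<..q'} s :: real) = indicator {max p p'<..min q q'}"
    by (auto simp: fun_eq_iff indicator_def)
  moreover have "integrable lborel (indicator {l<..u} :: real \<Rightarrow> real)"
    "(\<integral>s. indicator {l<..u} s \<partial>lborel) = max 0 (u - l)" for l u :: real
    by (cases "l \<le> u"; simp add: integrable_indicator_iff)+
  ultimately show "integrable lborel (\<lambda>s. indicator {p<..q} s * indicator {p'<..q'} s :: real)"
    "(\<integral>s. indicator {p<..q} s * indicator {p'<..q'} s \<partial>lborel) = max 0 (min q q' - max p p')"
    by simp_all
qed

text \<open>The intervals may overlap arbitrarily, so the difference of two elementary integrals over different
partitions is an instance: both sides expand into double sums with the terms of \<open>ito_cross\<close>.\<close>

lemma ito_isometry: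
  assumes K: "finite K"
    and p: "\<And>k. k \<in> K \<Longrightarrow> 0 \<le> p k \<and> p k \<le> q k"
    and a: "\<And>k. k \<in> K \<Longrightarrow> a k \<in> borel_measurable (past M B (p k))" "\<And>k. k \<in> K \<Longrightarrow> L2 (a k)"
  shows "L2 (\<lambda>\<omega>. \<Sum>k\<in>K. a k \<omega> * incr (p k) (q k) x \<omega>)"
    "ennreal (expectation (\<lambda>\<omega>. (\<Sum>k\<in>K. a k \<omega> * incr (p k) (q k) x \<omega>)\<^sup>2)) = ennreal (C x \<bullet> x) *
      (\<integral>\<^sup>+\<omega>. \<integral>\<^sup>+s. ennreal ((\<Sum>k\<in>K. indicator {p k<..q k} s * a k \<omega>)\<^sup>2) \<partial>lborel \<partial>M)"
proof -
  have L: "L2 (\<lambda>\<omega>. a k \<omega> * incr (p k) (q k) x \<omega>)" if "k \<in> K" for k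
    using that p[OF that] a[OF that] by (intro past_L2_incr) auto
  then show "L2 (\<lambda>\<omega>. \<Sum>k\<in>K. a k \<omega> * incr (p k) (q k) x \<omega>)" by (rule L2_sum)
  define ov where "ov k l = max 0 (min (q k) (q l) - max (p k) (p l))" for k l
  have aa: "integrable M (\<lambda>\<omega>. a k \<omega> * a l \<omega>)" if "k \<in> K" "l \<in> K" for k l
    by (rule L2_mult[OF a(2)[OF that(1)] a(2)[OF that(2)]])
  have "expectation (\<lambda>\<omega>. (\<Sum>k\<in>K. a k \<omega> * incr (p k) (q k) x \<omega>)\<^sup>2) =
    expectation (\<lambda>\<omega>. \<Sum>k\<in>K. \<Sum>l\<in>K. (a k \<omega> * incr (p k) (q k) x \<omega>) * (a l \<omega> * incr (p l) (q l) x \<omega>))"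
    by (simp add: power2_eq_square sum_product)
  also have "\<dots> = (\<Sum>k\<in>K. \<Sum>l\<in>K. expectation (\<lambda>\<omega>. (a k \<omega> * incr (p k) (q k) x \<omega>) * (a l \<omega> * incr (p l) (q l) x \<omega>)))"
    using L2_mult[OF L L] by (subst Bochner_Integration.integral_sum, auto intro!: Bochner_Integration.integrable_sum)+
  also have "\<dots> = (\<Sum>k\<in>K. \<Sum>l\<in>K. (C x \<bullet> x) * (expectation (\<lambda>\<omega>. a k \<omega> * a l \<omega>) * ov k l))"
    unfolding ov_def using p a by (intro sum.cong refl ito_cross) auto
  also have "\<dots> = (C x \<bullet> x) * expectation (\<lambda>\<omega>. \<Sum>k\<in>K. \<Sum>l\<in>K. a k \<omega> * a l \<omega> * ov k l)"
    using aa by (simp add: sum_distrib_left)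
  finally have E: "expectation (\<lambda>\<omega>. (\<Sum>k\<in>K. a k \<omega> * incr (p k) (q k) x \<omega>)\<^sup>2) =
    (C x \<bullet> x) * expectation (\<lambda>\<omega>. \<Sum>k\<in>K. \<Sum>l\<in>K. a k \<omega> * a l \<omega> * ov k l)" .
  have inner: "(\<integral>\<^sup>+s. ennreal ((\<Sum>k\<in>K. indicator {p k<..q k} s * a k \<omega>)\<^sup>2) \<partial>lborel) =
      ennreal (\<Sum>k\<in>K. \<Sum>l\<in>K. a k \<omega> * a l \<omega> * ov k l)"
    and nonneg: "0 \<le> (\<Sum>k\<in>K. \<Sum>l\<in>K. a k \<omega> * a l \<omega> * ov k l)" for \<omega>
  proof -
    have eq: "(\<Sum>k\<in>K. indicator {p k<..q k} s * a k \<omega>)\<^sup>2 =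
      (\<Sum>k\<in>K. \<Sum>l\<in>K. a k \<omega> * a l \<omega> * (indicator {p k<..q k} s * indicator {p l<..q l} s))" for s
      by (simp add: power2_eq_square sum_product mult_ac)
    have int: "integrable lborel (\<lambda>s. \<Sum>k\<in>K. \<Sum>l\<in>K. a k \<omega> * a l \<omega> * (indicator {p k<..q k} s * indicator {p l<..q l} s :: real))"
      using p by (intro Bochner_Integration.integrable_sum integrable_mult_right integral_indicator_overlap(1)) auto
    have val: "(\<integral>s. (\<Sum>k\<in>K. \<Sum>l\<in>K. a k \<omega> * a l \<omega> * (indicator {p k<..q k} s * indicator {p l<..q l} s)) \<partial>lborel)
      = (\<Sum>k\<in>K. \<Sum>l\<in>K. a k \<omega> * a l \<omega> * ov k l)"
      using p integral_indicator_overlap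
      by (subst Bochner_Integration.integral_sum, (intro Bochner_Integration.integrable_sum integrable_mult_right, auto)[1])
        (simp add: Bochner_Integration.integral_sum ov_def)
    show "0 \<le> (\<Sum>k\<in>K. \<Sum>l\<in>K. a k \<omega> * a l \<omega> * ov k l)"
      unfolding val[symmetric] eq[symmetric] by (intro Bochner_Integration.integral_nonneg) simp
    show "(\<integral>\<^sup>+s. ennreal ((\<Sum>k\<in>K. indicator {p k<..q k} s * a k \<omega>)\<^sup>2) \<partial>lborel) =
      ennreal (\<Sum>k\<in>K. \<Sum>l\<in>K. a k \<omega> * a l \<omega> * ov k l)"
      unfolding val[symmetric] eq
      by (rule nn_integral_eq_integral[OF int]) (simp flip: eq)
  qed
  have "(\<integral>\<^sup>+\<omega>. ennreal (\<Sum>k\<in>K. \<Sum>l\<in>K. a k \<omega> * a l \<omega> * ov k l) \<partial>M) =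
    ennreal (expectation (\<lambda>\<omega>. \<Sum>k\<in>K. \<Sum>l\<in>K. a k \<omega> * a l \<omega> * ov k l))"
    using aa nonneg by (intro nn_integral_eq_integral) (auto intro!: Bochner_Integration.integrable_sum)
  then show "ennreal (expectation (\<lambda>\<omega>. (\<Sum>k\<in>K. a k \<omega> * incr (p k) (q k) x \<omega>)\<^sup>2)) = ennreal (C x \<bullet> x) *
      (\<integral>\<^sup>+\<omega>. \<integral>\<^sup>+s. ennreal ((\<Sum>k\<in>K. indicator {p k<..q k} s * a k \<omega>)\<^sup>2) \<partial>lborel \<partial>M)"
    unfolding E inner by (simp add: ennreal_mult' C_nonneg)
qed

end

section \<open>Dyadic approximation of the stochastic integral\<close>

definition grid :: "real \<Rightarrow> nat \<Rightarrow> nat \<Rightarrow> real" where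
  "grid t k l = t * real l / 2 ^ k"

lemma grid_mono: "0 \<le> t \<Longrightarrow> l \<le> l' \<Longrightarrow> grid t k l \<le> grid t k l'"
  by (auto simp: grid_def intro!: divide_right_mono mult_left_mono)

lemma grid_nonneg: "0 \<le> t \<Longrightarrow> 0 \<le> grid t k l"
  by (simp add: grid_def)

lemma grid_Suc_diff: "grid t k (Suc l) - grid t k l = t / 2 ^ k"
  by (simp add: grid_def field_simps)

lemma grid_cell:
  assumes "0 < s" "s \<le> t"
  obtains l where "l < 2 ^ k" "grid t k l < s" "s \<le> grid t k (Suc l)"
proof
  define j where "j = \<lceil>s * 2 ^ k / t\<rceil>"
  have t: "0 < t" using assms by simp
  have x: "0 < s * 2 ^ k / t" "s * 2 ^ k / t \<le> 2 ^ k" using assms t by (auto simp: field_simps)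
  have j: "1 \<le> j" "j \<le> 2 ^ k" "of_int j - 1 < s * 2 ^ k / t" "s * 2 ^ k / t \<le> of_int j"
    using x ceiling_correct[of "s * 2 ^ k / t"] unfolding j_def
    by (auto simp: ceiling_le_iff le_ceiling_iff)
  define l where "l = nat (j - 1)"
  have l: "real l = of_int j - 1" "int l = j - 1" using j(1) by (auto simp: l_def)
  have "int l < 2 ^ k" using l(2) j(2) by simp
  then show "l < 2 ^ k" by (metis of_nat_less_iff of_nat_numeral of_nat_power)
  show "grid t k l < s" using j(3) t by (simp add: grid_def l(1) field_simps)
  show "s \<le> grid t k (Suc l)" using j(4) t by (simp add: grid_def l(1) field_simps)
qed

context hilbert_brownian_motion
begin

definition dyadic_integral :: "real \<Rightarrow> nat \<Rightarrow> 'w \<Rightarrow> 'a \<Rightarrow>\<^sub>L 'a" where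
  "dyadic_integral t k = elementary_integral B (2 ^ k) (grid t k) (\<lambda>l. B (grid t k l))"

definition dyadic_process :: "real \<Rightarrow> nat \<Rightarrow> real \<Rightarrow> 'w \<Rightarrow> 'a" where
  "dyadic_process t k = elementary_process (2 ^ k) (grid t k) (\<lambda>l. B (grid t k l))"

lemma elementary_integral_entry:
  "elementary_integral B n \<tau> X \<omega> x \<bullet> y = (\<Sum>k<n. (X k \<omega> \<bullet> y) * incr (\<tau> k) (\<tau> (Suc k)) x \<omega>)"
  by (simp add: elementary_integral_def blinfun.sum_left tensor_op_apply inner_sum_left incr_def
      inner_commute[of x] mult.commute)

lemma elementary_process_entry:
  "elementary_process n \<tau> X s \<omega> \<bullet> y = (\<Sum>k<n. indicator {\<tau> k<..\<tau> (Suc k)} s * (X k \<omega> \<bullet> y))"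
  by (simp add: elementary_process_def inner_sum_left)

lemma dyadic_process_cell:
  assumes t: "0 \<le> t" and l: "l < 2 ^ k" "grid t k l < s" "s \<le> grid t k (Suc l)"
  shows "dyadic_process t k s \<omega> = B (grid t k l) \<omega>"
proof -
  have "dyadic_process t k s \<omega> = (\<Sum>j<2 ^ k. if j = l then B (grid t k l) \<omega> else 0)"
    unfolding dyadic_process_def elementary_process_def
  proof (intro sum.cong refl)
    fix j
    show "indicator {grid t k j<..grid t k (Suc j)} s *\<^sub>R B (grid t k j) \<omega> = (if j = l then B (grid t k l) \<omega> else 0)"
    proof (cases j l rule: linorder_cases)
      case less
      then have "grid t k (Suc j) \<le> grid t k l" by (intro grid_mono t) simp
      with l less show ?thesis by (simp add: indicator_def)
    next
      case greater
      then have "grid t k (Suc l) \<le> grid t k j" by (intro grid_mono t) simp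
      with l greater show ?thesis by (simp add: indicator_def)
    qed (use l in simp)
  qed
  then show ?thesis using l(1) by simp
qed

lemma dyadic_process_outside:
  assumes t: "0 \<le> t" and s: "s \<notin> {0<..t}"
  shows "dyadic_process t k s \<omega> = 0"
  unfolding dyadic_process_def elementary_process_def
proof (intro sum.neutral ballI)
  fix l :: nat assume "l \<in> {..<2 ^ k}"
  then have "grid t k (Suc l) \<le> grid t k (2 ^ k)" by (intro grid_mono t) auto
  then have "grid t k (Suc l) \<le> t" by (simp add: grid_def)
  with s grid_nonneg[OF t, of k l] show "indicator {grid t k l<..grid t k (Suc l)} s *\<^sub>R B (grid t k l) \<omega> = 0"
    by (auto simp: indicator_def)
qed

lemma dyadic_process_tendsto:
  assumes cont: "continuous_on {0..} (\<lambda>s. B s \<omega>)" and s: "0 < s" "s \<le> t"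
  shows "(\<lambda>k. dyadic_process t k s \<omega>) \<longlonglongrightarrow> B s \<omega>"
proof -
  have t: "0 \<le> t" using s by simp
  have "\<exists>r. dyadic_process t k s \<omega> = B r \<omega> \<and> 0 \<le> r \<and> r < s \<and> s - t / 2 ^ k \<le> r" for k
  proof -
    obtain l where l: "l < 2 ^ k" "grid t k l < s" "s \<le> grid t k (Suc l)" using grid_cell[OF s] .
    then show ?thesis
      using dyadic_process_cell[OF t l] grid_nonneg[OF t, of k l] grid_Suc_diff[of t k l]
      by (intro exI[of _ "grid t k l"]) auto
  qed
  then obtain r where r: "\<And>k. dyadic_process t k s \<omega> = B (r k) \<omega>" "\<And>k. 0 \<le> r k" "\<And>k. r k < s"
    "\<And>k. s - t / 2 ^ k \<le> r k" by metis
  have "(\<lambda>k. s - t * (1 / 2) ^ k) \<longlonglongrightarrow> s - t * 0"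
    by (intro tendsto_intros LIMSEQ_power_zero) simp
  then have "(\<lambda>k. s - t / 2 ^ k) \<longlonglongrightarrow> s" by (simp add: power_divide)
  then have "r \<longlonglongrightarrow> s"
    by (rule tendsto_sandwich[rotated 2, OF _ tendsto_const]) (use r(4) less_imp_le[OF r(3)] in auto)
  then have "(\<lambda>k. B (r k) \<omega>) \<longlonglongrightarrow> B s \<omega>"
    by (rule continuous_on_tendsto_compose[OF cont]) (use r s in auto)
  then show ?thesis by (simp add: r)
qed

text \<open>A jointly measurable version of the Brownian motion on \<open>[0, t]\<close>, so that Tonelli's theorem applies; the
given process is only known to be measurable for each fixed time and to have continuous paths.\<close>

definition limit_path :: "real \<Rightarrow> real \<Rightarrow> 'w \<Rightarrow> 'a" where
  "limit_path t s \<omega> = lim (\<lambda>k. dyadic_process t k s \<omega>)"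

lemma limit_path_eq: "AE \<omega> in M. \<forall>s\<in>{0..t}. limit_path t s \<omega> = B s \<omega>"
  using B_continuous B_zero
proof eventually_elim
  fix \<omega> assume \<omega>: "continuous_on {0..} (\<lambda>s. B s \<omega>)" "B 0 \<omega> = 0"
  show "\<forall>s\<in>{0..t}. limit_path t s \<omega> = B s \<omega>"
  proof
    fix s assume s: "s \<in> {0..t}"
    show "limit_path t s \<omega> = B s \<omega>"
    proof (cases "s = 0")
      case True
      have "dyadic_process t k 0 \<omega> = 0" for k using s by (intro dyadic_process_outside) auto
      with True \<omega> show ?thesis by (simp add: limit_path_def)
    next
      case False
      then show ?thesis
        unfolding limit_path_def using s by (intro limI dyadic_process_tendsto \<omega>) auto
    qed
  qed
qed

lemma B_AE_eq_limit_path: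
  assumes "s \<in> {0..t}"
  shows "AE \<omega> in M. limit_path t s \<omega> = B s \<omega>"
  using limit_path_eq[of t] by eventually_elim (use assms in auto)

lemma dyadic_process_measurable [measurable]:
  assumes "0 \<le> t"
  shows "(\<lambda>(s, \<omega>). dyadic_process t k s \<omega>) \<in> borel_measurable (lborel \<Otimes>\<^sub>M M)"
proof -
  have [measurable]: "B (grid t k l) \<in> borel_measurable M" for l
    by (rule B_measurable) (rule grid_nonneg[OF assms])
  show ?thesis unfolding dyadic_process_def elementary_process_def by measurable
qed

lemma limit_path_measurable:
  assumes "0 \<le> t"
  shows "(\<lambda>(s, \<omega>). limit_path t s \<omega>) \<in> borel_measurable (lborel \<Otimes>\<^sub>M M)"
proof -
  have "(\<lambda>p. lim (\<lambda>k. case p of (s, \<omega>) \<Rightarrow> dyadic_process t k s \<omega>)) \<in> borel_measurable (lborel \<Otimes>\<^sub>M M)"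
    by (rule borel_measurable_lim_metric) (rule dyadic_process_measurable[OF assms])
  also have "(\<lambda>p. lim (\<lambda>k. case p of (s, \<omega>) \<Rightarrow> dyadic_process t k s \<omega>)) = (\<lambda>(s, \<omega>). limit_path t s \<omega>)"
    by (auto simp: limit_path_def)
  finally show ?thesis .
qed

lemma B_L2:
  assumes "0 \<le> s"
  shows "L2 (\<lambda>\<omega>. B s \<omega> \<bullet> y)"
proof -
  have m: "(\<lambda>\<omega>. B s \<omega> \<bullet> y) \<in> borel_measurable M" using B_measurable[OF assms] by simp
  have L: "L2 (incr 0 s y)" by (rule L4_L2, rule incr_L4) (use assms in auto)
  have "AE \<omega> in M. (incr 0 s y \<omega>)\<^sup>2 = (B s \<omega> \<bullet> y)\<^sup>2"
    using B_zero by eventually_elim (simp add: incr_def)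
  then have "integrable M (\<lambda>\<omega>. (B s \<omega> \<bullet> y)\<^sup>2)"
    using L m by (subst integrable_cong_AE[where g = "\<lambda>\<omega>. (incr 0 s y \<omega>)\<^sup>2"]) (auto simp: L2_def)
  with m show ?thesis by (simp add: L2_def)
qed

text \<open>At a fixed time the approximation is the value at the left end of a cell, so the error is an increment
over at most the mesh \<open>t / 2 ^ k\<close>. Tonelli's theorem integrates this over time.\<close>

lemma dyadic_process_error:
  assumes t: "0 \<le> t"
  shows "(\<integral>\<^sup>+\<omega>. (\<integral>\<^sup>+s\<in>{0..t}. ennreal (((limit_path t s \<omega> - dyadic_process t k s \<omega>) \<bullet> y)\<^sup>2) \<partial>lborel) \<partial>M)
    \<le> ennreal (t\<^sup>2 * (C y \<bullet> y) / 2 ^ k)"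
proof -
  interpret PS: pair_sigma_finite lborel M by unfold_locales
  note [measurable] = dyadic_process_measurable[OF t] limit_path_measurable[OF t]
  have "(\<integral>\<^sup>+\<omega>. (\<integral>\<^sup>+s\<in>{0..t}. ennreal (((limit_path t s \<omega> - dyadic_process t k s \<omega>) \<bullet> y)\<^sup>2) \<partial>lborel) \<partial>M)
    = (\<integral>\<^sup>+s. \<integral>\<^sup>+\<omega>. ennreal (((limit_path t s \<omega> - dyadic_process t k s \<omega>) \<bullet> y)\<^sup>2) * indicator {0..t} s \<partial>M \<partial>lborel)"
    by (rule PS.Fubini') measurable
  also have "\<dots> \<le> (\<integral>\<^sup>+s. ennreal (t * (C y \<bullet> y) / 2 ^ k) * indicator {0..t} s \<partial>lborel)"
  proof (rule nn_integral_mono)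
    fix s
    show "(\<integral>\<^sup>+\<omega>. ennreal (((limit_path t s \<omega> - dyadic_process t k s \<omega>) \<bullet> y)\<^sup>2) * indicator {0..t} s \<partial>M)
      \<le> ennreal (t * (C y \<bullet> y) / 2 ^ k) * indicator {0..t} s"
    proof (cases "s \<in> {0..t}")
      case True
      have "(\<integral>\<^sup>+\<omega>. ennreal (((limit_path t s \<omega> - dyadic_process t k s \<omega>) \<bullet> y)\<^sup>2) \<partial>M)
        \<le> ennreal (t * (C y \<bullet> y) / 2 ^ k)"
      proof (cases "s = 0")
        case True
        then have "dyadic_process t k s \<omega> = 0" "limit_path t s \<omega> = 0" for k \<omega>
          using dyadic_process_outside[OF t, of s] by (auto simp: limit_path_def)
        then show ?thesis by simp
      next
        case False
        with True have s: "0 < s" "s \<le> t" by auto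
        obtain l where l: "l < 2 ^ k" "grid t k l < s" "s \<le> grid t k (Suc l)" using grid_cell[OF s] .
        have g: "0 \<le> grid t k l" "grid t k l \<le> s" using grid_nonneg[OF t] l by auto
        have "(\<integral>\<^sup>+\<omega>. ennreal (((limit_path t s \<omega> - dyadic_process t k s \<omega>) \<bullet> y)\<^sup>2) \<partial>M)
          = (\<integral>\<^sup>+\<omega>. ennreal ((incr (grid t k l) s y \<omega>)\<^sup>2) \<partial>M)"
        proof (rule nn_integral_cong_AE)
          show "AE \<omega> in M. ennreal (((limit_path t s \<omega> - dyadic_process t k s \<omega>) \<bullet> y)\<^sup>2) = ennreal ((incr (grid t k l) s y \<omega>)\<^sup>2)"
            using B_AE_eq_limit_path[OF True] by eventually_elim (simp add: dyadic_process_cell[OF t l] incr_def)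
        qed
        also have "\<dots> = ennreal (expectation (\<lambda>\<omega>. (incr (grid t k l) s y \<omega>)\<^sup>2))"
          using L4_L2[OF incr_L4[OF g, of y]] by (intro nn_integral_eq_integral) (auto simp: L2_def)
        also have "\<dots> = ennreal ((s - grid t k l) * (C y \<bullet> y))" by (simp add: incr_square[OF g])
        also have "\<dots> \<le> ennreal (t / 2 ^ k * (C y \<bullet> y))"
          using l grid_Suc_diff[of t k l] C_nonneg by (intro ennreal_leI mult_right_mono) auto
        finally show ?thesis by simp
      qed
      with True show ?thesis by simp
    qed simp
  qed
  also have "\<dots> = ennreal (t * (C y \<bullet> y) / 2 ^ k) * ennreal t"
    using t by (simp add: nn_integral_cmult_indicator)
  also have "\<dots> = ennreal (t\<^sup>2 * (C y \<bullet> y) / 2 ^ k)"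
    using t C_nonneg by (simp add: ennreal_mult[symmetric] power2_eq_square mult_ac)
  finally show ?thesis .
qed

text \<open>A single unit vector is an orthonormal set.\<close>

lemma hs_norm_sq_ge:
  fixes T :: "'b::real_inner \<Rightarrow>\<^sub>L 'c::real_inner"
  shows "ennreal ((norm (T x))\<^sup>2) \<le> ennreal ((norm x)\<^sup>2) * hs_norm_sq T"
proof (cases "x = 0")
  case False
  define z where "z = x /\<^sub>R norm x"
  have z: "norm z = 1" "x = norm x *\<^sub>R z" using False by (auto simp: z_def)
  have "(\<Sum>v\<in>{z}. ennreal ((norm (T v))\<^sup>2)) \<le> hs_norm_sq T"
    unfolding hs_norm_sq_def
    by (rule SUP_upper) (use z in \<open>auto simp: orthonormal_family_def norm_eq_1\<close>)
  then have "ennreal ((norm x)\<^sup>2) * ennreal ((norm (T z))\<^sup>2) \<le> ennreal ((norm x)\<^sup>2) * hs_norm_sq T"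
    by (intro mult_left_mono) auto
  moreover have "norm (T x) = norm x * norm (T z)" by (subst z(2)) (simp add: blinfun.scaleR_right)
  ultimately show ?thesis by (simp add: ennreal_mult[symmetric] power_mult_distrib)
qed simp


lemma elementary_integrand_L2:
  assumes X: "elementary_integrand M B t n \<tau> X" and k: "k < n"
  shows "0 \<le> \<tau> k" "\<tau> k \<le> \<tau> (Suc k)" "\<tau> (Suc k) \<le> t"
    "(\<lambda>\<omega>. X k \<omega> \<bullet> y) \<in> borel_measurable (past M B (\<tau> k))" "L2 (\<lambda>\<omega>. X k \<omega> \<bullet> y)" "X k \<in> borel_measurable M"
proof -
  have X': "\<tau> 0 = 0" "\<tau> n = t" "\<And>k. k < n \<Longrightarrow> \<tau> k \<le> \<tau> (Suc k)"
    "X k \<in> borel_measurable (past M B (\<tau> k))" "(\<integral>\<^sup>+\<omega>. ennreal ((norm (X k \<omega>))\<^sup>2) \<partial>M) < \<infinity>"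
    using X k by (auto simp: elementary_integrand_def)
  have mono: "\<tau> i \<le> \<tau> j" if "i \<le> j" "j \<le> n" for i j
    using that
  proof (induction rule: dec_induct)
    case (step m)
    then show ?case using X'(3)[of m] by auto
  qed simp
  show "0 \<le> \<tau> k" "\<tau> k \<le> \<tau> (Suc k)" "\<tau> (Suc k) \<le> t"
    using mono[of 0 k] mono[of k "Suc k"] mono[of "Suc k" n] k X'(1,2) by auto
  show "(\<lambda>\<omega>. X k \<omega> \<bullet> y) \<in> borel_measurable (past M B (\<tau> k))" using X'(4) by simp
  show XM: "X k \<in> borel_measurable M" by (rule measurable_past_M[OF X'(4)])
  have "integrable M (\<lambda>\<omega>. (norm (X k \<omega>))\<^sup>2 * (norm y)\<^sup>2)"
    using X'(5) XM by (intro integrable_mult_left) (auto simp: integrable_iff_bounded)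
  then have "integrable M (\<lambda>\<omega>. (X k \<omega> \<bullet> y)\<^sup>2)"
  proof (rule Bochner_Integration.integrable_bound)
    show "AE \<omega> in M. norm ((X k \<omega> \<bullet> y)\<^sup>2) \<le> norm ((norm (X k \<omega>))\<^sup>2 * (norm y)\<^sup>2)"
      by (auto simp: power_mult_distrib[symmetric] abs_le_square_iff[symmetric] Cauchy_Schwarz_ineq2)
  qed (use XM in measurable)
  then show "L2 (\<lambda>\<omega>. X k \<omega> \<bullet> y)" using XM by (simp add: L2_def)
qed

lemma elementary_process_outside:
  assumes X: "elementary_integrand M B t n \<tau> X" and s: "s \<notin> {0<..t}"
  shows "elementary_process n \<tau> X s \<omega> = 0"
  unfolding elementary_process_def
  using s elementary_integrand_L2(1-3)[OF X] by (intro sum.neutral ballI) (force simp: indicator_def)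

text \<open>The intervals of both partitions form one family, with a minus sign on the dyadic integrand.\<close>

lemma ito_isometry_difference:
  assumes t: "0 \<le> t" and X: "elementary_integrand M B t n \<tau> X"
  shows "L2 (\<lambda>\<omega>. (elementary_integral B n \<tau> X \<omega> x - dyadic_integral t k \<omega> x) \<bullet> y)"
   "(\<integral>\<^sup>+\<omega>. ennreal (((elementary_integral B n \<tau> X \<omega> x - dyadic_integral t k \<omega> x) \<bullet> y)\<^sup>2) \<partial>M) =
     ennreal (C x \<bullet> x) *
     (\<integral>\<^sup>+\<omega>. \<integral>\<^sup>+s. ennreal (((elementary_process n \<tau> X s \<omega> - dyadic_process t k s \<omega>) \<bullet> y)\<^sup>2) \<partial>lborel \<partial>M)"
proof -
  \<comment> \<open>The disjoint sum of the two index sets.\<close>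
  define K where "K = {..<n} <+> {..<(2::nat) ^ k}"
  define p where "p = case_sum \<tau> (grid t k)"
  define q where "q = case_sum (\<lambda>i. \<tau> (Suc i)) (\<lambda>l. grid t k (Suc l))"
  define a where "a = case_sum (\<lambda>i \<omega>. X i \<omega> \<bullet> y) (\<lambda>l \<omega>. (-1) * (B (grid t k l) \<omega> \<bullet> y))"
  note Xp = elementary_integrand_L2[OF X]
  have g: "0 \<le> grid t k l" "grid t k l \<le> grid t k (Suc l)" for l
    using grid_nonneg[OF t] grid_mono[OF t, of l "Suc l"] by auto
  have fin: "finite K" by (simp add: K_def)
  have pq: "0 \<le> p i \<and> p i \<le> q i" if "i \<in> K" for i
    using that Xp g by (auto simp: K_def p_def q_def)
  have am: "a i \<in> borel_measurable (past M B (p i))" if "i \<in> K" for i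
    using that Xp(4)[of _ y] B_measurable_past[OF g(1) order_refl]
    by (auto simp: K_def p_def a_def)
  have aL: "L2 (a i)" if "i \<in> K" for i
    using that Xp(5)[of _ y] L2_cmult[OF B_L2[OF g(1), of _ y], of "-1"]
    by (auto simp: K_def a_def)
  note iso = ito_isometry[of K p q a x, OF fin pq am aL]
  have J: "(\<Sum>i\<in>K. a i \<omega> * incr (p i) (q i) x \<omega>) =
    (elementary_integral B n \<tau> X \<omega> x - dyadic_integral t k \<omega> x) \<bullet> y" for \<omega>
    by (simp add: K_def a_def p_def q_def sum.Plus elementary_integral_entry dyadic_integral_def
        inner_diff_left sum_negf)
  have P: "(\<Sum>i\<in>K. indicator {p i<..q i} s * a i \<omega>) =
    (elementary_process n \<tau> X s \<omega> - dyadic_process t k s \<omega>) \<bullet> y" for s \<omega>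
    unfolding K_def inner_diff_left elementary_process_entry dyadic_process_def
    by (subst sum.Plus) (simp_all only: finite_lessThan a_def p_def q_def sum.case mult_minus1
        comp_def mult_minus_right sum_negf diff_conv_add_uminus)
  show L: "L2 (\<lambda>\<omega>. (elementary_integral B n \<tau> X \<omega> x - dyadic_integral t k \<omega> x) \<bullet> y)"
    using iso(1) unfolding J .
  show "(\<integral>\<^sup>+\<omega>. ennreal (((elementary_integral B n \<tau> X \<omega> x - dyadic_integral t k \<omega> x) \<bullet> y)\<^sup>2) \<partial>M) =
     ennreal (C x \<bullet> x) *
     (\<integral>\<^sup>+\<omega>. \<integral>\<^sup>+s. ennreal (((elementary_process n \<tau> X s \<omega> - dyadic_process t k s \<omega>) \<bullet> y)\<^sup>2) \<partial>lborel \<partial>M)"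
    using iso(2) L unfolding J P by (subst nn_integral_eq_integral) (auto simp: L2_def)
qed

lemma square_sum_le: "(a + b)\<^sup>2 \<le> 2 * a\<^sup>2 + 2 * b\<^sup>2" for a b :: real
  using sum_squares_bound[of a b] by (simp add: power2_sum)

text \<open>The isometry, with the Brownian motion inserted between the two integrands.\<close>

lemma elementary_integral_error:
  assumes t: "0 \<le> t" and X: "elementary_integrand M B t n \<tau> X"
  defines "F \<equiv> \<integral>\<^sup>+\<omega>. (\<integral>\<^sup>+s\<in>{0..t}. ennreal ((norm (B s \<omega> - elementary_process n \<tau> X s \<omega>))\<^sup>2) \<partial>lborel) \<partial>M"
  shows "(\<integral>\<^sup>+\<omega>. ennreal (((elementary_integral B n \<tau> X \<omega> x - dyadic_integral t k \<omega> x) \<bullet> y)\<^sup>2) \<partial>M)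
    \<le> ennreal (C x \<bullet> x) * (ennreal (2 * (norm y)\<^sup>2) * F + ennreal (2 * (t\<^sup>2 * (C y \<bullet> y) / 2 ^ k)))"
proof -
  interpret PS: pair_sigma_finite lborel M by unfold_locales
  note [measurable] = dyadic_process_measurable[OF t] limit_path_measurable[OF t]
  have [measurable]: "(\<lambda>(s, \<omega>). elementary_process n \<tau> X s \<omega>) \<in> borel_measurable (lborel \<Otimes>\<^sub>M M)"
    unfolding elementary_process_def split_beta
  proof (intro borel_measurable_sum borel_measurable_scaleR)
    fix i assume "i \<in> {..<n}"
    then have [measurable]: "X i \<in> borel_measurable M" using elementary_integrand_L2(6)[OF X] by simp
    show "(\<lambda>p. X i (snd p)) \<in> borel_measurable (lborel \<Otimes>\<^sub>M M)" by measurable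
    show "(\<lambda>p. indicator {\<tau> i<..\<tau> (Suc i)} (fst p) :: real) \<in> borel_measurable (lborel \<Otimes>\<^sub>M M)" by measurable
  qed
  let ?E = "elementary_process n \<tau> X" and ?D = "dyadic_process t k"
  let ?f = "\<lambda>s \<omega>. ennreal ((norm (limit_path t s \<omega> - ?E s \<omega>))\<^sup>2) * indicator {0..t} s"
  let ?g = "\<lambda>s \<omega>. ennreal (((limit_path t s \<omega> - ?D s \<omega>) \<bullet> y)\<^sup>2) * indicator {0..t} s"
  have F: "F = (\<integral>\<^sup>+\<omega>. \<integral>\<^sup>+s. ?f s \<omega> \<partial>lborel \<partial>M)"
    unfolding F_def
  proof (rule nn_integral_cong_AE)
    show "AE \<omega> in M. (\<integral>\<^sup>+s\<in>{0..t}. ennreal ((norm (B s \<omega> - ?E s \<omega>))\<^sup>2) \<partial>lborel) = (\<integral>\<^sup>+s. ?f s \<omega> \<partial>lborel)"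
      using limit_path_eq[of t]
    proof eventually_elim
      fix \<omega> assume "\<forall>s\<in>{0..t}. limit_path t s \<omega> = B s \<omega>"
      then show "(\<integral>\<^sup>+s\<in>{0..t}. ennreal ((norm (B s \<omega> - ?E s \<omega>))\<^sup>2) \<partial>lborel) = (\<integral>\<^sup>+s. ?f s \<omega> \<partial>lborel)"
        by (intro nn_integral_cong) (auto simp: indicator_def)
    qed
  qed
  have pt: "ennreal (((?E s \<omega> - ?D s \<omega>) \<bullet> y)\<^sup>2) \<le> ennreal (2 * (norm y)\<^sup>2) * ?f s \<omega> + 2 * ?g s \<omega>" for s \<omega>
  proof (cases "s \<in> {0<..t}")
    case True
    have "((?E s \<omega> - ?D s \<omega>) \<bullet> y)\<^sup>2 = ((limit_path t s \<omega> - ?D s \<omega>) \<bullet> y + - ((limit_path t s \<omega> - ?E s \<omega>) \<bullet> y))\<^sup>2"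
      by (simp add: inner_diff_left)
    also have "\<dots> \<le> 2 * ((limit_path t s \<omega> - ?D s \<omega>) \<bullet> y)\<^sup>2 + 2 * ((limit_path t s \<omega> - ?E s \<omega>) \<bullet> y)\<^sup>2"
      using square_sum_le[of "(limit_path t s \<omega> - ?D s \<omega>) \<bullet> y" "- ((limit_path t s \<omega> - ?E s \<omega>) \<bullet> y)"] by simp
    also have "((limit_path t s \<omega> - ?E s \<omega>) \<bullet> y)\<^sup>2 \<le> (norm (limit_path t s \<omega> - ?E s \<omega>) * norm y)\<^sup>2"
      using Cauchy_Schwarz_ineq2[of "limit_path t s \<omega> - ?E s \<omega>" y] by (simp add: abs_le_square_iff[symmetric])
    finally have "((?E s \<omega> - ?D s \<omega>) \<bullet> y)\<^sup>2 \<le> 2 * (norm y)\<^sup>2 * (norm (limit_path t s \<omega> - ?E s \<omega>))\<^sup>2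
        + 2 * ((limit_path t s \<omega> - ?D s \<omega>) \<bullet> y)\<^sup>2"
      by (simp add: power_mult_distrib mult_ac)
    then have "ennreal (((?E s \<omega> - ?D s \<omega>) \<bullet> y)\<^sup>2) \<le> ennreal (2 * (norm y)\<^sup>2 * (norm (limit_path t s \<omega> - ?E s \<omega>))\<^sup>2
        + 2 * ((limit_path t s \<omega> - ?D s \<omega>) \<bullet> y)\<^sup>2)" by (rule ennreal_leI)
    with True show ?thesis by (simp add: ennreal_mult ennreal_plus)
  next
    case False
    then show ?thesis
      by (simp add: elementary_process_outside[OF X False] dyadic_process_outside[OF t False])
  qed
  have "(\<integral>\<^sup>+\<omega>. \<integral>\<^sup>+s. ennreal (((?E s \<omega> - ?D s \<omega>) \<bullet> y)\<^sup>2) \<partial>lborel \<partial>M)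
    \<le> (\<integral>\<^sup>+\<omega>. \<integral>\<^sup>+s. (ennreal (2 * (norm y)\<^sup>2) * ?f s \<omega> + 2 * ?g s \<omega>) \<partial>lborel \<partial>M)"
    by (intro nn_integral_mono pt)
  also have "\<dots> = (\<integral>\<^sup>+\<omega>. ennreal (2 * (norm y)\<^sup>2) * (\<integral>\<^sup>+s. ?f s \<omega> \<partial>lborel) + 2 * (\<integral>\<^sup>+s. ?g s \<omega> \<partial>lborel) \<partial>M)"
  proof (rule nn_integral_cong)
    fix \<omega> assume [measurable]: "\<omega> \<in> space M"
    show "(\<integral>\<^sup>+s. (ennreal (2 * (norm y)\<^sup>2) * ?f s \<omega> + 2 * ?g s \<omega>) \<partial>lborel) =
      ennreal (2 * (norm y)\<^sup>2) * (\<integral>\<^sup>+s. ?f s \<omega> \<partial>lborel) + 2 * (\<integral>\<^sup>+s. ?g s \<omega> \<partial>lborel)"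
    proof (subst nn_integral_add)
      show "(\<lambda>s. ennreal (2 * (norm y)\<^sup>2) * ?f s \<omega>) \<in> borel_measurable lborel"
        "(\<lambda>s. 2 * ?g s \<omega>) \<in> borel_measurable lborel" by measurable
      have "(\<lambda>s. ?f s \<omega>) \<in> borel_measurable lborel" "(\<lambda>s. ?g s \<omega>) \<in> borel_measurable lborel"
        by measurable
      then show "(\<integral>\<^sup>+s. ennreal (2 * (norm y)\<^sup>2) * ?f s \<omega> \<partial>lborel) + (\<integral>\<^sup>+s. 2 * ?g s \<omega> \<partial>lborel) =
        ennreal (2 * (norm y)\<^sup>2) * (\<integral>\<^sup>+s. ?f s \<omega> \<partial>lborel) + 2 * (\<integral>\<^sup>+s. ?g s \<omega> \<partial>lborel)"
        by (simp only: nn_integral_cmult)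
    qed
  qed
  also have "\<dots> = ennreal (2 * (norm y)\<^sup>2) * F + 2 * (\<integral>\<^sup>+\<omega>. \<integral>\<^sup>+s. ?g s \<omega> \<partial>lborel \<partial>M)"
  proof -
    have "(\<lambda>\<omega>. \<integral>\<^sup>+s. ?f s \<omega> \<partial>lborel) \<in> borel_measurable M" "(\<lambda>\<omega>. \<integral>\<^sup>+s. ?g s \<omega> \<partial>lborel) \<in> borel_measurable M"
      by measurable
    then show ?thesis unfolding F by (simp add: nn_integral_add nn_integral_cmult)
  qed
  also have "\<dots> \<le> ennreal (2 * (norm y)\<^sup>2) * F + 2 * ennreal (t\<^sup>2 * (C y \<bullet> y) / 2 ^ k)"
    by (intro add_left_mono mult_left_mono dyadic_process_error[OF t]) auto
  also have "\<dots> = ennreal (2 * (norm y)\<^sup>2) * F + ennreal (2 * (t\<^sup>2 * (C y \<bullet> y) / 2 ^ k))"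
    using C_nonneg[of y] by (simp add: ennreal_mult[symmetric] flip: ennreal_numeral)
  finally show ?thesis
    unfolding ito_isometry_difference(2)[OF t X] by (rule mult_left_mono) simp
qed

text \<open>By the isometry, the distance of an approximating elementary integral to the dyadic one is the mean
square distance of the integrands. As the approximation improves, this tends to the distance of the
Brownian motion to its dyadic approximation. Only entries of the operators occur, which keeps all
integrands measurable; the Hilbert--Schmidt norm in the definition of the integral enters through a
pointwise lower bound.\<close>

lemma ito_dyadic_error:
  assumes t: "0 \<le> t" and I: "ito_tensor_integral M B t B I"
  shows "(\<integral>\<^sup>+\<omega>. ennreal (((I \<omega> x - dyadic_integral t k \<omega> x) \<bullet> y)\<^sup>2) \<partial>M)
    \<le> ennreal (4 * t\<^sup>2 * (C x \<bullet> x) * (C y \<bullet> y) / 2 ^ k)"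
proof -
  obtain n \<tau> X where X: "\<And>m. elementary_integrand M B t (n m) (\<tau> m) (X m)"
    and F: "(\<lambda>m. \<integral>\<^sup>+\<omega>. (\<integral>\<^sup>+s\<in>{0..t}. ennreal ((norm (B s \<omega> - elementary_process (n m) (\<tau> m) (X m) s \<omega>))\<^sup>2) \<partial>lborel) \<partial>M)
          \<longlonglongrightarrow> 0" (is "?F \<longlonglongrightarrow> 0")
    and H: "(\<lambda>m. \<integral>\<^sup>+\<omega>. hs_norm_sq (I \<omega> - elementary_integral B (n m) (\<tau> m) (X m) \<omega>) \<partial>M) \<longlonglongrightarrow> 0" (is "?H \<longlonglongrightarrow> 0")
    and Im: "\<And>x. (\<lambda>\<omega>. I \<omega> x) \<in> borel_measurable M"
    using I unfolding ito_tensor_integral_def by blast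
  let ?J = "\<lambda>m. elementary_integral B (n m) (\<tau> m) (X m)" and ?D = "dyadic_integral t k"
  define c1 where "c1 = ennreal (2 * (norm x * norm y)\<^sup>2)"
  define c2 where "c2 = ennreal (2 * (C x \<bullet> x))"
  define c3 where "c3 = ennreal (2 * (norm y)\<^sup>2)"
  define c4 where "c4 = ennreal (2 * (t\<^sup>2 * (C y \<bullet> y) / 2 ^ k))"
  have Jm: "(\<lambda>\<omega>. (?J m \<omega> x - ?D \<omega> x) \<bullet> y) \<in> borel_measurable M" for m
    using ito_isometry_difference(1)[OF t X] by (simp add: L2_def)
  have Dm: "(\<lambda>\<omega>. ?D \<omega> x \<bullet> y) \<in> borel_measurable M"
  proof -
    have [measurable]: "B (grid t k l) \<in> borel_measurable M" for l
      by (rule B_measurable) (rule grid_nonneg[OF t])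
    show ?thesis unfolding dyadic_integral_def elementary_integral_entry incr_def by measurable
  qed
  have Iym: "(\<lambda>\<omega>. I \<omega> x \<bullet> y) \<in> borel_measurable M" using Im by simp
  have IJm: "(\<lambda>\<omega>. (I \<omega> x - ?J m \<omega> x) \<bullet> y) \<in> borel_measurable M" for m
    using borel_measurable_diff[OF Iym borel_measurable_add[OF Jm[of m] Dm]] by (simp add: inner_diff_left)
  have le: "(\<integral>\<^sup>+\<omega>. ennreal (((I \<omega> x - ?D \<omega> x) \<bullet> y)\<^sup>2) \<partial>M) \<le> c1 * ?H m + c2 * (c3 * ?F m + c4)" for m
  proof -
    have pt: "ennreal (((I \<omega> x - ?D \<omega> x) \<bullet> y)\<^sup>2) \<le> 2 * ennreal (((I \<omega> x - ?J m \<omega> x) \<bullet> y)\<^sup>2)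
        + 2 * ennreal (((?J m \<omega> x - ?D \<omega> x) \<bullet> y)\<^sup>2)" for \<omega>
    proof -
      have "((I \<omega> x - ?D \<omega> x) \<bullet> y)\<^sup>2 = ((I \<omega> x - ?J m \<omega> x) \<bullet> y + (?J m \<omega> x - ?D \<omega> x) \<bullet> y)\<^sup>2"
        by (simp add: inner_diff_left)
      also have "\<dots> \<le> 2 * ((I \<omega> x - ?J m \<omega> x) \<bullet> y)\<^sup>2 + 2 * ((?J m \<omega> x - ?D \<omega> x) \<bullet> y)\<^sup>2"
        by (rule square_sum_le)
      finally show ?thesis
        by (simp add: ennreal_mult[symmetric] ennreal_plus[symmetric] del: ennreal_plus flip: ennreal_numeral)
    qed
    have "(\<integral>\<^sup>+\<omega>. ennreal (((I \<omega> x - ?D \<omega> x) \<bullet> y)\<^sup>2) \<partial>M) \<le>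
      (\<integral>\<^sup>+\<omega>. 2 * ennreal (((I \<omega> x - ?J m \<omega> x) \<bullet> y)\<^sup>2) + 2 * ennreal (((?J m \<omega> x - ?D \<omega> x) \<bullet> y)\<^sup>2) \<partial>M)"
      by (rule nn_integral_mono) (rule pt)
    also have "\<dots> = 2 * (\<integral>\<^sup>+\<omega>. ennreal (((I \<omega> x - ?J m \<omega> x) \<bullet> y)\<^sup>2) \<partial>M)
      + 2 * (\<integral>\<^sup>+\<omega>. ennreal (((?J m \<omega> x - ?D \<omega> x) \<bullet> y)\<^sup>2) \<partial>M)"
      using IJm[of m] Jm[of m] by (simp add: nn_integral_add nn_integral_cmult)
    also have "\<dots> \<le> 2 * (ennreal ((norm x * norm y)\<^sup>2) * ?H m) + 2 * (ennreal (C x \<bullet> x) * (c3 * ?F m + c4))"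
    proof (intro add_mono mult_left_mono)
      show "(\<integral>\<^sup>+\<omega>. ennreal (((I \<omega> x - ?J m \<omega> x) \<bullet> y)\<^sup>2) \<partial>M) \<le> ennreal ((norm x * norm y)\<^sup>2) * ?H m"
      proof -
        have pt: "ennreal (((I \<omega> x - ?J m \<omega> x) \<bullet> y)\<^sup>2) \<le> ennreal ((norm y)\<^sup>2) * (ennreal ((norm x)\<^sup>2) * hs_norm_sq (I \<omega> - ?J m \<omega>))" for \<omega>
        proof -
          have "((I \<omega> x - ?J m \<omega> x) \<bullet> y)\<^sup>2 \<le> (norm ((I \<omega> - ?J m \<omega>) x) * norm y)\<^sup>2"
            using Cauchy_Schwarz_ineq2[of "(I \<omega> - ?J m \<omega>) x" y]
            by (simp add: abs_le_square_iff[symmetric] blinfun.diff_left)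
          then have "ennreal (((I \<omega> x - ?J m \<omega> x) \<bullet> y)\<^sup>2) \<le> ennreal ((norm y)\<^sup>2) * ennreal ((norm ((I \<omega> - ?J m \<omega>) x))\<^sup>2)"
            by (simp add: ennreal_mult[symmetric] power_mult_distrib mult.commute)
          also have "\<dots> \<le> ennreal ((norm y)\<^sup>2) * (ennreal ((norm x)\<^sup>2) * hs_norm_sq (I \<omega> - ?J m \<omega>))"
            by (intro mult_left_mono hs_norm_sq_ge) simp
          finally show ?thesis .
        qed
        show ?thesis
        proof (cases "norm x * norm y = 0")
          case True
          then have "((I \<omega> x - ?J m \<omega> x) \<bullet> y) = 0" for \<omega> by (auto simp: blinfun.zero_right)
          then show ?thesis by simp
        next
          case False
          define r where "r = (norm x * norm y)\<^sup>2"
          have r: "0 < r" using False by (simp add: r_def)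
          have "(\<integral>\<^sup>+\<omega>. ennreal (1 / r) * ennreal (((I \<omega> x - ?J m \<omega> x) \<bullet> y)\<^sup>2) \<partial>M) \<le> ?H m"
          proof (rule nn_integral_mono)
            fix \<omega>
            have "ennreal (1 / r) * ennreal (((I \<omega> x - ?J m \<omega> x) \<bullet> y)\<^sup>2) \<le> ennreal (1 / r) *
              (ennreal ((norm y)\<^sup>2) * (ennreal ((norm x)\<^sup>2) * hs_norm_sq (I \<omega> - ?J m \<omega>)))"
              by (intro mult_left_mono pt) simp
            also have "\<dots> = ennreal (1 / r * ((norm y)\<^sup>2 * (norm x)\<^sup>2)) * hs_norm_sq (I \<omega> - ?J m \<omega>)"
            proof -
              have "ennreal (1 / r * ((norm y)\<^sup>2 * (norm x)\<^sup>2)) =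
                ennreal (1 / r) * (ennreal ((norm y)\<^sup>2) * ennreal ((norm x)\<^sup>2))"
                using r by (subst ennreal_mult, simp, simp, subst ennreal_mult) auto
              then show ?thesis by (simp only: mult.assoc)
            qed
            also have "1 / r * ((norm y)\<^sup>2 * (norm x)\<^sup>2) = 1"
            proof -
              have "(norm y)\<^sup>2 * (norm x)\<^sup>2 = r" by (simp add: r_def power_mult_distrib mult.commute)
              then show ?thesis using r by simp
            qed
            finally show "ennreal (1 / r) * ennreal (((I \<omega> x - ?J m \<omega> x) \<bullet> y)\<^sup>2) \<le> hs_norm_sq (I \<omega> - ?J m \<omega>)"
              by simp
          qed
          then have "ennreal (1 / r) * (\<integral>\<^sup>+\<omega>. ennreal (((I \<omega> x - ?J m \<omega> x) \<bullet> y)\<^sup>2) \<partial>M) \<le> ?H m"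
            using IJm[of m] by (simp add: nn_integral_cmult)
          then have "ennreal r * (ennreal (1 / r) * (\<integral>\<^sup>+\<omega>. ennreal (((I \<omega> x - ?J m \<omega> x) \<bullet> y)\<^sup>2) \<partial>M)) \<le> ennreal r * ?H m"
            by (intro mult_left_mono) auto
          then show ?thesis using r by (simp add: mult.assoc[symmetric] ennreal_mult[symmetric] flip: r_def)
        qed
      qed
      show "(\<integral>\<^sup>+\<omega>. ennreal (((?J m \<omega> x - ?D \<omega> x) \<bullet> y)\<^sup>2) \<partial>M) \<le> ennreal (C x \<bullet> x) * (c3 * ?F m + c4)"
        unfolding c3_def c4_def by (rule elementary_integral_error[OF t X])
    qed auto
    also have "\<dots> = c1 * ?H m + c2 * (c3 * ?F m + c4)"
      unfolding c1_def c2_def using C_nonneg[of x] by (simp add: ennreal_mult mult.assoc)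
    finally show ?thesis .
  qed
  have "(\<lambda>m. c1 * ?H m + c2 * (c3 * ?F m + c4)) \<longlonglongrightarrow> c1 * 0 + c2 * (c3 * 0 + c4)"
    by (intro tendsto_add ennreal_tendsto_cmult H F tendsto_const) (simp_all add: c1_def c2_def c3_def)
  then have "(\<integral>\<^sup>+\<omega>. ennreal (((I \<omega> x - ?D \<omega> x) \<bullet> y)\<^sup>2) \<partial>M) \<le> c1 * 0 + c2 * (c3 * 0 + c4)"
    by (rule tendsto_lowerbound) (use le in auto)
  also have "\<dots> = ennreal (4 * t\<^sup>2 * (C x \<bullet> x) * (C y \<bullet> y) / 2 ^ k)"
    unfolding c2_def c4_def using C_nonneg[of x] C_nonneg[of y]
    by (simp add: ennreal_mult[symmetric] mult_ac)
  finally show ?thesis .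
qed

end

section \<open>Fourth moments of sums of tensor products of increments\<close>

context hilbert_brownian_motion
begin

lemma past_triple:
  fixes f :: "'w \<Rightarrow> real" and \<phi> \<psi> :: "'a \<Rightarrow> real"
  assumes s: "0 \<le> s" "s \<le> s'" "s' \<le> s''" and f: "f \<in> borel_measurable (past M B s)" "integrable M f"
    and \<phi>: "\<phi> \<in> borel_measurable borel" "integrable M (\<lambda>\<omega>. \<phi> (B s' \<omega> - B s \<omega>))"
    and \<psi>: "\<psi> \<in> borel_measurable borel" "integrable M (\<lambda>\<omega>. \<psi> (B s'' \<omega> - B s' \<omega>))"
  shows "integrable M (\<lambda>\<omega>. f \<omega> * \<phi> (B s' \<omega> - B s \<omega>) * \<psi> (B s'' \<omega> - B s' \<omega>))"
    "expectation (\<lambda>\<omega>. f \<omega> * \<phi> (B s' \<omega> - B s \<omega>) * \<psi> (B s'' \<omega> - B s' \<omega>)) =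
      expectation f * expectation (\<lambda>\<omega>. \<phi> (B s' \<omega> - B s \<omega>)) * expectation (\<lambda>\<omega>. \<psi> (B s'' \<omega> - B s' \<omega>))"
proof -
  note 1 = past_expectation_mult[OF s(1,2) f \<phi>]
  have s': "0 \<le> s'" using s by simp
  have m: "(\<lambda>\<omega>. f \<omega> * \<phi> (B s' \<omega> - B s \<omega>)) \<in> borel_measurable (past M B s')"
    using measurable_past_mono[OF s(2) f(1)] B_measurable_past[OF s(1,2)] B_measurable_past[OF s' order_refl]
    by (intro borel_measurable_times measurable_compose[OF _ \<phi>(1)] borel_measurable_diff)
  note 2 = past_expectation_mult[OF s' s(3) m 1(1) \<psi>]
  show "integrable M (\<lambda>\<omega>. f \<omega> * \<phi> (B s' \<omega> - B s \<omega>) * \<psi> (B s'' \<omega> - B s' \<omega>))"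
    "expectation (\<lambda>\<omega>. f \<omega> * \<phi> (B s' \<omega> - B s \<omega>) * \<psi> (B s'' \<omega> - B s' \<omega>)) =
      expectation f * expectation (\<lambda>\<omega>. \<phi> (B s' \<omega> - B s \<omega>)) * expectation (\<lambda>\<omega>. \<psi> (B s'' \<omega> - B s' \<omega>))"
    using 2 1(2) by simp_all
qed

text \<open>
A grid \<open>T\<close> of mesh \<open>h\<close> and a finite set \<open>J\<close> of eigenvectors. The left and right increments in the \<open>l\<close>-th
pair of cells are the vectors \<open>X l\<close> and \<open>Y l\<close> of the introduction, and \<open>tensor_sum l i j\<close> is the entry of
the sum of the first \<open>l\<close> products \<open>X m \<otimes> Y m\<close>.\<close>

context
  fixes T :: "nat \<Rightarrow> real" and h :: real and J :: "nat set" and e :: "nat \<Rightarrow> 'a" and c :: "nat \<Rightarrow> real"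
  assumes T: "\<And>j. 0 \<le> T j" "\<And>j. T (Suc j) = T j + h" and h: "0 \<le> h"
    and J: "finite J" "orthonormal_family J e"
    and c: "\<And>i. i \<in> J \<Longrightarrow> C (e i) = c i *\<^sub>R e i" "\<And>i. i \<in> J \<Longrightarrow> 0 < c i"
begin

definition left_incr :: "nat \<Rightarrow> nat \<Rightarrow> 'w \<Rightarrow> real" where
  "left_incr l i = incr (T (2 * l)) (T (Suc (2 * l))) (e i)"

definition right_incr :: "nat \<Rightarrow> nat \<Rightarrow> 'w \<Rightarrow> real" where
  "right_incr l j = incr (T (Suc (2 * l))) (T (Suc (Suc (2 * l)))) (e j)"

definition tensor_sum :: "nat \<Rightarrow> nat \<Rightarrow> nat \<Rightarrow> 'w \<Rightarrow> real" where
  "tensor_sum l i j \<omega> = (\<Sum>m<l. left_incr m i \<omega> * right_incr m j \<omega>)"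

lemma T_le: "T j \<le> T (Suc j)" using T h by simp

lemma T_mono: "i \<le> j \<Longrightarrow> T i \<le> T j"
  by (rule lift_Suc_mono_le[of T]) (rule T_le)

lemma
  shows left_incr_L4: "L4 (left_incr l i)" and right_incr_L4: "L4 (right_incr l i)"
    and left_incr_mean: "expectation (left_incr l i) = 0"
    and left_incr_fourth: "i \<in> J \<Longrightarrow> expectation (\<lambda>\<omega>. left_incr l i \<omega> ^ 4) = 3 * (h * c i)\<^sup>2"
    and right_incr_fourth: "i \<in> J \<Longrightarrow> expectation (\<lambda>\<omega>. right_incr l i \<omega> ^ 4) = 3 * (h * c i)\<^sup>2"
    and left_incr_cov: "i \<in> J \<Longrightarrow> j \<in> J \<Longrightarrow> expectation (\<lambda>\<omega>. left_incr l i \<omega> * left_incr l j \<omega>) = (if i = j then h * c i else 0)"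
    and right_incr_cov: "i \<in> J \<Longrightarrow> j \<in> J \<Longrightarrow> expectation (\<lambda>\<omega>. right_incr l i \<omega> * right_incr l j \<omega>) = (if i = j then h * c i else 0)"
proof -
  have cc: "C (e i) \<bullet> e j = (if i = j then c i else 0)" if "i \<in> J" "j \<in> J" for i j
    using J(2) c(1)[OF that(1)] that by (auto simp: orthonormal_family_def)
  note [simp] = T(2)
  show "L4 (left_incr l i)" "L4 (right_incr l i)" "expectation (left_incr l i) = 0"
    unfolding left_incr_def right_incr_def by (intro incr_L4 incr_mean T(1) T_le)+
  show "i \<in> J \<Longrightarrow> expectation (\<lambda>\<omega>. left_incr l i \<omega> ^ 4) = 3 * (h * c i)\<^sup>2"
    unfolding left_incr_def by (subst incr_fourth[OF T(1) T_le]) (simp add: cc)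
  show "i \<in> J \<Longrightarrow> expectation (\<lambda>\<omega>. right_incr l i \<omega> ^ 4) = 3 * (h * c i)\<^sup>2"
    unfolding right_incr_def by (subst incr_fourth[OF T(1) T_le]) (simp add: cc)
  show "i \<in> J \<Longrightarrow> j \<in> J \<Longrightarrow> expectation (\<lambda>\<omega>. left_incr l i \<omega> * left_incr l j \<omega>) = (if i = j then h * c i else 0)"
    unfolding left_incr_def by (subst incr_covariance[OF T(1) T_le]) (simp add: cc)
  show "i \<in> J \<Longrightarrow> j \<in> J \<Longrightarrow> expectation (\<lambda>\<omega>. right_incr l i \<omega> * right_incr l j \<omega>) = (if i = j then h * c i else 0)"
    unfolding right_incr_def by (subst incr_covariance[OF T(1) T_le]) (simp add: cc)
qed

text \<open>A variable of the past, a function of the left increment and a function of the right increment are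
independent. All expectations below reduce to this factorisation.\<close>

lemma past_left_right:
  fixes f :: "'w \<Rightarrow> real" and \<phi> \<psi> :: "(nat \<Rightarrow> real) \<Rightarrow> real"
  assumes f: "f \<in> borel_measurable (past M B (T (2 * l)))" "integrable M f"
    and \<phi>: "(\<lambda>v. \<phi> (\<lambda>i. v \<bullet> e i)) \<in> borel_measurable borel" "integrable M (\<lambda>\<omega>. \<phi> (\<lambda>i. left_incr l i \<omega>))"
    and \<psi>: "(\<lambda>v. \<psi> (\<lambda>i. v \<bullet> e i)) \<in> borel_measurable borel" "integrable M (\<lambda>\<omega>. \<psi> (\<lambda>i. right_incr l i \<omega>))"
  shows "integrable M (\<lambda>\<omega>. f \<omega> * \<phi> (\<lambda>i. left_incr l i \<omega>) * \<psi> (\<lambda>i. right_incr l i \<omega>))"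
    "expectation (\<lambda>\<omega>. f \<omega> * \<phi> (\<lambda>i. left_incr l i \<omega>) * \<psi> (\<lambda>i. right_incr l i \<omega>)) =
      expectation f * expectation (\<lambda>\<omega>. \<phi> (\<lambda>i. left_incr l i \<omega>)) * expectation (\<lambda>\<omega>. \<psi> (\<lambda>i. right_incr l i \<omega>))"
  using past_triple[OF T(1) T_le T_le f \<phi>[unfolded left_incr_def incr_def] \<psi>[unfolded right_incr_def incr_def]]
  by (simp_all only: left_incr_def right_incr_def incr_def)

definition coord_norm_sq :: "(nat \<Rightarrow> real) \<Rightarrow> real" where
  "coord_norm_sq x = (\<Sum>i\<in>J. (x i)\<^sup>2)"

abbreviation eig_sum :: real where "eig_sum \<equiv> (\<Sum>i\<in>J. c i)"

abbreviation eig_sq_sum :: real where "eig_sq_sum \<equiv> (\<Sum>i\<in>J. (c i)\<^sup>2)"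

text \<open>The inequality of the arithmetic and geometric mean, with weights that balance the two fourth moments.\<close>

lemma fourth_sq_le:
  assumes "i \<in> J" "j \<in> J" and x: "\<And>i. L4 (x i)"
    and m4: "\<And>i. i \<in> J \<Longrightarrow> expectation (\<lambda>\<omega>. x i \<omega> ^ 4) = 3 * (h * c i)\<^sup>2"
  shows "expectation (\<lambda>\<omega>. (x i \<omega>)\<^sup>2 * (x j \<omega>)\<^sup>2) \<le> 3 * h\<^sup>2 * c i * c j"
proof -
  have ci: "0 < c i" "0 < c j" using c(2) assms(1,2) by auto
  have "expectation (\<lambda>\<omega>. (x i \<omega>)\<^sup>2 * (x j \<omega>)\<^sup>2) \<le>
    expectation (\<lambda>\<omega>. c j / c i / 2 * x i \<omega> ^ 4 + c i / c j / 2 * x j \<omega> ^ 4)"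
  proof (rule integral_mono)
    show "integrable M (\<lambda>\<omega>. (x i \<omega>)\<^sup>2 * (x j \<omega>)\<^sup>2)"
      by (intro L2_mult L4_square x)
    show "integrable M (\<lambda>\<omega>. c j / c i / 2 * x i \<omega> ^ 4 + c i / c j / 2 * x j \<omega> ^ 4)"
      using x by (auto simp: L4_def)
    fix \<omega>
    have "0 \<le> (c j * (x i \<omega>)\<^sup>2 - c i * (x j \<omega>)\<^sup>2)\<^sup>2 / (2 * c i * c j)"
      using ci by simp
    also have "\<dots> = c j / c i / 2 * x i \<omega> ^ 4 + c i / c j / 2 * x j \<omega> ^ 4 - (x i \<omega>)\<^sup>2 * (x j \<omega>)\<^sup>2"
      using ci by (simp add: field_simps power2_eq_square power4_eq_xxxx)
    finally show "(x i \<omega>)\<^sup>2 * (x j \<omega>)\<^sup>2 \<le> c j / c i / 2 * x i \<omega> ^ 4 + c i / c j / 2 * x j \<omega> ^ 4" by simp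
  qed
  also have "\<dots> = c j / c i / 2 * (3 * (h * c i)\<^sup>2) + c i / c j / 2 * (3 * (h * c j)\<^sup>2)"
    using x m4[OF assms(1)] m4[OF assms(2)] by (simp add: L4_def)
  also have "\<dots> = 3 * h\<^sup>2 * c i * c j" using ci by (simp add: field_simps power2_eq_square)
  finally show ?thesis .
qed

lemma coord_norm_sq_moments:
  assumes x: "\<And>i. L4 (x i)"
    and m4: "\<And>i. i \<in> J \<Longrightarrow> expectation (\<lambda>\<omega>. x i \<omega> ^ 4) = 3 * (h * c i)\<^sup>2"
    and cov: "\<And>i j. i \<in> J \<Longrightarrow> j \<in> J \<Longrightarrow> expectation (\<lambda>\<omega>. x i \<omega> * x j \<omega>) = (if i = j then h * c i else 0)"
  shows "L2 (\<lambda>\<omega>. coord_norm_sq (\<lambda>i. x i \<omega>))" "expectation (\<lambda>\<omega>. coord_norm_sq (\<lambda>i. x i \<omega>)) = h * eig_sum"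
    "expectation (\<lambda>\<omega>. (coord_norm_sq (\<lambda>i. x i \<omega>))\<^sup>2) \<le> 3 * (h * eig_sum)\<^sup>2"
proof -
  show L: "L2 (\<lambda>\<omega>. coord_norm_sq (\<lambda>i. x i \<omega>))" unfolding coord_norm_sq_def by (intro L2_sum L4_square x)
  have "expectation (\<lambda>\<omega>. coord_norm_sq (\<lambda>i. x i \<omega>)) = (\<Sum>i\<in>J. expectation (\<lambda>\<omega>. (x i \<omega>)\<^sup>2))"
    unfolding coord_norm_sq_def using L4_L2[OF x] by (intro Bochner_Integration.integral_sum) (auto simp: L2_def)
  also have "\<dots> = h * eig_sum" unfolding sum_distrib_left
    using cov by (intro sum.cong refl) (simp add: power2_eq_square)
  finally show "expectation (\<lambda>\<omega>. coord_norm_sq (\<lambda>i. x i \<omega>)) = h * eig_sum" .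
  have i: "integrable M (\<lambda>\<omega>. (x i \<omega>)\<^sup>2 * (x j \<omega>)\<^sup>2)" for i j
    by (intro L2_mult L4_square x)
  have "expectation (\<lambda>\<omega>. (coord_norm_sq (\<lambda>i. x i \<omega>))\<^sup>2) = expectation (\<lambda>\<omega>. \<Sum>i\<in>J. \<Sum>j\<in>J. (x i \<omega>)\<^sup>2 * (x j \<omega>)\<^sup>2)"
    by (simp add: coord_norm_sq_def power2_eq_square[of "sum _ _"] sum_product)
  also have "\<dots> = (\<Sum>i\<in>J. \<Sum>j\<in>J. expectation (\<lambda>\<omega>. (x i \<omega>)\<^sup>2 * (x j \<omega>)\<^sup>2))"
    using i by simp
  also have "\<dots> \<le> (\<Sum>i\<in>J. \<Sum>j\<in>J. 3 * h\<^sup>2 * c i * c j)"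
    by (intro sum_mono fourth_sq_le x m4)
  also have "\<dots> = 3 * (h * eig_sum)\<^sup>2"
  proof -
    have "3 * (h * eig_sum)\<^sup>2 = 3 * h\<^sup>2 * (sum c J * sum c J)"
      by (simp add: power2_eq_square)
    also have "\<dots> = (\<Sum>i\<in>J. \<Sum>j\<in>J. 3 * h\<^sup>2 * c i * c j)"
      unfolding sum_product by (simp add: sum_distrib_left mult.assoc)
    finally show ?thesis by simp
  qed
  finally show "expectation (\<lambda>\<omega>. (coord_norm_sq (\<lambda>i. x i \<omega>))\<^sup>2) \<le> 3 * (h * eig_sum)\<^sup>2" .
qed

lemmas left_incr_norm_sq = coord_norm_sq_moments[of "left_incr l" for l, OF left_incr_L4 left_incr_fourth left_incr_cov]
lemmas right_incr_norm_sq = coord_norm_sq_moments[of "right_incr l" for l, OF right_incr_L4 right_incr_fourth right_incr_cov]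

lemma tensor_sum_Suc: "tensor_sum (Suc l) i j \<omega> = tensor_sum l i j \<omega> + left_incr l i \<omega> * right_incr l j \<omega>"
  by (simp add: tensor_sum_def)

lemma tensor_sum_past: "tensor_sum l i j \<in> borel_measurable (past M B (T (2 * l)))"
  unfolding tensor_sum_def[abs_def] left_incr_def right_incr_def
  by (intro borel_measurable_sum borel_measurable_times incr_measurable_past T(1) T_le T_mono) auto

lemma left_incr_right_incr_L4: "L4 (\<lambda>\<omega>. left_incr l i \<omega> * right_incr l j \<omega>)"
proof -
  have "integrable M (\<lambda>\<omega>. 1 * left_incr l i \<omega> ^ 4 * right_incr l j \<omega> ^ 4)"
    using left_incr_L4 right_incr_L4 by (intro past_left_right(1)[where \<phi> = "\<lambda>x. x i ^ 4" and \<psi> = "\<lambda>x. x j ^ 4"]) (auto simp: L4_def)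
  moreover have "(\<lambda>\<omega>. left_incr l i \<omega> * right_incr l j \<omega>) \<in> borel_measurable M"
    using left_incr_L4[of l i] right_incr_L4[of l j] by (intro borel_measurable_times) (auto simp: L4_def)
  ultimately show ?thesis by (simp add: L4_def power_mult_distrib)
qed

lemma tensor_sum_L4: "L4 (tensor_sum l i j)"
proof (induction l)
  case 0
  then show ?case by (simp add: tensor_sum_def[abs_def] L4_def)
next
  case (Suc l)
  then show ?case
    using L4_add[OF Suc left_incr_right_incr_L4] by (simp add: tensor_sum_Suc[abs_def])
qed

lemma integrable_left_incr_prod: "integrable M (\<lambda>\<omega>. left_incr l i \<omega> * left_incr l j \<omega>)"
  and integrable_right_incr_prod: "integrable M (\<lambda>\<omega>. right_incr l i \<omega> * right_incr l j \<omega>)"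
  by (intro L2_mult L4_L2 left_incr_L4 right_incr_L4)+

lemma past_left_incr_right_incr:
  assumes "f \<in> borel_measurable (past M B (T (2 * l)))" "integrable M f"
  shows "integrable M (\<lambda>\<omega>. f \<omega> * left_incr l i \<omega> * right_incr l j \<omega>)" "expectation (\<lambda>\<omega>. f \<omega> * left_incr l i \<omega> * right_incr l j \<omega>) = 0"
  using past_left_right[OF assms, of "\<lambda>x. x i" "\<lambda>x. x j"] L2_integrable[OF L4_L2[OF left_incr_L4]] L2_integrable[OF L4_L2[OF right_incr_L4]]
  by (auto simp: left_incr_mean)

lemma past_left_incr_right_incr2:
  assumes "f \<in> borel_measurable (past M B (T (2 * l)))" "integrable M f"
  shows "integrable M (\<lambda>\<omega>. f \<omega> * (left_incr l i \<omega> * left_incr l i' \<omega>) * (right_incr l j \<omega> * right_incr l j' \<omega>))"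
    "expectation (\<lambda>\<omega>. f \<omega> * (left_incr l i \<omega> * left_incr l i' \<omega>) * (right_incr l j \<omega> * right_incr l j' \<omega>)) =
      expectation f * expectation (\<lambda>\<omega>. left_incr l i \<omega> * left_incr l i' \<omega>) * expectation (\<lambda>\<omega>. right_incr l j \<omega> * right_incr l j' \<omega>)"
  using past_left_right[OF assms, of "\<lambda>x. x i * x i'" "\<lambda>x. x j * x j'"] integrable_left_incr_prod integrable_right_incr_prod
  by auto

lemma tensor_sum_mean: "expectation (tensor_sum l i j) = 0"
proof (induction l)
  case 0
  then show ?case by (simp add: tensor_sum_def[abs_def])
next
  case (Suc l)
  note i1 = tensor_sum_L4[of l i j]
  note i2 = L4_L2[OF i1]
  note i = L2_integrable[OF i2]
  have p: "integrable M (\<lambda>\<omega>. left_incr l i \<omega> * right_incr l j \<omega>)" "expectation (\<lambda>\<omega>. left_incr l i \<omega> * right_incr l j \<omega>) = 0"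
    using past_left_incr_right_incr[of "\<lambda>_. 1" l i j, OF borel_measurable_const integrable_const]
    by (simp_all only: mult_1)
  have "expectation (tensor_sum (Suc l) i j) = expectation (\<lambda>\<omega>. tensor_sum l i j \<omega> + left_incr l i \<omega> * right_incr l j \<omega>)"
    by (simp only: tensor_sum_Suc[abs_def])
  also have "\<dots> = 0"
    unfolding Bochner_Integration.integral_add[OF i p(1)] p(2) Suc by simp
  finally show ?case .
qed

lemma tensor_sum_cov:
  assumes "i \<in> J" "i' \<in> J" "j \<in> J" "j' \<in> J"
  shows "expectation (\<lambda>\<omega>. tensor_sum l i j \<omega> * tensor_sum l i' j' \<omega>) =
    (if i = i' \<and> j = j' then real l * (h\<^sup>2 * c i * c j) else 0)"
proof (induction l)
  case 0
  then show ?case by (simp add: tensor_sum_def[abs_def])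
next
  case (Suc l)
  let ?a = "tensor_sum l i j" and ?a' = "tensor_sum l i' j'"
  let ?x = "left_incr l i" and ?x' = "left_incr l i'" and ?y = "right_incr l j" and ?y' = "right_incr l j'"
  note int = L2_integrable[OF L4_L2[OF tensor_sum_L4]]
  note 1 = L2_mult[OF L4_L2[OF tensor_sum_L4[of l i j]] L4_L2[OF tensor_sum_L4[of l i' j']]]
  note 2 = past_left_incr_right_incr[OF tensor_sum_past int, of l i j i' j']
  note 3 = past_left_incr_right_incr[OF tensor_sum_past int, of l i' j' i j]
  have E1: "expectation (\<lambda>_. 1 :: real) = 1" using prob_space by simp
  note 4 = past_left_incr_right_incr2[of "\<lambda>_. 1" l i i' j j', OF borel_measurable_const integrable_const,
      unfolded mult_1 E1]
  have "expectation (\<lambda>\<omega>. tensor_sum (Suc l) i j \<omega> * tensor_sum (Suc l) i' j' \<omega>) =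
    expectation (\<lambda>\<omega>. ?a \<omega> * ?a' \<omega> + ?a \<omega> * ?x' \<omega> * ?y' \<omega> + ?a' \<omega> * ?x \<omega> * ?y \<omega> + ?x \<omega> * ?x' \<omega> * (?y \<omega> * ?y' \<omega>))"
    by (simp add: tensor_sum_Suc algebra_simps)
  also have "\<dots> = expectation (\<lambda>\<omega>. ?a \<omega> * ?a' \<omega>) + expectation (\<lambda>\<omega>. ?x \<omega> * ?x' \<omega>) * expectation (\<lambda>\<omega>. ?y \<omega> * ?y' \<omega>)"
    unfolding Bochner_Integration.integral_add[OF Bochner_Integration.integrable_add[OF
        Bochner_Integration.integrable_add[OF 1 2(1)] 3(1)] 4(1)]
      Bochner_Integration.integral_add[OF Bochner_Integration.integrable_add[OF 1 2(1)] 3(1)]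
      Bochner_Integration.integral_add[OF 1 2(1)] 2(2) 3(2) 4(2) by simp
  also have "\<dots> = (if i = i' \<and> j = j' then real (Suc l) * (h\<^sup>2 * c i * c j) else 0)"
    unfolding Suc using assms by (simp add: left_incr_cov right_incr_cov power2_eq_square algebra_simps)
  finally show ?case .
qed

definition tensor_norm :: "nat \<Rightarrow> 'w \<Rightarrow> real" where
  "tensor_norm l \<omega> = (\<Sum>(i, j)\<in>J \<times> J. (tensor_sum l i j \<omega>)\<^sup>2)"

lemma tensor_norm_expand: "tensor_norm l \<omega> = (\<Sum>(i, j)\<in>J \<times> J. (\<Sum>m<l.
    incr (T (2 * m)) (T (Suc (2 * m))) (e i) \<omega> * incr (T (Suc (2 * m))) (T (Suc (Suc (2 * m)))) (e j) \<omega>)\<^sup>2)"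
  by (simp add: tensor_norm_def tensor_sum_def left_incr_def right_incr_def)

lemma tensor_norm_L2: "L2 (tensor_norm l)"
  unfolding tensor_norm_def[abs_def] split_beta by (intro L2_sum L4_square tensor_sum_L4)

lemma tensor_norm_past: "tensor_norm l \<in> borel_measurable (past M B (T (2 * l)))"
  unfolding tensor_norm_def[abs_def] split_beta
  by (intro borel_measurable_sum borel_measurable_power tensor_sum_past)

text \<open>Adding one product changes the squared norm by \<open>n\<close>, the product of the squared norms of the new vectors,
and by twice the inner product \<open>g\<close> of the new product with the sum of the old ones. The centred old norm
\<open>\<xi>\<close>, the centred \<open>\<zeta> = n - \<mu>\<close> and \<open>g\<close> are pairwise uncorrelated: \<open>\<zeta>\<close> is independent of the past, \<open>g\<close> is
linear in the new left increment, and \<open>tensor_sum\<close> has mean zero. So the variances add up. That of \<open>\<zeta>\<close> is at most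
\<open>9 * \<mu>\<^sup>2\<close>. That of \<open>g\<close> grows linearly with the number of terms, but has the squared sum of \<open>c i ^ 2\<close> in
place of the fourth power of the sum of \<open>c i\<close>.\<close>

lemma tensor_norm_deviation:
  "expectation (\<lambda>\<omega>. (tensor_norm l \<omega> - real l * (h * eig_sum)\<^sup>2)\<^sup>2)
    \<le> 9 * real l * (h * eig_sum) ^ 4 + 2 * (real l)\<^sup>2 * h ^ 4 * eig_sq_sum\<^sup>2"
proof (induction l)
  case 0
  then show ?case by (simp add: tensor_norm_def[abs_def] tensor_sum_def[abs_def])
next
  case (Suc l)
  define \<mu> where "\<mu> = (h * eig_sum)\<^sup>2"
  define \<xi> where "\<xi> \<omega> = tensor_norm l \<omega> - real l * \<mu>" for \<omega>
  define n where "n \<omega> = coord_norm_sq (\<lambda>i. left_incr l i \<omega>) * coord_norm_sq (\<lambda>i. right_incr l i \<omega>)" for \<omega>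
  define \<zeta> where "\<zeta> \<omega> = n \<omega> - \<mu>" for \<omega>
  define G where "G p \<omega> = tensor_sum l (fst p) (snd p) \<omega> * left_incr l (fst p) \<omega> * right_incr l (snd p) \<omega>" for p \<omega>
  define g where "g \<omega> = (\<Sum>p\<in>J \<times> J. G p \<omega>)" for \<omega>
  have split: "tensor_norm (Suc l) \<omega> - real (Suc l) * \<mu> = \<xi> \<omega> + \<zeta> \<omega> + 2 * g \<omega>" for \<omega>
  proof -
    have "n \<omega> = (\<Sum>p\<in>J \<times> J. (left_incr l (fst p) \<omega> * right_incr l (snd p) \<omega>)\<^sup>2)"
      unfolding n_def coord_norm_sq_def sum_product by (simp add: sum.cartesian_product power_mult_distrib split_beta)
    then have "tensor_norm (Suc l) \<omega> = tensor_norm l \<omega> + n \<omega> + 2 * g \<omega>"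
      unfolding tensor_norm_def g_def G_def split_beta tensor_sum_Suc
      by (simp add: sum_distrib_left flip: sum.distrib) (simp add: power2_sum algebra_simps)
    then show ?thesis by (simp add: \<xi>_def \<zeta>_def algebra_simps)
  qed
  have E1: "expectation (\<lambda>_. 1 :: real) = 1" using prob_space by simp
  have J2: "finite (J \<times> J)" using J by simp
  have coord_norm_sq_m: "(\<lambda>v. coord_norm_sq (\<lambda>i. v \<bullet> e i)) \<in> borel_measurable borel" unfolding coord_norm_sq_def by measurable
  have \<xi>p: "\<xi> \<in> borel_measurable (past M B (T (2 * l)))"
    unfolding \<xi>_def[abs_def] using tensor_norm_past by simp
  have \<xi>L: "L2 \<xi>" unfolding \<xi>_def[abs_def] by (intro L2_diff tensor_norm_L2 L2_const)
  have sq_int: "integrable M (\<lambda>\<omega>. (coord_norm_sq (\<lambda>i. left_incr l i \<omega>))\<^sup>2)" "integrable M (\<lambda>\<omega>. (coord_norm_sq (\<lambda>i. right_incr l i \<omega>))\<^sup>2)"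
    using left_incr_norm_sq(1)[of l] right_incr_norm_sq(1)[of l] by (auto simp: L2_def)
  have int1: "integrable M (\<lambda>\<omega>. coord_norm_sq (\<lambda>i. left_incr l i \<omega>))" "integrable M (\<lambda>\<omega>. coord_norm_sq (\<lambda>i. right_incr l i \<omega>))"
    using L2_integrable[OF left_incr_norm_sq(1)] L2_integrable[OF right_incr_norm_sq(1)] by auto
  have fn: "integrable M (\<lambda>\<omega>. f \<omega> * n \<omega>)" "expectation (\<lambda>\<omega>. f \<omega> * n \<omega>) = expectation f * \<mu>"
    if "f \<in> borel_measurable (past M B (T (2 * l)))" "integrable M f" for f
    using past_left_right[OF that coord_norm_sq_m int1(1) coord_norm_sq_m int1(2)] left_incr_norm_sq(2)[of l] right_incr_norm_sq(2)[of l]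
    by (simp_all add: n_def mult.assoc \<mu>_def power2_eq_square)
  have n_sq: "integrable M (\<lambda>\<omega>. (n \<omega>)\<^sup>2)" "expectation (\<lambda>\<omega>. (n \<omega>)\<^sup>2) \<le> 9 * \<mu>\<^sup>2"
  proof -
    have m: "(\<lambda>v. (coord_norm_sq (\<lambda>i. v \<bullet> e i))\<^sup>2) \<in> borel_measurable borel" using coord_norm_sq_m by measurable
    note tr = past_left_right[of "\<lambda>_. 1" l "\<lambda>x. (coord_norm_sq x)\<^sup>2" "\<lambda>x. (coord_norm_sq x)\<^sup>2",
        OF borel_measurable_const integrable_const m sq_int(1) m sq_int(2), unfolded mult_1 E1]
    show "integrable M (\<lambda>\<omega>. (n \<omega>)\<^sup>2)" using tr(1) by (simp add: n_def power_mult_distrib)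
    have "expectation (\<lambda>\<omega>. (n \<omega>)\<^sup>2) = expectation (\<lambda>\<omega>. (coord_norm_sq (\<lambda>i. left_incr l i \<omega>))\<^sup>2) * expectation (\<lambda>\<omega>. (coord_norm_sq (\<lambda>i. right_incr l i \<omega>))\<^sup>2)"
      using tr(2) by (simp add: n_def power_mult_distrib)
    also have "\<dots> \<le> (3 * (h * eig_sum)\<^sup>2) * (3 * (h * eig_sum)\<^sup>2)"
      using left_incr_norm_sq(3)[of l] right_incr_norm_sq(3)[of l] by (intro mult_mono) auto
    finally show "expectation (\<lambda>\<omega>. (n \<omega>)\<^sup>2) \<le> 9 * \<mu>\<^sup>2" by (simp add: \<mu>_def power2_eq_square mult_ac)
  qed
  have nL: "L2 n"
    using n_sq(1) left_incr_norm_sq(1)[of l] right_incr_norm_sq(1)[of l] by (auto simp: L2_def n_def[abs_def])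
  have n_mean: "expectation n = \<mu>"
    using fn(2)[OF borel_measurable_const integrable_const, of 1] by (simp add: prob_space)
  have \<zeta>L: "L2 \<zeta>" unfolding \<zeta>_def[abs_def] by (intro L2_diff nL L2_const)
  have AL: "L2 (tensor_sum l i j)" for i j by (rule L4_L2[OF tensor_sum_L4])
  have GL: "L2 (G p)" for p
  proof -
    have "integrable M (\<lambda>\<omega>. (tensor_sum l (fst p) (snd p) \<omega>)\<^sup>2 * (left_incr l (fst p) \<omega> * left_incr l (fst p) \<omega>) * (right_incr l (snd p) \<omega> * right_incr l (snd p) \<omega>))"
      using AL[of "fst p" "snd p"] by (intro past_left_incr_right_incr2(1) borel_measurable_power tensor_sum_past) (auto simp: L2_def)
    moreover have "G p \<in> borel_measurable M"
      unfolding G_def[abs_def] using AL left_incr_L4 right_incr_L4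
      by (intro borel_measurable_times) (auto simp: L2_def L4_def)
    moreover have "(G p \<omega>)\<^sup>2 = (tensor_sum l (fst p) (snd p) \<omega>)\<^sup>2 * (left_incr l (fst p) \<omega> * left_incr l (fst p) \<omega>) *
        (right_incr l (snd p) \<omega> * right_incr l (snd p) \<omega>)" for \<omega>
      unfolding G_def power_mult_distrib by (simp add: power2_eq_square)
    ultimately show ?thesis by (simp add: L2_def)
  qed
  have gL: "L2 g" unfolding g_def[abs_def] by (intro L2_sum GL)
  have \<xi>\<zeta>: "expectation (\<lambda>\<omega>. \<xi> \<omega> * \<zeta> \<omega>) = 0"
    using fn[OF \<xi>p L2_integrable[OF \<xi>L]] L2_integrable[OF \<xi>L] by (simp add: \<zeta>_def right_diff_distrib)
  have \<xi>g: "expectation (\<lambda>\<omega>. \<xi> \<omega> * g \<omega>) = 0"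
  proof -
    have *: "expectation (\<lambda>\<omega>. \<xi> \<omega> * G p \<omega>) = 0" for p
      using past_left_incr_right_incr(2)[of "\<lambda>\<omega>. \<xi> \<omega> * tensor_sum l (fst p) (snd p) \<omega>" l "fst p" "snd p"]
        L2_mult[OF \<xi>L AL] borel_measurable_times[OF \<xi>p tensor_sum_past]
      by (simp add: G_def mult.assoc)
    show ?thesis
      unfolding g_def sum_distrib_left
      using L2_mult[OF \<xi>L GL] by (subst Bochner_Integration.integral_sum) (auto simp: *)
  qed
  have \<zeta>g: "expectation (\<lambda>\<omega>. \<zeta> \<omega> * g \<omega>) = 0"
  proof -
    have *: "expectation (\<lambda>\<omega>. \<zeta> \<omega> * G p \<omega>) = 0" for p
    proof -
      obtain i j where p: "p = (i, j)" by (cases p)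
      let ?A = "tensor_sum l i j"
      note Ai = L2_integrable[OF AL[of i j]]
      note 1 = past_left_incr_right_incr[OF tensor_sum_past Ai, of i j]
      have m: "(\<lambda>v. v \<bullet> e i * coord_norm_sq (\<lambda>i. v \<bullet> e i)) \<in> borel_measurable borel" for i using coord_norm_sq_m by measurable
      have il: "integrable M (\<lambda>\<omega>. left_incr l i \<omega> * coord_norm_sq (\<lambda>i. left_incr l i \<omega>))"
        by (rule L2_mult[OF L4_L2[OF left_incr_L4] left_incr_norm_sq(1)])
      have ir: "integrable M (\<lambda>\<omega>. right_incr l j \<omega> * coord_norm_sq (\<lambda>i. right_incr l i \<omega>))"
        by (rule L2_mult[OF L4_L2[OF right_incr_L4] right_incr_norm_sq(1)])
      note 2 = past_left_right[OF tensor_sum_past Ai m il m ir]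
      have "expectation (\<lambda>\<omega>. \<zeta> \<omega> * G p \<omega>) =
        expectation (\<lambda>\<omega>. ?A \<omega> * (left_incr l i \<omega> * coord_norm_sq (\<lambda>i. left_incr l i \<omega>)) * (right_incr l j \<omega> * coord_norm_sq (\<lambda>i. right_incr l i \<omega>))
          - \<mu> * (?A \<omega> * left_incr l i \<omega> * right_incr l j \<omega>))"
        by (simp add: \<zeta>_def G_def p n_def algebra_simps)
      also have "\<dots> = 0"
        unfolding Bochner_Integration.integral_diff[OF 2(1) integrable_mult_right[OF 1(1)]] 2(2)
        by (simp add: tensor_sum_mean 1(2))
      finally show ?thesis .
    qed
    show ?thesis
      unfolding g_def sum_distrib_left
      using L2_mult[OF \<zeta>L GL] by (subst Bochner_Integration.integral_sum) (auto simp: *)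
  qed
  have g2: "expectation (\<lambda>\<omega>. (g \<omega>)\<^sup>2) = real l * h ^ 4 * eig_sq_sum\<^sup>2"
  proof -
    have GG: "expectation (\<lambda>\<omega>. G p \<omega> * G q \<omega>) = (if p = q then real l * h ^ 4 * ((c (fst p))\<^sup>2 * (c (snd p))\<^sup>2) else 0)"
      if pq: "p \<in> J \<times> J" "q \<in> J \<times> J" for p q
    proof -
      obtain i j i' j' where p: "p = (i, j)" "q = (i', j')" by (cases p, cases q)
      have ij: "i \<in> J" "j \<in> J" "i' \<in> J" "j' \<in> J" using pq p by auto
      have m: "(\<lambda>\<omega>. tensor_sum l i j \<omega> * tensor_sum l i' j' \<omega>) \<in> borel_measurable (past M B (T (2 * l)))"
        by (intro borel_measurable_times tensor_sum_past)
      have "expectation (\<lambda>\<omega>. G p \<omega> * G q \<omega>) = expectation (\<lambda>\<omega>. (tensor_sum l i j \<omega> * tensor_sum l i' j' \<omega>) *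
          (left_incr l i \<omega> * left_incr l i' \<omega>) * (right_incr l j \<omega> * right_incr l j' \<omega>))"
        by (simp add: G_def p mult_ac)
      also have "\<dots> = (if p = q then real l * h ^ 4 * ((c (fst p))\<^sup>2 * (c (snd p))\<^sup>2) else 0)"
        using past_left_incr_right_incr2(2)[OF m L2_mult[OF AL AL], of i i' j j'] ij
        by (simp add: p tensor_sum_cov left_incr_cov right_incr_cov power2_eq_square power4_eq_xxxx mult_ac)
      finally show ?thesis .
    qed
    have "expectation (\<lambda>\<omega>. (g \<omega>)\<^sup>2) = expectation (\<lambda>\<omega>. \<Sum>p\<in>J \<times> J. \<Sum>q\<in>J \<times> J. G p \<omega> * G q \<omega>)"
      by (simp add: g_def power2_eq_square sum_product)
    also have "\<dots> = (\<Sum>p\<in>J \<times> J. \<Sum>q\<in>J \<times> J. expectation (\<lambda>\<omega>. G p \<omega> * G q \<omega>))"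
      using L2_mult[OF GL GL] by simp
    also have "\<dots> = (\<Sum>p\<in>J \<times> J. \<Sum>q\<in>J \<times> J. if p = q then real l * h ^ 4 * ((c (fst p))\<^sup>2 * (c (snd p))\<^sup>2) else 0)"
      by (intro sum.cong refl GG)
    also have "\<dots> = (\<Sum>p\<in>J \<times> J. real l * h ^ 4 * ((c (fst p))\<^sup>2 * (c (snd p))\<^sup>2))"
      using J2 by simp
    also have "\<dots> = real l * h ^ 4 * eig_sq_sum\<^sup>2"
      unfolding power2_eq_square[of "sum _ _"] sum_product sum.cartesian_product
      by (simp add: sum_distrib_left split_beta)
    finally show ?thesis .
  qed
  have \<zeta>2: "expectation (\<lambda>\<omega>. (\<zeta> \<omega>)\<^sup>2) \<le> 9 * \<mu>\<^sup>2"
  proof -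
    have "expectation (\<lambda>\<omega>. (\<zeta> \<omega>)\<^sup>2) = expectation (\<lambda>\<omega>. (n \<omega>)\<^sup>2 - 2 * \<mu> * n \<omega> + \<mu>\<^sup>2)"
      by (simp add: \<zeta>_def power2_diff algebra_simps)
    also have "\<dots> = expectation (\<lambda>\<omega>. (n \<omega>)\<^sup>2) - 2 * \<mu> * \<mu> + \<mu>\<^sup>2"
      using n_sq(1) L2_integrable[OF nL] n_mean prob_space by simp
    also have "\<dots> \<le> 9 * \<mu>\<^sup>2" using n_sq(2) zero_le_power2[of \<mu>] unfolding power2_eq_square[of \<mu>] by linarith
    finally show ?thesis .
  qed
  have "expectation (\<lambda>\<omega>. (tensor_norm (Suc l) \<omega> - real (Suc l) * \<mu>)\<^sup>2) =
    expectation (\<lambda>\<omega>. (\<xi> \<omega>)\<^sup>2 + (\<zeta> \<omega>)\<^sup>2 + 4 * (g \<omega>)\<^sup>2 + 2 * (\<xi> \<omega> * \<zeta> \<omega>) + 4 * (\<xi> \<omega> * g \<omega>) + 4 * (\<zeta> \<omega> * g \<omega>))"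
    unfolding split by (simp add: power2_eq_square algebra_simps)
  also have "\<dots> = expectation (\<lambda>\<omega>. (\<xi> \<omega>)\<^sup>2) + expectation (\<lambda>\<omega>. (\<zeta> \<omega>)\<^sup>2) + 4 * expectation (\<lambda>\<omega>. (g \<omega>)\<^sup>2)"
    using L2_mult[OF \<xi>L \<zeta>L] L2_mult[OF \<xi>L gL] L2_mult[OF \<zeta>L gL] \<xi>L \<zeta>L gL \<xi>\<zeta> \<xi>g \<zeta>g
    by (simp add: L2_def)
  also have "\<dots> \<le> (9 * real l * (h * eig_sum) ^ 4 + 2 * (real l)\<^sup>2 * h ^ 4 * eig_sq_sum\<^sup>2) + 9 * \<mu>\<^sup>2 + 4 * (real l * h ^ 4 * eig_sq_sum\<^sup>2)"
    unfolding g2 using Suc \<zeta>2 by (simp add: \<xi>_def \<mu>_def)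
  also have "\<dots> \<le> 9 * real (Suc l) * (h * eig_sum) ^ 4 + 2 * (real (Suc l))\<^sup>2 * h ^ 4 * eig_sq_sum\<^sup>2"
  proof -
    have "0 \<le> h ^ 4 * eig_sq_sum\<^sup>2" by simp
    moreover have "9 * real (Suc l) * (h * eig_sum) ^ 4 + 2 * (real (Suc l))\<^sup>2 * h ^ 4 * eig_sq_sum\<^sup>2 =
      (9 * real l * (h * eig_sum) ^ 4 + 2 * (real l)\<^sup>2 * h ^ 4 * eig_sq_sum\<^sup>2) + 9 * \<mu>\<^sup>2 + 4 * (real l * h ^ 4 * eig_sq_sum\<^sup>2) + 2 * (h ^ 4 * eig_sq_sum\<^sup>2)"
      by (simp add: \<mu>_def power2_eq_square power4_eq_xxxx algebra_simps)
    ultimately show ?thesis by linarith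
  qed
  finally show ?case by (simp add: \<mu>_def)
qed

end

end

section \<open>Almost sure decay of the dyadic remainders\<close>

lemma sum_even_odd:
  fixes f :: "nat \<Rightarrow> 'b::comm_monoid_add"
  shows "(\<Sum>m<2 * n. f m) = (\<Sum>l<n. f (2 * l) + f (Suc (2 * l)))"
  by (induction n) (auto simp: add.assoc)

lemma L2_set_sum_le:
  fixes f :: "'d \<Rightarrow> 'i \<Rightarrow> real"
  shows "L2_set (\<lambda>i. \<Sum>d\<in>D. f d i) I \<le> (\<Sum>d\<in>D. L2_set (f d) I)"
proof (induction D rule: infinite_finite_induct)
  case (insert d D)
  then have "L2_set (\<lambda>i. \<Sum>d\<in>insert d D. f d i) I = L2_set (\<lambda>i. f d i + (\<Sum>d\<in>D. f d i)) I" by simp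
  also have "\<dots> \<le> L2_set (f d) I + L2_set (\<lambda>i. \<Sum>d\<in>D. f d i) I" by (rule L2_set_triangle_ineq)
  finally show ?case using insert by simp
qed (auto simp: L2_set_def)

context hilbert_brownian_motion
begin

text \<open>In each cell the Riemann sum over the finer partition replaces \<open>B\<close> at the left end by its value at
the midpoint on the right half of the cell.\<close>

lemma dyadic_integral_Suc:
  fixes t k
  defines "g \<equiv> grid t (Suc k)"
  shows "(dyadic_integral t (Suc k) \<omega> x - dyadic_integral t k \<omega> x) \<bullet> y =
    (\<Sum>l<2 ^ k. incr (g (2 * l)) (g (Suc (2 * l))) y \<omega> * incr (g (Suc (2 * l))) (g (Suc (Suc (2 * l)))) x \<omega>)"
proof -
  have g: "grid t k l = g (2 * l)" for l by (simp add: g_def grid_def)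
  have "dyadic_integral t (Suc k) \<omega> x \<bullet> y = (\<Sum>l<2 ^ k. (B (g (2 * l)) \<omega> \<bullet> y) * incr (g (2 * l)) (g (Suc (2 * l))) x \<omega>
      + (B (g (Suc (2 * l))) \<omega> \<bullet> y) * incr (g (Suc (2 * l))) (g (Suc (Suc (2 * l)))) x \<omega>)"
    unfolding dyadic_integral_def elementary_integral_entry g_def[symmetric] power_Suc by (rule sum_even_odd)
  moreover have "dyadic_integral t k \<omega> x \<bullet> y =
      (\<Sum>l<2 ^ k. (B (g (2 * l)) \<omega> \<bullet> y) * (incr (g (2 * l)) (g (Suc (2 * l))) x \<omega> + incr (g (Suc (2 * l))) (g (Suc (Suc (2 * l)))) x \<omega>))"
    unfolding dyadic_integral_def elementary_integral_entry g
    using incr_split by (intro sum.cong refl arg_cong2[where f = "(*)"]) auto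
  ultimately show ?thesis
    by (simp add: inner_diff_left incr_def[of _ _ y] algebra_simps flip: sum_subtractf)
qed

text \<open>
At level \<open>k\<close> the first \<open>2 ^ k\<close> eigenvectors are projected away; \<open>a k\<close> bounds the trace of the covariance
that is left. The last hypothesis says that the eigenvalues beyond \<open>2 ^ k\<close> are spread out: the sum of
their squares is smaller by \<open>1 / 2 ^ k\<close> than the square of their sum.\<close>

context
  fixes t :: real and e :: "nat \<Rightarrow> 'a" and c :: "nat \<Rightarrow> real" and a :: "nat \<Rightarrow> real" and Q :: real
  assumes t: "0 < t" and e: "orthonormal_family {1..} e"
    and c: "\<And>i. 1 \<le> i \<Longrightarrow> C (e i) = c i *\<^sub>R e i" "\<And>i. 1 \<le> i \<Longrightarrow> 0 < c i"
    and a: "\<And>k. 0 < a k" "\<And>k N. (\<Sum>i\<in>{2 ^ k<..N}. c i) \<le> a k"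
    and Q: "0 \<le> Q" "\<And>k N. (\<Sum>i\<in>{2 ^ k<..N}. (c i)\<^sup>2) \<le> Q * (a k)\<^sup>2 / 2 ^ k"
begin

text \<open>The squared Hilbert--Schmidt norm of the difference of the dyadic integrals at levels \<open>k + d + 1\<close> and
\<open>k + d\<close>, restricted to the indices in \<open>(2 ^ k, N]\<close>.\<close>

definition level_norm :: "nat \<Rightarrow> nat \<Rightarrow> nat \<Rightarrow> 'w \<Rightarrow> real" where
  "level_norm k d N = tensor_norm (grid t (Suc (k + d))) {2 ^ k<..N} e (2 ^ (k + d))"

text \<open>An upper bound, uniform in \<open>N\<close>, for the expectation of \<open>level_norm k d N\<close>.\<close>

definition level_mean :: "nat \<Rightarrow> nat \<Rightarrow> real" where
  "level_mean k d = t\<^sup>2 * (a k)\<^sup>2 / (4 * 2 ^ (k + d))"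

lemma level_mean_pos: "0 < level_mean k d"
  using t a(1)[of k] by (simp add: level_mean_def)

lemma level_context:
  shows "0 \<le> grid t (Suc j) l" "grid t (Suc j) (Suc l) = grid t (Suc j) l + t / 2 ^ Suc j" "0 \<le> t / 2 ^ Suc j"
    "finite {2 ^ k<..N::nat}" "orthonormal_family {2 ^ k<..N} e"
    "i \<in> {2 ^ k<..N} \<Longrightarrow> C (e i) = c i *\<^sub>R e i" "i \<in> {2 ^ k<..N} \<Longrightarrow> 0 < c i"
proof -
  show "0 \<le> grid t (Suc j) l" using t by (intro grid_nonneg) simp
  show "grid t (Suc j) (Suc l) = grid t (Suc j) l + t / 2 ^ Suc j"
    using grid_Suc_diff[of t "Suc j" l] by simp
  show "orthonormal_family {2 ^ k<..N} e" using e by (auto simp: orthonormal_family_def)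
  show "0 \<le> t / 2 ^ Suc j" using t by simp
  show "i \<in> {2 ^ k<..N} \<Longrightarrow> C (e i) = c i *\<^sub>R e i" "i \<in> {2 ^ k<..N} \<Longrightarrow> 0 < c i" using c[of i] by auto
qed simp

lemma level_norm_L2: "L2 (level_norm k d N)"
  unfolding level_norm_def
  by (rule tensor_norm_L2[where T = "grid t (Suc (k + d))" and J = "{2 ^ k<..N}" and e = e and c = c
        and h = "t / 2 ^ Suc (k + d)", OF level_context])

lemma level_norm_eq: "level_norm k d N \<omega> = (\<Sum>(i, j)\<in>{2 ^ k<..N} \<times> {2 ^ k<..N}.
    ((dyadic_integral t (Suc (k + d)) \<omega> (e j) - dyadic_integral t (k + d) \<omega> (e j)) \<bullet> e i)\<^sup>2)"
  unfolding level_norm_def dyadic_integral_Suc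
  by (rule tensor_norm_expand[where T = "grid t (Suc (k + d))" and J = "{2 ^ k<..N}" and e = e and c = c
        and h = "t / 2 ^ Suc (k + d)", OF level_context])

lemma level_norm_mono: "N \<le> N' \<Longrightarrow> level_norm k d N \<omega> \<le> level_norm k d N' \<omega>"
  unfolding level_norm_eq by (intro sum_mono2) auto

text \<open>The excess over an upper bound of the mean is dominated by the deviation from the mean. In contrast to
the deviation it is monotone in \<open>N\<close>, so that the supremum over \<open>N\<close> can be integrated.\<close>

lemma level_norm_excess:
  "(\<integral>\<^sup>+\<omega>. ennreal ((max 0 (level_norm k d N \<omega> - level_mean k d))\<^sup>2) \<partial>M)
    \<le> ennreal ((9 + 2 * Q\<^sup>2) * (level_mean k d)\<^sup>2 / 2 ^ k)"
proof -
  define n where "n = k + d"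
  define L :: real where "L = 2 ^ n"
  define h where "h = t / 2 ^ Suc n"
  define u where "u = (\<Sum>i\<in>{2 ^ k<..N}. c i)"
  define v where "v = (\<Sum>i\<in>{2 ^ k<..N}. (c i)\<^sup>2)"
  let ?S = "level_norm k d N"
  have L: "0 < L" "2 ^ k \<le> L" by (auto simp: L_def n_def power_add)
  have "0 \<le> u" unfolding u_def by (intro sum_nonneg less_imp_le level_context(7))
  then have u: "0 \<le> u" "u \<le> a k" using a(2)[of k N] by (auto simp: u_def)
  have v: "0 \<le> v" "v \<le> Q * (a k)\<^sup>2 / 2 ^ k" using Q(2)[of k N] by (auto simp: v_def intro!: sum_nonneg)
  have m: "level_mean k d = L * h\<^sup>2 * (a k)\<^sup>2"
    by (simp add: level_mean_def L_def h_def n_def power2_eq_square field_simps)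
  have dev: "expectation (\<lambda>\<omega>. (?S \<omega> - L * (h * u)\<^sup>2)\<^sup>2) \<le> 9 * L * (h * u) ^ 4 + 2 * L\<^sup>2 * h ^ 4 * v\<^sup>2"
    using tensor_norm_deviation[where T = "grid t (Suc (k + d))" and J = "{2 ^ k<..N}" and e = e and c = c
        and h = "t / 2 ^ Suc (k + d)" and l = "2 ^ n", OF level_context]
    by (simp add: level_norm_def u_def v_def h_def L_def n_def)
  have "(\<integral>\<^sup>+\<omega>. ennreal ((max 0 (?S \<omega> - level_mean k d))\<^sup>2) \<partial>M) \<le> (\<integral>\<^sup>+\<omega>. ennreal ((?S \<omega> - L * (h * u)\<^sup>2)\<^sup>2) \<partial>M)"
  proof (intro nn_integral_mono ennreal_leI)
    fix \<omega>
    have "(h * u)\<^sup>2 \<le> h\<^sup>2 * (a k)\<^sup>2" using u by (simp add: power_mult_distrib mult_left_mono power_mono)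
    then have "L * (h * u)\<^sup>2 \<le> level_mean k d" unfolding m using L by (simp add: mult.assoc)
    then show "(max 0 (?S \<omega> - level_mean k d))\<^sup>2 \<le> (?S \<omega> - L * (h * u)\<^sup>2)\<^sup>2"
      by (cases "?S \<omega> \<le> level_mean k d") (auto simp: max_def intro!: power_mono)
  qed
  also have "\<dots> = ennreal (expectation (\<lambda>\<omega>. (?S \<omega> - L * (h * u)\<^sup>2)\<^sup>2))"
    using L2_diff[OF level_norm_L2[of k d N] L2_const[of "L * (h * u)\<^sup>2"]]
    by (intro nn_integral_eq_integral) (auto simp: L2_def)
  also have "\<dots> \<le> ennreal ((9 + 2 * Q\<^sup>2) * (level_mean k d)\<^sup>2 / 2 ^ k)"
  proof (rule ennreal_leI)
    have 1: "9 * L * (h * u) ^ 4 \<le> 9 * (level_mean k d)\<^sup>2 / 2 ^ k"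
    proof -
      have "(h * u) ^ 4 \<le> h ^ 4 * (a k) ^ 4"
        using u by (simp add: power_mult_distrib mult_left_mono power_mono)
      then have "9 * L * (h * u) ^ 4 \<le> 9 * L * (h ^ 4 * (a k) ^ 4)" using L by (intro mult_left_mono) auto
      also have "\<dots> = 9 * (level_mean k d)\<^sup>2 / L"
        using L by (simp add: m power2_eq_square power4_eq_xxxx field_simps)
      also have "\<dots> \<le> 9 * (level_mean k d)\<^sup>2 / 2 ^ k" using L by (intro divide_left_mono) auto
      finally show ?thesis .
    qed
    have 2: "2 * L\<^sup>2 * h ^ 4 * v\<^sup>2 \<le> 2 * Q\<^sup>2 * (level_mean k d)\<^sup>2 / 2 ^ k"
    proof -
      have "v\<^sup>2 \<le> (Q * (a k)\<^sup>2 / 2 ^ k)\<^sup>2" using v by (intro power_mono) auto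
      then have "2 * L\<^sup>2 * h ^ 4 * v\<^sup>2 \<le> 2 * L\<^sup>2 * h ^ 4 * (Q * (a k)\<^sup>2 / 2 ^ k)\<^sup>2"
        using L by (intro mult_left_mono) auto
      also have "\<dots> = 2 * Q\<^sup>2 * (level_mean k d)\<^sup>2 / (2 ^ k * 2 ^ k)"
        by (simp add: m power2_eq_square power4_eq_xxxx field_simps)
      also have "\<dots> \<le> 2 * Q\<^sup>2 * (level_mean k d)\<^sup>2 / 2 ^ k"
        by (intro divide_left_mono) (auto simp: mult_le_cancel_left1)
      finally show ?thesis .
    qed
    show "expectation (\<lambda>\<omega>. (?S \<omega> - L * (h * u)\<^sup>2)\<^sup>2) \<le> (9 + 2 * Q\<^sup>2) * (level_mean k d)\<^sup>2 / 2 ^ k"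
      using dev 1 2 by (simp add: distrib_right add_divide_distrib)
  qed
  finally show ?thesis .
qed

text \<open>The weight \<open>(625 / 256) ^ d\<close> makes the expectations summable over \<open>d\<close>. Its square root \<open>(25 / 16) ^ d\<close> is
still beaten by the decay \<open>1 / 2 ^ d\<close> of \<open>level_mean k d\<close>.\<close>

definition level_excess :: "nat \<Rightarrow> nat \<Rightarrow> 'w \<Rightarrow> ennreal" where
  "level_excess k d \<omega> = (SUP N. ennreal ((max 0 (level_norm k d N \<omega> - level_mean k d))\<^sup>2
      * (1 / ((level_mean k d)\<^sup>2 * (625 / 256) ^ d))))"

lemma level_excess_measurable: "level_excess k d \<in> borel_measurable M"
proof -
  have [measurable]: "level_norm k d N \<in> borel_measurable M" for N using level_norm_L2 by (simp add: L2_def)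
  show ?thesis unfolding level_excess_def[abs_def] by measurable
qed

lemma level_excess_integral:
  "(\<integral>\<^sup>+\<omega>. level_excess k d \<omega> \<partial>M) \<le> ennreal ((9 + 2 * Q\<^sup>2) * (1 / 2) ^ k * (256 / 625) ^ d)"
proof -
  define r where "r = 1 / ((level_mean k d)\<^sup>2 * (625 / 256) ^ d)"
  have r: "0 < r" using level_mean_pos[of k d] by (simp add: r_def)
  have [measurable]: "level_norm k d N \<in> borel_measurable M" for N using level_norm_L2 by (simp add: L2_def)
  have "(\<integral>\<^sup>+\<omega>. level_excess k d \<omega> \<partial>M) =
    (SUP N. \<integral>\<^sup>+\<omega>. ennreal ((max 0 (level_norm k d N \<omega> - level_mean k d))\<^sup>2 * r) \<partial>M)"
    unfolding level_excess_def r_def[symmetric]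
  proof (rule nn_integral_monotone_convergence_SUP)
    show "incseq (\<lambda>N \<omega>. ennreal ((max 0 (level_norm k d N \<omega> - level_mean k d))\<^sup>2 * r))"
      using r by (intro incseq_SucI le_funI ennreal_leI mult_right_mono power_mono max.mono diff_mono
          level_norm_mono order_refl) auto
  qed measurable
  also have "\<dots> \<le> ennreal ((9 + 2 * Q\<^sup>2) * (1 / 2) ^ k * (256 / 625) ^ d)"
  proof (rule SUP_least)
    fix N
    have "(\<integral>\<^sup>+\<omega>. ennreal ((max 0 (level_norm k d N \<omega> - level_mean k d))\<^sup>2 * r) \<partial>M)
      = (\<integral>\<^sup>+\<omega>. ennreal ((max 0 (level_norm k d N \<omega> - level_mean k d))\<^sup>2) \<partial>M) * ennreal r"
      using r by (simp add: ennreal_mult nn_integral_multc)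
    also have "\<dots> \<le> ennreal ((9 + 2 * Q\<^sup>2) * (level_mean k d)\<^sup>2 / 2 ^ k) * ennreal r"
      by (rule mult_right_mono[OF level_norm_excess]) simp
    also have "\<dots> = ennreal ((9 + 2 * Q\<^sup>2) * (level_mean k d)\<^sup>2 / 2 ^ k * r)"
      using r by (intro ennreal_mult''[symmetric]) simp
    also have "(9 + 2 * Q\<^sup>2) * (level_mean k d)\<^sup>2 / 2 ^ k * r = (9 + 2 * Q\<^sup>2) * (1 / 2) ^ k * (256 / 625) ^ d"
      using level_mean_pos[of k d] by (simp add: r_def power_divide field_simps)
    finally show "(\<integral>\<^sup>+\<omega>. ennreal ((max 0 (level_norm k d N \<omega> - level_mean k d))\<^sup>2 * r) \<partial>M)
      \<le> ennreal ((9 + 2 * Q\<^sup>2) * (1 / 2) ^ k * (256 / 625) ^ d)" .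
  qed
  finally show ?thesis .
qed

text \<open>The expected total excess over all levels is finite, so almost surely the total excess is finite and
bounds each single one.\<close>

lemma level_norm_bound:
  "AE \<omega> in M. \<exists>L\<ge>0. \<forall>k d N. level_norm k d N \<omega> \<le> L * level_mean k d * (25 / 16) ^ d"
proof -
  note [measurable] = level_excess_measurable
  let ?q = "9 + 2 * Q\<^sup>2"
  have q: "0 \<le> ?q" by simp
  have "(\<integral>\<^sup>+\<omega>. (\<Sum>k. \<Sum>d. level_excess k d \<omega>) \<partial>M) = (\<Sum>k. \<Sum>d. \<integral>\<^sup>+\<omega>. level_excess k d \<omega> \<partial>M)"
    by (simp add: nn_integral_suminf)
  also have "\<dots> \<le> (\<Sum>k. \<Sum>d. ennreal (?q * (1 / 2) ^ k * (256 / 625) ^ d))"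
    by (intro suminf_le level_excess_integral) auto
  also have "\<dots> = (\<Sum>k. ennreal (?q * (1 / 2) ^ k * (1 / (1 - 256 / 625))))"
  proof (intro arg_cong[where f = suminf] ext)
    fix k
    have "(\<lambda>d. ?q * (1 / 2) ^ k * (256 / 625) ^ d) sums (?q * (1 / 2) ^ k * (1 / (1 - 256 / 625)))"
      by (intro sums_mult geometric_sums) simp
    then show "(\<Sum>d. ennreal (?q * (1 / 2) ^ k * (256 / 625) ^ d)) = ennreal (?q * (1 / 2) ^ k * (1 / (1 - 256 / 625)))"
      using q by (intro sums_unique[symmetric]) (subst sums_ennreal; simp)
  qed
  also have "\<dots> = ennreal (?q * (1 / (1 - 1 / 2)) * (1 / (1 - 256 / 625)))"
  proof -
    have "(\<lambda>k. ?q * (1 / 2) ^ k * (1 / (1 - 256 / 625))) sums (?q * (1 / (1 - 1 / 2)) * (1 / (1 - 256 / 625)))"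
      by (intro sums_mult sums_mult2 geometric_sums) simp
    then show ?thesis using q by (intro sums_unique[symmetric]) (subst sums_ennreal; simp)
  qed
  also have "\<dots> < \<infinity>" by simp
  finally have fin: "(\<integral>\<^sup>+\<omega>. (\<Sum>k. \<Sum>d. level_excess k d \<omega>) \<partial>M) \<noteq> \<infinity>" by simp
  have "AE \<omega> in M. (\<Sum>k. \<Sum>d. level_excess k d \<omega>) \<noteq> \<infinity>"
    by (rule nn_integral_PInf_AE[OF _ fin]) measurable
  then show ?thesis
  proof eventually_elim
    fix \<omega> assume \<omega>: "(\<Sum>k. \<Sum>d. level_excess k d \<omega>) \<noteq> \<infinity>"
    define Z where "Z = (\<Sum>k. \<Sum>d. level_excess k d \<omega>)"
    have le: "level_excess k d \<omega> \<le> Z" for k d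
    proof -
      have "level_excess k d \<omega> \<le> (\<Sum>d. level_excess k d \<omega>)"
        using sum_le_suminf[of "\<lambda>d. level_excess k d \<omega>" "{d}"] by simp
      also have "\<dots> \<le> Z" unfolding Z_def
        using sum_le_suminf[of "\<lambda>k. \<Sum>d. level_excess k d \<omega>" "{k}"] by simp
      finally show ?thesis .
    qed
    define z where "z = enn2real Z"
    have z: "Z = ennreal z" "0 \<le> z" using \<omega> by (auto simp: z_def Z_def less_top)
    show "\<exists>L\<ge>0. \<forall>k d N. level_norm k d N \<omega> \<le> L * level_mean k d * (25 / 16) ^ d"
    proof (intro exI[of _ "1 + sqrt z"] conjI allI)
      show "0 \<le> 1 + sqrt z" using z by simp
      fix k d N
      let ?m = "level_mean k d" and ?x = "max 0 (level_norm k d N \<omega> - level_mean k d)"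
      note m = level_mean_pos[of k d]
      have "ennreal (?x\<^sup>2 * (1 / (?m\<^sup>2 * (625 / 256) ^ d))) \<le> level_excess k d \<omega>"
        unfolding level_excess_def by (rule SUP_upper) simp
      also have "\<dots> \<le> ennreal z" using le z by simp
      finally have "?x\<^sup>2 * (1 / (?m\<^sup>2 * (625 / 256) ^ d)) \<le> z" using z by simp
      then have "?x\<^sup>2 \<le> z * (?m\<^sup>2 * (625 / 256) ^ d)" using m by (simp add: field_simps)
      also have "\<dots> = (sqrt z * ?m * (25 / 16) ^ d)\<^sup>2"
      proof -
        have "((25 / 16) ^ d)\<^sup>2 = ((25 / 16)\<^sup>2 :: real) ^ d" by (simp only: power_mult[symmetric] mult.commute)
        then have "((25 / 16) ^ d)\<^sup>2 = (625 / 256 :: real) ^ d" by (simp add: power2_eq_square)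
        then show ?thesis using z by (simp add: power_mult_distrib)
      qed
      finally have "?x \<le> sqrt z * ?m * (25 / 16) ^ d"
        by (rule power2_le_imp_le) (use z m in auto)
      moreover have "?m * 1 \<le> ?m * (25 / 16) ^ d" using m by (intro mult_left_mono) auto
      ultimately show "level_norm k d N \<omega> \<le> (1 + sqrt z) * ?m * (25 / 16) ^ d"
        by (simp add: algebra_simps)
    qed
  qed
qed

text \<open>The remainder at level \<open>k\<close> is the sum of the differences of consecutive levels. Their norms decay
geometrically, since \<open>25 / 32 \<le> (25 / 28)\<^sup>2\<close>, and add up by the triangle inequality.\<close>

lemma dyadic_remainder_bound:
  assumes L: "0 \<le> L" "\<And>k d N. level_norm k d N \<omega> \<le> L * level_mean k d * (25 / 16) ^ d"
    and lim: "\<And>i j. 1 \<le> i \<Longrightarrow> 1 \<le> j \<Longrightarrow> (\<lambda>K. dyadic_integral t K \<omega> (e j) \<bullet> e i) \<longlonglongrightarrow> I (e j) \<bullet> e i"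
  shows "(\<Sum>(i, j)\<in>{2 ^ k<..N} \<times> {2 ^ k<..N}. ((I (e j) - dyadic_integral t k \<omega> (e j)) \<bullet> e i)\<^sup>2)
    \<le> 100 * L * t\<^sup>2 * (a k)\<^sup>2 / 2 ^ k"
proof -
  let ?P = "{2 ^ k<..N} \<times> {2 ^ k<..N}"
  let ?D = "\<lambda>K p. dyadic_integral t K \<omega> (e (snd p)) \<bullet> e (fst p)"
  define y where "y = sqrt (L * t\<^sup>2 * (a k)\<^sup>2 / 2 ^ k)"
  have y: "0 \<le> y" "y\<^sup>2 = L * t\<^sup>2 * (a k)\<^sup>2 / 2 ^ k" using L(1) by (auto simp: y_def)
  have lev: "L2_set (\<lambda>p. ?D (Suc (k + d)) p - ?D (k + d) p) ?P \<le> y * (25 / 28) ^ d" for d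
  proof -
    have "(L2_set (\<lambda>p. ?D (Suc (k + d)) p - ?D (k + d) p) ?P)\<^sup>2 = level_norm k d N \<omega>"
      by (simp add: L2_set_def sum_nonneg level_norm_eq split_beta inner_diff_left)
    also have "\<dots> \<le> L * level_mean k d * (25 / 16) ^ d" by (rule L(2))
    also have "\<dots> = y\<^sup>2 * ((1 / 4) * ((1 / 2) * (25 / 16)) ^ d)"
      by (simp only: y level_mean_def power_add power_mult_distrib power_divide) (simp add: field_simps)
    also have "\<dots> \<le> y\<^sup>2 * (1 * ((25 / 28)\<^sup>2) ^ d)"
      by (intro mult_left_mono mult_mono power_mono) (auto simp: power2_eq_square)
    also have "\<dots> = (y * (25 / 28) ^ d)\<^sup>2"
      by (simp only: power_mult_distrib mult_1 power_mult[symmetric] mult.commute[of 2 d])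
    finally show ?thesis by (rule power2_le_imp_le) (use y in auto)
  qed
  have part: "L2_set (\<lambda>p. ?D (k + K) p - ?D k p) ?P \<le> 10 * y" for K
  proof -
    have "(\<lambda>p. ?D (k + K) p - ?D k p) = (\<lambda>p. \<Sum>d<K. ?D (Suc (k + d)) p - ?D (k + d) p)"
      using sum_lessThan_telescope[of "\<lambda>d. ?D (k + d) p" K for p] by (auto simp: fun_eq_iff)
    then have "L2_set (\<lambda>p. ?D (k + K) p - ?D k p) ?P \<le> (\<Sum>d<K. L2_set (\<lambda>p. ?D (Suc (k + d)) p - ?D (k + d) p) ?P)"
      using L2_set_sum_le[of "\<lambda>d p. ?D (Suc (k + d)) p - ?D (k + d) p" "{..<K}" ?P] by simp
    also have "\<dots> \<le> (\<Sum>d<K. y * (25 / 28) ^ d)" by (intro sum_mono lev)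
    also have "\<dots> = y * (\<Sum>d<K. (25 / 28) ^ d)" by (simp add: sum_distrib_left)
    also have "\<dots> \<le> y * 10"
    proof (intro mult_left_mono y)
      have "(\<Sum>d<K. (25 / 28 :: real) ^ d) \<le> (\<Sum>d. (25 / 28 :: real) ^ d)"
        by (intro sum_le_suminf summable_geometric) auto
      also have "\<dots> = 1 / (1 - 25 / 28)" by (intro suminf_geometric) simp
      finally show "(\<Sum>d<K. (25 / 28 :: real) ^ d) \<le> 10" by simp
    qed
    finally show ?thesis by simp
  qed
  have "(\<lambda>K. L2_set (\<lambda>p. ?D (k + K) p - ?D k p) ?P) \<longlonglongrightarrow> L2_set (\<lambda>p. I (e (snd p)) \<bullet> e (fst p) - ?D k p) ?P"
    unfolding L2_set_def
  proof (intro tendsto_real_sqrt tendsto_sum tendsto_power tendsto_diff tendsto_const)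
    fix p assume p: "p \<in> ?P"
    have "(\<lambda>K. ?D K p) \<longlonglongrightarrow> I (e (snd p)) \<bullet> e (fst p)" using p by (intro lim) auto
    then have "(\<lambda>K. ?D (K + k) p) \<longlonglongrightarrow> I (e (snd p)) \<bullet> e (fst p)" by (rule LIMSEQ_ignore_initial_segment)
    then show "(\<lambda>K. ?D (k + K) p) \<longlonglongrightarrow> I (e (snd p)) \<bullet> e (fst p)" by (simp add: add.commute)
  qed
  then have "L2_set (\<lambda>p. I (e (snd p)) \<bullet> e (fst p) - ?D k p) ?P \<le> 10 * y"
    by (rule LIMSEQ_le_const2) (use part in auto)
  then have "(L2_set (\<lambda>p. I (e (snd p)) \<bullet> e (fst p) - ?D k p) ?P)\<^sup>2 \<le> (10 * y)\<^sup>2"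
    by (intro power_mono L2_set_nonneg)
  then show ?thesis
    by (simp add: L2_set_def sum_nonneg split_beta inner_diff_left power_mult_distrib y)
qed


lemma dyadic_integral_measurable:
  assumes "0 \<le> s"
  shows "(\<lambda>\<omega>. dyadic_integral s k \<omega> x \<bullet> y) \<in> borel_measurable M"
proof -
  have [measurable]: "B (grid s k l) \<in> borel_measurable M" for l
    by (rule B_measurable) (rule grid_nonneg[OF assms])
  show ?thesis unfolding dyadic_integral_def elementary_integral_entry incr_def by measurable
qed

lemma ito_error_measurable:
  assumes I: "ito_tensor_integral M B t B I"
  shows "(\<lambda>\<omega>. (I \<omega> x - dyadic_integral t k \<omega> x) \<bullet> y) \<in> borel_measurable M"
proof -
  have "(\<lambda>\<omega>. I \<omega> x) \<in> borel_measurable M" using I unfolding ito_tensor_integral_def by blast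
  then show ?thesis using dyadic_integral_measurable[of t k x y] t by (simp add: inner_diff_left)
qed

lemma dyadic_integral_tendsto:
  assumes I: "ito_tensor_integral M B t B I"
  shows "AE \<omega> in M. (\<lambda>k. dyadic_integral t k \<omega> x \<bullet> y) \<longlonglongrightarrow> I \<omega> x \<bullet> y"
proof -
  let ?r = "\<lambda>k \<omega>. (I \<omega> x - dyadic_integral t k \<omega> x) \<bullet> y"
  let ?q = "4 * t\<^sup>2 * (C x \<bullet> x) * (C y \<bullet> y)"
  have q: "0 \<le> ?q" using C_nonneg by simp
  note [measurable] = ito_error_measurable[OF I]
  have "(\<integral>\<^sup>+\<omega>. (\<Sum>k. ennreal ((?r k \<omega>)\<^sup>2)) \<partial>M) = (\<Sum>k. \<integral>\<^sup>+\<omega>. ennreal ((?r k \<omega>)\<^sup>2) \<partial>M)"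
    by (rule nn_integral_suminf) measurable
  also have "\<dots> \<le> (\<Sum>k. ennreal (?q * (1 / 2) ^ k))"
    using ito_dyadic_error[OF _ I, of x _ y] t by (intro suminf_le) (auto simp: power_divide)
  also have "\<dots> = ennreal (?q * (1 / (1 - 1 / 2)))"
  proof -
    have "(\<lambda>k. ?q * (1 / 2) ^ k) sums (?q * (1 / (1 - 1 / 2)))" by (intro sums_mult geometric_sums) simp
    then show ?thesis using q by (intro sums_unique[symmetric]) (subst sums_ennreal; simp)
  qed
  also have "\<dots> < \<infinity>" by simp
  finally have "(\<integral>\<^sup>+\<omega>. (\<Sum>k. ennreal ((?r k \<omega>)\<^sup>2)) \<partial>M) \<noteq> \<infinity>" by simp
  then have "AE \<omega> in M. (\<Sum>k. ennreal ((?r k \<omega>)\<^sup>2)) \<noteq> \<infinity>"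
    by (intro nn_integral_PInf_AE) measurable
  then show ?thesis
  proof eventually_elim
    fix \<omega> assume "(\<Sum>k. ennreal ((?r k \<omega>)\<^sup>2)) \<noteq> \<infinity>"
    then have "summable (\<lambda>k. (?r k \<omega>)\<^sup>2)" by (intro summable_suminf_not_top) auto
    then have "(\<lambda>k. (?r k \<omega>)\<^sup>2) \<longlonglongrightarrow> 0" by (rule summable_LIMSEQ_zero)
    then have "(\<lambda>k. sqrt ((?r k \<omega>)\<^sup>2)) \<longlonglongrightarrow> sqrt 0" by (rule tendsto_real_sqrt)
    then have "(\<lambda>k. ?r k \<omega>) \<longlonglongrightarrow> 0" by (simp add: tendsto_rabs_zero_iff)
    then have "(\<lambda>k. I \<omega> x \<bullet> y - ?r k \<omega>) \<longlonglongrightarrow> I \<omega> x \<bullet> y - 0" by (intro tendsto_diff tendsto_const)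
    then show "(\<lambda>k. dyadic_integral t k \<omega> x \<bullet> y) \<longlonglongrightarrow> I \<omega> x \<bullet> y" by (simp add: inner_diff_left)
  qed
qed

text \<open>In a degenerate direction already the crudest Riemann sum has no error, and it vanishes because \<open>B 0 = 0\<close>.\<close>

lemma ito_degenerate:
  assumes I: "ito_tensor_integral M B t B I" and deg: "C x \<bullet> x = 0 \<or> C y \<bullet> y = 0"
  shows "AE \<omega> in M. I \<omega> x \<bullet> y = 0"
proof -
  let ?r = "\<lambda>\<omega>. (I \<omega> x - dyadic_integral t 0 \<omega> x) \<bullet> y"
  note [measurable] = ito_error_measurable[OF I]
  have "(\<integral>\<^sup>+\<omega>. ennreal ((?r \<omega>)\<^sup>2) \<partial>M) \<le> 0"
    using ito_dyadic_error[OF _ I, of x 0 y] t deg by auto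
  then have "AE \<omega> in M. ennreal ((?r \<omega>)\<^sup>2) = 0"
    by (subst (asm) le_zero_eq) (subst (asm) nn_integral_0_iff_AE, auto)
  then show ?thesis using B_zero
    by eventually_elim (simp add: inner_diff_left dyadic_integral_def elementary_integral_entry grid_def)
qed

lemma B_degenerate:
  assumes "0 \<le> s" and deg: "C x \<bullet> x = 0"
  shows "AE \<omega> in M. B s \<omega> \<bullet> x = 0"
proof -
  have L: "L2 (incr 0 s x)" by (rule L4_L2, rule incr_L4) (use assms in auto)
  have "expectation (\<lambda>\<omega>. (incr 0 s x \<omega>)\<^sup>2) = 0" using assms by (subst incr_square) auto
  then have "AE \<omega> in M. (incr 0 s x \<omega>)\<^sup>2 = 0"
    using L by (subst (asm) integral_nonneg_eq_0_iff_AE) (auto simp: L2_def)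
  then show ?thesis using B_zero by eventually_elim (simp add: incr_def)
qed

lemma countable_dense_subset:
  fixes S :: "'a set"
  obtains D where "countable D" "D \<subseteq> S" "S \<subseteq> closure D"
  using separable[of S] by metis

text \<open>Almost surely, each path satisfies the remainder estimates at all levels, and the Brownian motion and
its integral live on the closed span of the eigenvectors. The exceptional sets are collected over
countable dense sets of directions.\<close>

lemma ito_path_properties:
  assumes I: "ito_tensor_integral M B t B I"
    and ker: "\<And>x. (\<And>i. 1 \<le> i \<Longrightarrow> x \<bullet> e i = 0) \<Longrightarrow> C x = 0"
  shows "AE \<omega> in M.
    (\<exists>L\<ge>0. \<forall>k N. (\<Sum>(i, j)\<in>{2 ^ k<..N} \<times> {2 ^ k<..N}.
        ((I \<omega> (e j) - dyadic_integral t k \<omega> (e j)) \<bullet> e i)\<^sup>2) \<le> L * (a k)\<^sup>2 / 2 ^ k) \<and>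
    (\<forall>x. (\<forall>i\<ge>1. x \<bullet> e i = 0) \<longrightarrow> (\<forall>y. I \<omega> x \<bullet> y = 0 \<and> I \<omega> y \<bullet> x = 0) \<and> (\<forall>k l. B (grid t k l) \<omega> \<bullet> x = 0))"
proof -
  let ?E = "{x. \<forall>i\<ge>1. x \<bullet> e i = 0}"
  obtain D where D: "countable D" "D \<subseteq> ?E" "?E \<subseteq> closure D" by (rule countable_dense_subset)
  obtain U :: "'a set" where U: "countable U" "U \<subseteq> UNIV" "UNIV \<subseteq> closure U" by (rule countable_dense_subset)
  have C0: "C x \<bullet> x = 0" if "x \<in> D" for x using D(2) ker that by auto
  have 1: "AE \<omega> in M. \<forall>x\<in>D. \<forall>y\<in>U. I \<omega> x \<bullet> y = 0 \<and> I \<omega> y \<bullet> x = 0"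
    using ito_degenerate[OF I] C0 by (intro AE_ball_countable'[OF _ D(1)] AE_ball_countable'[OF _ U(1)]) auto
  have 2: "AE \<omega> in M. \<forall>x\<in>D. \<forall>k l. B (grid t k l) \<omega> \<bullet> x = 0"
    using B_degenerate[OF grid_nonneg] t C0 by (intro AE_ball_countable'[OF _ D(1)]) (auto simp: AE_all_countable)
  have 3: "AE \<omega> in M. \<forall>i j. (\<lambda>K. dyadic_integral t K \<omega> (e j) \<bullet> e i) \<longlonglongrightarrow> I \<omega> (e j) \<bullet> e i"
    using dyadic_integral_tendsto[OF I] by (simp add: AE_all_countable)
  show ?thesis using 1 2 3 level_norm_bound
  proof eventually_elim
    fix \<omega>
    assume IU: "\<forall>x\<in>D. \<forall>y\<in>U. I \<omega> x \<bullet> y = 0 \<and> I \<omega> y \<bullet> x = 0"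
      and BD: "\<forall>x\<in>D. \<forall>k l. B (grid t k l) \<omega> \<bullet> x = 0"
      and lim: "\<forall>i j. (\<lambda>K. dyadic_integral t K \<omega> (e j) \<bullet> e i) \<longlonglongrightarrow> I \<omega> (e j) \<bullet> e i"
      and "\<exists>L\<ge>0. \<forall>k d N. level_norm k d N \<omega> \<le> L * level_mean k d * (25 / 16) ^ d"
    then obtain L where L: "0 \<le> L" "\<And>k d N. level_norm k d N \<omega> \<le> L * level_mean k d * (25 / 16) ^ d" by blast
    have rem: "(\<Sum>(i, j)\<in>{2 ^ k<..N} \<times> {2 ^ k<..N}. ((I \<omega> (e j) - dyadic_integral t k \<omega> (e j)) \<bullet> e i)\<^sup>2)
      \<le> (100 * L * t\<^sup>2) * (a k)\<^sup>2 / 2 ^ k" for k N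
      using dyadic_remainder_bound[OF L, of "I \<omega>" k N] lim by simp
    have IDy: "I \<omega> x \<bullet> y = 0 \<and> I \<omega> y \<bullet> x = 0" if x: "x \<in> D" for x y
    proof -
      have "closed {y. I \<omega> x \<bullet> y = 0 \<and> I \<omega> y \<bullet> x = 0}"
        by (intro closed_Collect_conj closed_Collect_eq continuous_intros)
      then have "closure U \<subseteq> {y. I \<omega> x \<bullet> y = 0 \<and> I \<omega> y \<bullet> x = 0}"
        using IU x by (intro closure_minimal) auto
      then show ?thesis using U(3) by auto
    qed
    have deg: "(\<forall>y. I \<omega> x \<bullet> y = 0 \<and> I \<omega> y \<bullet> x = 0) \<and> (\<forall>k l. B (grid t k l) \<omega> \<bullet> x = 0)" if x: "x \<in> ?E" for x
    proof -
      have "closed {x. (\<forall>y. I \<omega> x \<bullet> y = 0 \<and> I \<omega> y \<bullet> x = 0) \<and> (\<forall>k l. B (grid t k l) \<omega> \<bullet> x = 0)}"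
        by (intro closed_Collect_conj closed_Collect_all closed_Collect_eq continuous_intros)
      then have "closure D \<subseteq> {x. (\<forall>y. I \<omega> x \<bullet> y = 0 \<and> I \<omega> y \<bullet> x = 0) \<and> (\<forall>k l. B (grid t k l) \<omega> \<bullet> x = 0)}"
        using IDy BD by (intro closure_minimal) auto
      then show ?thesis using D(3) x by blast
    qed
    show "(\<exists>L\<ge>0. \<forall>k N. (\<Sum>(i, j)\<in>{2 ^ k<..N} \<times> {2 ^ k<..N}.
        ((I \<omega> (e j) - dyadic_integral t k \<omega> (e j)) \<bullet> e i)\<^sup>2) \<le> L * (a k)\<^sup>2 / 2 ^ k) \<and>
      (\<forall>x. (\<forall>i\<ge>1. x \<bullet> e i = 0) \<longrightarrow> (\<forall>y. I \<omega> x \<bullet> y = 0 \<and> I \<omega> y \<bullet> x = 0) \<and> (\<forall>k l. B (grid t k l) \<omega> \<bullet> x = 0))"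
      using rem L(1) deg by (intro conjI exI[of _ "100 * L * t\<^sup>2"]) auto
  qed
qed

end

end

section \<open>Singular values of the Levy area\<close>

text \<open>
For \<open>u \<le> 1\<close>, choose \<open>k\<close> with \<open>2 ^ k\<close> between \<open>u powr (- 1 / \<delta>)\<close> and twice that number. Then the number of
avoided directions and the variational term are both of the order \<open>u powr (- 1 / \<delta>)\<close>.\<close>

lemma
  fixes T :: "'a::{real_inner, banach} \<Rightarrow>\<^sub>L 'a"
  assumes \<delta>: "1 < \<delta>" and L: "0 \<le> L"
    and small: "\<And>k. \<exists>V. finite V \<and> card V \<le> 4 * 2 ^ k \<and>
      (\<forall>S. finite S \<longrightarrow> orthonormal S \<longrightarrow> (\<forall>x\<in>S. \<forall>w\<in>V. x \<bullet> w = 0) \<longrightarrow>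
        (\<Sum>x\<in>S. (norm (T x))\<^sup>2) \<le> L * (2 ^ k) powr (1 - 2 * \<delta>))"
  shows dyadic_decay_compact: "compact_operator T"
    and dyadic_decay_discrete: "discrete_spectrum T"
    and dyadic_decay_count: "0 < u \<Longrightarrow> u \<le> 1 \<Longrightarrow> real (eigen_count T u) \<le> (8 + L) * u powr (- 1 / \<delta>)"
proof -
  define \<eta> where "\<eta> k = L * (2 ^ k) powr (1 - 2 * \<delta>)" for k :: nat
  obtain V where V: "\<And>k. finite (V k)" "\<And>k. card (V k) \<le> 4 * 2 ^ k"
    "\<And>k S. finite S \<Longrightarrow> orthonormal S \<Longrightarrow> (\<And>x w. x \<in> S \<Longrightarrow> w \<in> V k \<Longrightarrow> x \<bullet> w = 0) \<Longrightarrow>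
        (\<Sum>x\<in>S. (norm (T x))\<^sup>2) \<le> \<eta> k"
    using small unfolding \<eta>_def by metis
  show "compact_operator T"
  proof (rule compact_operator_if_small_off_finite)
    fix \<epsilon> :: real assume \<epsilon>: "0 < \<epsilon>"
    have "(\<lambda>k. \<eta> k) \<longlonglongrightarrow> L * 0"
    proof (unfold \<eta>_def, intro tendsto_mult tendsto_const)
      show "(\<lambda>k. (2 ^ k) powr (1 - 2 * \<delta>)) \<longlonglongrightarrow> 0" using \<delta> by real_asymp
    qed
    then have "\<forall>\<^sub>F k in sequentially. \<eta> k < \<epsilon>\<^sup>2" by (rule order_tendstoD) (use \<epsilon> in simp)
    then obtain k where k: "\<eta> k < \<epsilon>\<^sup>2" by (auto simp: eventually_sequentially)
    show "\<exists>V. finite V \<and> (\<forall>x. (\<forall>v\<in>V. x \<bullet> v = 0) \<longrightarrow> norm (T x) \<le> \<epsilon> * norm x)"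
    proof (intro exI[of _ "V k"] conjI V(1) allI impI)
      fix x assume x: "\<forall>v\<in>V k. x \<bullet> v = 0"
      show "norm (T x) \<le> \<epsilon> * norm x"
      proof (cases "x = 0")
        case False
        define z where "z = x /\<^sub>R norm x"
        have z: "norm z = 1" "x = norm x *\<^sub>R z" using False by (auto simp: z_def)
        have "(\<Sum>x\<in>{z}. (norm (T x))\<^sup>2) \<le> \<eta> k"
        proof (rule V(3))
          show "orthonormal {z}" using z(1) by (simp add: orthonormal_family_def norm_eq_1)
        qed (use x in \<open>auto simp: z_def\<close>)
        then have "(norm (T z))\<^sup>2 \<le> \<epsilon>\<^sup>2" using k by simp
        then have "norm (T z) \<le> \<epsilon>" using \<epsilon> by (auto intro: power2_le_imp_le)
        then have "norm x * norm (T z) \<le> norm x * \<epsilon>" by (intro mult_left_mono) auto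
        moreover have "norm (T x) = norm x * norm (T z)" by (subst z(2)) (simp add: blinfun.scaleR_right)
        ultimately show ?thesis by (simp add: mult.commute)
      qed simp
    qed
  qed
  note cnt = eigen_count_le_avoiding[OF _ V(1) V(3)]
  show "discrete_spectrum T" unfolding discrete_spectrum_def using cnt(1) by blast
  show "real (eigen_count T u) \<le> (8 + L) * u powr (- 1 / \<delta>)" if u: "0 < u" "u \<le> 1"
  proof -
    define w where "w = u powr (- 1 / \<delta>)"
    have w: "1 \<le> w" using u \<delta> powr_mono2'[of "- 1 / \<delta>" u 1] by (simp add: w_def)
    define k where "k = nat \<lceil>log 2 w\<rceil>"
    have l: "0 \<le> log 2 w" using w by simp
    have "log 2 w \<le> real k" "real k < log 2 w + 1"
      using l ceiling_correct[of "log 2 w"] by (auto simp: k_def)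
    then have "2 powr log 2 w \<le> 2 powr real k" "2 powr real k \<le> 2 powr (log 2 w + 1)"
      by (auto intro: powr_mono)
    then have k: "w \<le> 2 ^ k" "2 ^ k \<le> 2 * w" using w by (auto simp: powr_add powr_realpow)
    have "real (eigen_count T u) \<le> real (card (V k)) + \<eta> k / u\<^sup>2" by (rule cnt(2)[OF u(1)])
    also have "real (card (V k)) \<le> 4 * 2 ^ k" using V(2)[of k] by (simp flip: of_nat_le_iff[where 'a = real])
    also have "4 * 2 ^ k \<le> 8 * w" using k by simp
    also have "\<eta> k / u\<^sup>2 \<le> L * w"
    proof -
      have "(2 ^ k) powr (1 - 2 * \<delta>) \<le> w powr (1 - 2 * \<delta>)"
        using k w \<delta> by (intro powr_mono2') auto
      also have "w powr (1 - 2 * \<delta>) = w * u\<^sup>2"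
      proof -
        have exponent: "(- 1 / \<delta>) * (1 - 2 * \<delta>) = - 1 / \<delta> + 2" using \<delta> by (simp add: field_simps)
        have "w powr (1 - 2 * \<delta>) = u powr (- 1 / \<delta> + 2)" by (simp only: w_def powr_powr exponent)
        also have "\<dots> = w * u\<^sup>2" unfolding powr_add w_def using u by simp
        finally show ?thesis .
      qed
      finally have "\<eta> k \<le> L * (w * u\<^sup>2)" unfolding \<eta>_def using L by (rule mult_left_mono)
      then show ?thesis using u by (simp add: field_simps)
    qed
    finally show ?thesis by (simp add: w_def distrib_right)
  qed
qed

text \<open>Only finitely many singular values exceed one. For the others the bound on the count can be inverted.\<close>

lemma weak_schatten_of_count:
  fixes T :: "'a::real_inner \<Rightarrow>\<^sub>L 'a"
  assumes \<delta>: "0 < \<delta>" and T: "compact_operator T" "discrete_spectrum T" and G: "0 < G"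
    and count: "\<And>u. 0 < u \<Longrightarrow> u \<le> 1 \<Longrightarrow> real (eigen_count T u) \<le> G * u powr (- 1 / \<delta>)"
  shows "T \<in> weak_schatten (1 / \<delta>)"
proof -
  note iff = singular_value_greater_iff[OF T(2)]
  define n1 where "n1 = eigen_count T 1"
  have nn: "0 \<le> singular_value T n" if "1 \<le> n" for n by (rule singular_value_nonneg[OF T(2) that])
  have dec: "singular_value T n \<le> singular_value T 1" if n: "1 \<le> n" for n
  proof (rule ccontr)
    assume less: "\<not> ?thesis"
    define r where "r = (singular_value T n + singular_value T 1) / 2"
    have r: "0 < r" "r < singular_value T n" "\<not> r < singular_value T 1" using less nn[of 1] by (auto simp: r_def)
    then show False using iff[OF n, of r] iff[of 1 r] n by auto
  qed
  have "real n powr \<delta> * singular_value T n \<le> max (G powr \<delta>) (real n1 powr \<delta> * singular_value T 1)" if n: "1 \<le> n" for n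
  proof (cases "n \<le> n1")
    case True
    have "real n powr \<delta> * singular_value T n \<le> real n1 powr \<delta> * singular_value T 1"
      using True n \<delta> dec[OF n] nn[OF n] by (intro mult_mono powr_mono2) auto
    then show ?thesis by simp
  next
    case False
    then have le1: "singular_value T n \<le> 1" using iff[OF n, of 1] by (auto simp: n1_def)
    have "singular_value T n \<le> (G / real n) powr \<delta>"
    proof (rule ccontr)
      assume "\<not> ?thesis"
      then have less: "(G / real n) powr \<delta> < singular_value T n" by simp
      define u where "u = ((G / real n) powr \<delta> + singular_value T n) / 2"
      have pos: "0 < (G / real n) powr \<delta>" using G n by simp
      have "x < (x + y) / 2 \<and> (x + y) / 2 < y \<and> 0 < (x + y) / 2 \<and> (x + y) / 2 \<le> 1"
        if "x < y" "y \<le> 1" "0 < x" for x y :: real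
        using that by auto
      from this[OF less le1 pos]
      have "(G / real n) powr \<delta> < u \<and> u < singular_value T n \<and> 0 < u \<and> u \<le> 1" unfolding u_def .
      then have u: "(G / real n) powr \<delta> < u" "u < singular_value T n" "0 < u" "u \<le> 1" by auto
      have "real n \<le> G * u powr (- 1 / \<delta>)" using count[OF u(3,4)] iff[OF n u(3)] u(2) by auto
      also have "\<dots> < G * ((G / real n) powr \<delta>) powr (- 1 / \<delta>)"
        using G \<delta> u(1) pos by (intro mult_strict_left_mono powr_less_mono2_neg) auto
      also have "\<dots> = real n" using G n \<delta> by (simp add: powr_powr powr_minus_divide)
      finally show False by simp
    qed
    then have "real n powr \<delta> * singular_value T n \<le> real n powr \<delta> * (G / real n) powr \<delta>"
      by (intro mult_left_mono) auto
    also have "\<dots> = G powr \<delta>" using G n by (simp add: powr_divide)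
    finally show ?thesis by simp
  qed
  then show ?thesis
    unfolding weak_schatten_def using T(1) by (auto intro!: bdd_aboveI2)
qed

lemma powr_square_divide:
  fixes x a :: real
  assumes "0 < x"
  shows "(x powr (1 - a))\<^sup>2 / x = x powr (1 - 2 * a)"
proof -
  have "x powr (1 - 2 * a) = x powr ((1 - a) + (1 - a) - 1)" by simp
  also have "\<dots> = (x powr (1 - a))\<^sup>2 / x"
    unfolding powr_diff[of x "(1 - a) + (1 - a)"] powr_add power2_eq_square using assms by simp
  finally show ?thesis by simp
qed

text \<open>The hypotheses on the eigenvalues in the section on dyadic remainders hold with \<open>a k\<close> a multiple of
\<open>(2 ^ k) powr (1 - \<delta>)\<close>. Positivity holds from the first index on because the sequence is non-increasing.\<close>

lemma decay_constants:
  fixes c :: "nat \<Rightarrow> real"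
  assumes b: "0 < b" and \<delta>: "1 < \<delta>" and c: "c \<sim>[at_top] (\<lambda>j. b * real j powr (- \<delta>))"
    and mono: "\<And>i. 1 \<le> i \<Longrightarrow> c (Suc i) \<le> c i"
  shows "1 \<le> j \<Longrightarrow> 0 < c j"
    and "\<exists>K>0. \<forall>k N. (\<Sum>i\<in>{2 ^ k<..N}. c i) \<le> K * (2 ^ k) powr (1 - \<delta>) \<and>
      (\<Sum>i\<in>{2 ^ k<..N}. (c i)\<^sup>2) \<le> (\<delta> - 1)\<^sup>2 * (K * (2 ^ k) powr (1 - \<delta>))\<^sup>2 / 2 ^ k"
proof -
  have lim: "(\<lambda>j. c j / (b * real j powr (- \<delta>))) \<longlonglongrightarrow> 1"
    using b eventually_gt_at_top[of 0] by (intro asymp_equiv_ratio[OF c]) (auto elim!: eventually_mono)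
  show pos: "0 < c j" if j: "1 \<le> j" for j
  proof -
    have "\<forall>\<^sub>F n in sequentially. 0 < c n / (b * real n powr (- \<delta>))"
      using lim by (rule order_tendstoD) simp
    then obtain n0 where n0: "\<And>n. n0 \<le> n \<Longrightarrow> 0 < c n / (b * real n powr (- \<delta>))"
      by (auto simp: eventually_sequentially)
    \<comment> \<open>A later index at which the asymptotics give positivity.\<close>
    define n where "n = max j n0"
    have n: "j \<le> n" "n0 \<le> n" by (auto simp: n_def)
    have "0 < b * real n powr (- \<delta>)" using n(1) j b by simp
    then have "0 < c n" using n0[OF n(2)] by (simp add: zero_less_divide_iff)
    moreover have "c n \<le> c j" using n(1)
    proof (induction rule: dec_induct)
      case (step m)
      with mono[of m] j show ?case by simp
    qed simp
    ultimately show ?thesis by simp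
  qed
  obtain r where r: "\<And>j. \<bar>c j / (b * real j powr (- \<delta>))\<bar> \<le> r"
    using convergent_imp_Bseq[OF convergentI[OF lim]] by (auto simp: Bseq_def)
  define R where "R = max 1 r * b"
  have R: "0 < R" using b by (simp add: R_def)
  have cR: "c j \<le> R * real j powr (- \<delta>)" if "1 \<le> j" for j
  proof -
    have "c j / (b * real j powr (- \<delta>)) \<le> max 1 r" using abs_le_D1[OF r[of j]] by simp
    then show ?thesis using that b by (simp add: R_def pos_divide_le_eq mult.assoc)
  qed
  have one: "1 \<le> (2::nat) ^ k" for k by simp
  have ge: "1 \<le> i" if "i \<in> {2 ^ k<..N}" for i k N :: nat using that one[of k] by auto
  show "\<exists>K>0. \<forall>k N. (\<Sum>i\<in>{2 ^ k<..N}. c i) \<le> K * (2 ^ k) powr (1 - \<delta>) \<and>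
      (\<Sum>i\<in>{2 ^ k<..N}. (c i)\<^sup>2) \<le> (\<delta> - 1)\<^sup>2 * (K * (2 ^ k) powr (1 - \<delta>))\<^sup>2 / 2 ^ k"
  proof (intro exI[of _ "R / (\<delta> - 1)"] conjI allI)
    show "0 < R / (\<delta> - 1)" using R \<delta> by simp
    fix k N :: nat
    have "(\<Sum>i\<in>{2 ^ k<..N}. c i) \<le> (\<Sum>i\<in>{2 ^ k<..N}. R * real i powr (- \<delta>))"
      by (intro sum_mono cR ge)
    also have "\<dots> \<le> R * (real (2 ^ k) powr (1 - \<delta>) / (\<delta> - 1))"
      unfolding sum_distrib_left[symmetric] using R by (intro mult_left_mono powr_tail_sum \<delta> one) auto
    finally show "(\<Sum>i\<in>{2 ^ k<..N}. c i) \<le> R / (\<delta> - 1) * (2 ^ k) powr (1 - \<delta>)" by simp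
    have "(\<Sum>i\<in>{2 ^ k<..N}. (c i)\<^sup>2) \<le> (\<Sum>i\<in>{2 ^ k<..N}. R\<^sup>2 * real i powr (- (2 * \<delta>)))"
    proof (intro sum_mono)
      fix i assume i: "i \<in> {2 ^ k<..N}"
      have "(c i)\<^sup>2 \<le> (R * real i powr (- \<delta>))\<^sup>2"
        using cR[OF ge[OF i]] pos[OF ge[OF i]] by (intro power_mono) auto
      also have "\<dots> = R\<^sup>2 * real i powr (- (2 * \<delta>))"
        by (simp add: power_mult_distrib power2_eq_square flip: powr_add)
      finally show "(c i)\<^sup>2 \<le> R\<^sup>2 * real i powr (- (2 * \<delta>))" .
    qed
    also have "\<dots> \<le> R\<^sup>2 * (real (2 ^ k) powr (1 - 2 * \<delta>) / (2 * \<delta> - 1))"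
      unfolding sum_distrib_left[symmetric] using R \<delta> by (intro mult_left_mono powr_tail_sum one) auto
    also have "\<dots> \<le> R\<^sup>2 * (real (2 ^ k) powr (1 - 2 * \<delta>) / 1)"
      using \<delta> by (intro mult_left_mono divide_left_mono) auto
    also have "\<dots> = (\<delta> - 1)\<^sup>2 * (R / (\<delta> - 1) * (2 ^ k) powr (1 - \<delta>))\<^sup>2 / 2 ^ k"
    proof -
      have "((2 ^ k) powr (1 - \<delta>))\<^sup>2 / 2 ^ k = (2 ^ k) powr (1 - 2 * \<delta>)"
        by (rule powr_square_divide) simp
      from this[symmetric] show ?thesis using \<delta> by (simp add: power_mult_distrib power_divide)
    qed
    finally show "(\<Sum>i\<in>{2 ^ k<..N}. (c i)\<^sup>2) \<le> (\<delta> - 1)\<^sup>2 * (R / (\<delta> - 1) * (2 ^ k) powr (1 - \<delta>))\<^sup>2 / 2 ^ k" .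
  qed
qed

text \<open>
By the determinant formula the wedge products of the eigenvectors are orthonormal, so \<open>K\<close> is diagonal.\<close>

lemma
  fixes f :: "nat \<times> nat \<Rightarrow> 'b::{real_inner, banach}" and wedge :: "'a::real_inner \<Rightarrow> 'a \<Rightarrow> 'c::real_inner"
  assumes t: "0 < t" and pos: "\<And>j. 1 \<le> j \<Longrightarrow> 0 < c j" and e: "orthonormal_family {1..} e"
    and K: "area_kernel c e t f wedge K"
    and fin: "\<And>u. 0 < u \<Longrightarrow> finite {(i, j). 1 \<le> i \<and> i < j \<and> u < t / 2 * sqrt (c i * c j)}"
  shows area_kernel_discrete: "discrete_spectrum K"
    and area_kernel_count: "0 < u \<Longrightarrow> eigen_count K u = card {(i, j). 1 \<le> i \<and> i < j \<and> u < t / 2 * sqrt (c i * c j)}"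
proof -
  let ?I = "area_index c"
  define l where "l p = t / 2 * sqrt (c (fst p) * c (snd p))" for p
  have I: "?I = {(i, j). 1 \<le> i \<and> i < j}" using pos by (auto simp: area_index_def)
  have lev: "{p \<in> ?I. u < l p} = {(i, j). 1 \<le> i \<and> i < j \<and> u < t / 2 * sqrt (c i * c j)}" for u
    by (auto simp: I l_def)
  have f: "orthonormal_basis ?I f" and ext: "exterior_square wedge" using K by (auto simp: area_kernel_def)
  have Kf: "K (f p) = l p *\<^sub>R wedge (e (fst p)) (e (snd p))" if "p \<in> ?I" for p
    using K that by (auto simp: area_kernel_def l_def)
  have w: "wedge u v \<bullet> wedge x z = (u \<bullet> x) * (v \<bullet> z) - (u \<bullet> z) * (v \<bullet> x)" for u v x z
    using ext by (simp add: exterior_square_def)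
  have ee: "e i \<bullet> e j = (if i = j then 1 else 0)" if "1 \<le> i" "1 \<le> j" for i j
    using e that by (simp add: orthonormal_family_def)
  have KK: "K (f p) \<bullet> K (f q) = (if p = q then (l p)\<^sup>2 else 0)" if pq: "p \<in> ?I" "q \<in> ?I" for p q
  proof -
    obtain i j i' j' where p: "p = (i, j)" "q = (i', j')" by (cases p, cases q)
    have ij: "1 \<le> i" "i < j" "1 \<le> i'" "i' < j'" using pq by (auto simp: I p)
    have "wedge (e i) (e j) \<bullet> wedge (e i') (e j') = (if i = i' \<and> j = j' then 1 else 0)"
      unfolding w using ij by (auto simp: ee)
    then show ?thesis unfolding Kf[OF pq(1)] Kf[OF pq(2)] by (auto simp: p power2_eq_square)
  qed
  have lpos: "0 < l p" if "p \<in> ?I" for p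
    using that t pos[of "fst p"] pos[of "snd p"] by (auto simp: I l_def)
  show "discrete_spectrum K"
    using diagonal_discrete_spectrum[OF f KK lpos] fin lev by simp
  show "eigen_count K u = card {(i, j). 1 \<le> i \<and> i < j \<and> u < t / 2 * sqrt (c i * c j)}" if "0 < u"
    using diagonal_eigen_count[OF f KK lpos _ that] fin lev by simp
qed

context hilbert_brownian_motion
begin

text \<open>The dyadic integral at level \<open>k\<close> is a sum of \<open>2 ^ k\<close> operators of rank one, and \<open>2 ^ k\<close> coordinates are
projected away, so \<open>4 * 2 ^ k\<close> directions have to be avoided.\<close>

lemma levy_area_decay:
  fixes e :: "nat \<Rightarrow> 'a" and c :: "nat \<Rightarrow> real"
  assumes t: "0 < t" and \<delta>: "1 < \<delta>" and e: "orthonormal_family {1..} e"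
    and c: "\<And>i. 1 \<le> i \<Longrightarrow> C (e i) = c i *\<^sub>R e i" "\<And>i. 1 \<le> i \<Longrightarrow> 0 < c i"
    and ker: "\<And>x. (\<And>i. 1 \<le> i \<Longrightarrow> x \<bullet> e i = 0) \<Longrightarrow> C x = 0"
    and K: "0 < K" "\<And>k N. (\<Sum>i\<in>{2 ^ k<..N}. c i) \<le> K * (2 ^ k) powr (1 - \<delta>)"
      "\<And>k N. (\<Sum>i\<in>{2 ^ k<..N}. (c i)\<^sup>2) \<le> (\<delta> - 1)\<^sup>2 * (K * (2 ^ k) powr (1 - \<delta>))\<^sup>2 / 2 ^ k"
    and A: "levy_area M B t A"
  shows "AE \<omega> in M. compact_operator (A \<omega>) \<and> discrete_spectrum (A \<omega>) \<and>
    (\<exists>G>0. \<forall>u. 0 < u \<longrightarrow> u \<le> 1 \<longrightarrow> real (eigen_count (A \<omega>) u) \<le> G * u powr (- 1 / \<delta>))"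
proof -
  obtain I where I: "ito_tensor_integral M B t B I" and AI: "AE \<omega> in M. A \<omega> = Alt2 (I \<omega>)"
    using A unfolding levy_area_def by blast
  let ?a = "\<lambda>k::nat. K * (2 ^ k) powr (1 - \<delta>)"
  have a: "0 < ?a k" for k using K(1) by simp
  have Q: "0 \<le> (\<delta> - 1)\<^sup>2" by simp
  have "AE \<omega> in M.
    (\<exists>L\<ge>0. \<forall>k N. (\<Sum>(i, j)\<in>{2 ^ k<..N} \<times> {2 ^ k<..N}.
        ((I \<omega> (e j) - dyadic_integral t k \<omega> (e j)) \<bullet> e i)\<^sup>2) \<le> L * (?a k)\<^sup>2 / 2 ^ k) \<and>
    (\<forall>x. (\<forall>i\<ge>1. x \<bullet> e i = 0) \<longrightarrow> (\<forall>y. I \<omega> x \<bullet> y = 0 \<and> I \<omega> y \<bullet> x = 0) \<and> (\<forall>k l. B (grid t k l) \<omega> \<bullet> x = 0))"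
    by (rule ito_path_properties[OF t e c a K(2) Q K(3) I ker])
  then show ?thesis using AI
  proof eventually_elim
    fix \<omega>
    assume props: "(\<exists>L\<ge>0. \<forall>k N. (\<Sum>(i, j)\<in>{2 ^ k<..N} \<times> {2 ^ k<..N}.
        ((I \<omega> (e j) - dyadic_integral t k \<omega> (e j)) \<bullet> e i)\<^sup>2) \<le> L * (?a k)\<^sup>2 / 2 ^ k) \<and>
      (\<forall>x. (\<forall>i\<ge>1. x \<bullet> e i = 0) \<longrightarrow> (\<forall>y. I \<omega> x \<bullet> y = 0 \<and> I \<omega> y \<bullet> x = 0) \<and> (\<forall>k l. B (grid t k l) \<omega> \<bullet> x = 0))"
      and A: "A \<omega> = Alt2 (I \<omega>)"
    then obtain L where L: "0 \<le> L" "\<And>k N. (\<Sum>(i, j)\<in>{2 ^ k<..N} \<times> {2 ^ k<..N}.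
        ((I \<omega> (e j) - dyadic_integral t k \<omega> (e j)) \<bullet> e i)\<^sup>2) \<le> L * (?a k)\<^sup>2 / 2 ^ k" by blast
    have kill: "I \<omega> x \<bullet> y = 0 \<and> I \<omega> y \<bullet> x = 0" "B (grid t k l) \<omega> \<bullet> x = 0"
      if "\<And>i. 1 \<le> i \<Longrightarrow> x \<bullet> e i = 0" for x y k l
      using props that by blast+
    define L' where "L' = L * K\<^sup>2"
    have L': "0 \<le> L'" using L(1) by (simp add: L'_def)
    have \<eta>: "L * (?a k)\<^sup>2 / 2 ^ k = L' * (2 ^ k) powr (1 - 2 * \<delta>)" for k
    proof -
      have "((2 ^ k) powr (1 - \<delta>))\<^sup>2 / 2 ^ k = (2 ^ k) powr (1 - 2 * \<delta>)"
        by (rule powr_square_divide) simp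
      from this[symmetric] show ?thesis by (simp add: L'_def power_mult_distrib)
    qed
    have small: "\<exists>V. finite V \<and> card V \<le> 4 * 2 ^ k \<and>
      (\<forall>S. finite S \<longrightarrow> orthonormal S \<longrightarrow> (\<forall>x\<in>S. \<forall>w\<in>V. x \<bullet> w = 0) \<longrightarrow>
        (\<Sum>x\<in>S. (norm (A \<omega> x))\<^sup>2) \<le> L' * (2 ^ k) powr (1 - 2 * \<delta>))" for k
    proof -
      let ?u = "\<lambda>l. B (grid t k l) \<omega>" and ?v = "\<lambda>l. B (grid t k (Suc l)) \<omega> - B (grid t k l) \<omega>"
      have J: "dyadic_integral t k \<omega> x \<bullet> y = (\<Sum>l<2 ^ k. (?u l \<bullet> y) * (?v l \<bullet> x))" for x y
        by (simp add: dyadic_integral_def elementary_integral_entry incr_def)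
      obtain V where "finite V" "card V \<le> 2 * 2 ^ k + 2 * 2 ^ k"
        "\<And>S. finite S \<Longrightarrow> orthonormal S \<Longrightarrow> (\<And>x w. x \<in> S \<Longrightarrow> w \<in> V \<Longrightarrow> x \<bullet> w = 0)
          \<Longrightarrow> (\<Sum>x\<in>S. (norm (Alt2 (I \<omega>) x))\<^sup>2) \<le> L' * (2 ^ k) powr (1 - 2 * \<delta>)"
      proof (rule Alt2_small_off_directions[OF e J kill(1)])
        show "(\<Sum>(i, j)\<in>{2 ^ k<..N} \<times> {2 ^ k<..N}. ((I \<omega> (e j) - dyadic_integral t k \<omega> (e j)) \<bullet> e i)\<^sup>2)
          \<le> L' * (2 ^ k) powr (1 - 2 * \<delta>)" for N
          using L(2)[of k N] unfolding \<eta> .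
      qed (auto simp: kill(2) inner_diff_left)
      then show ?thesis unfolding A by (intro exI[of _ V]) auto
    qed
    have "0 < 8 + L'" using L' by simp
    then show "compact_operator (A \<omega>) \<and> discrete_spectrum (A \<omega>) \<and>
      (\<exists>G>0. \<forall>u. 0 < u \<longrightarrow> u \<le> 1 \<longrightarrow> real (eigen_count (A \<omega>) u) \<le> G * u powr (- 1 / \<delta>))"
      using dyadic_decay_compact[OF \<delta> L' small] dyadic_decay_discrete[OF \<delta> L' small]
        dyadic_decay_count[OF \<delta> L' small] by blast
  qed
qed

end

text \<open>The power \<open>u powr (- p)\<close> is negligible against \<open>u powr (- 2 * p) * ln (1 / u)\<close>.\<close>

lemma count_ratio_tendsto:
  fixes N N' :: "real \<Rightarrow> nat"
  assumes p: "0 < p" and A: "0 < A" and a: "0 < a" and G: "0 < G"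
    and N: "(\<lambda>u. real (N u)) \<sim>[at_right 0] (\<lambda>u. A * u powr (- 2 * p) * ln (1 / u))"
    and N': "\<And>u. 0 < u \<Longrightarrow> u \<le> 1 \<Longrightarrow> real (N' u) \<le> G * u powr (- p)"
  shows "((\<lambda>u. real (N' (a * u)) / real (N u)) \<longlongrightarrow> 0) (at_right 0)"
proof -
  let ?F = "\<lambda>u. A * u powr (- 2 * p) * ln (1 / u)"
  have Fpos: "\<forall>\<^sub>F u in at_right 0. 0 < ?F u"
    by (rule eventually_mono[OF eventually_at_right_real[OF zero_less_one]]) (use A in auto)
  have "((\<lambda>u. real (N u) / ?F u) \<longlongrightarrow> 1) (at_right 0)"
    by (rule asymp_equiv_ratio[OF N]) (use Fpos in \<open>auto elim!: eventually_mono\<close>)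
  then have half: "\<forall>\<^sub>F u in at_right 0. 1 / 2 < real (N u) / ?F u" by (rule order_tendstoD) simp
  have lim: "((\<lambda>u. G * (a * u) powr (- p) / (?F u / 2)) \<longlongrightarrow> 0) (at_right 0)"
    using p A a G by real_asymp
  have small: "\<forall>\<^sub>F u in at_right 0. u \<in> {0<..<1 / a}" by (rule eventually_at_right_real) (use a in simp)
  show ?thesis
  proof (rule tendsto_sandwich[OF _ _ tendsto_const lim])
    show "\<forall>\<^sub>F u in at_right 0. 0 \<le> real (N' (a * u)) / real (N u)" by simp
    show "\<forall>\<^sub>F u in at_right 0. real (N' (a * u)) / real (N u) \<le> G * (a * u) powr (- p) / (?F u / 2)"
      using half small Fpos
    proof eventually_elim
      case (elim u)
      have "a * u \<le> 1" "0 < a * u" using elim(2) a by (auto simp: field_simps)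
      then have "real (N' (a * u)) \<le> G * (a * u) powr (- p)" by (intro N')
      moreover have "?F u / 2 \<le> real (N u)" using elim(1,3) by (simp add: field_simps)
      ultimately show ?case using elim(3) G by (intro frac_le) auto
    qed
  qed
qed

theorem proposition9p2:
  fixes C :: "'a::{real_inner, banach, second_countable_topology} \<Rightarrow>\<^sub>L 'a"
    and c :: "nat \<Rightarrow> real" and e :: "nat \<Rightarrow> 'a"
    and t b \<delta> :: real
    and f :: "nat \<times> nat \<Rightarrow> 'b::{real_inner, banach}"
    and wedge :: "'a \<Rightarrow> 'a \<Rightarrow> 'c::{real_inner, banach}"
    and K :: "'b \<Rightarrow>\<^sub>L 'c"
    and M :: "'w measure" and B :: "real \<Rightarrow> 'w \<Rightarrow> 'a" and A :: "'w \<Rightarrow> 'a \<Rightarrow>\<^sub>L 'a"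
  assumes "t > 0"
    and "C \<in> trace_class" and "positive_operator C" and "eigenpairs C c e"
    and "b > 0" and "\<delta> > 1"
    and "c \<sim>[at_top] (\<lambda>j. b * real j powr (- \<delta>))"
    and "area_kernel c e t f wedge K"
    and "prob_space M" and "brownian_motion M C B" and "levy_area M B t A"
  shows "((\<lambda>u. real (singular_value_count K u)) \<sim>[at_right 0]
            (\<lambda>u. (t * b / 2) powr (2 / \<delta>) / \<delta> * u powr (- 2 / \<delta>) * ln (1 / u))) \<and>
         (singular_value K \<sim>[at_top]
            (\<lambda>N. t * b / 2 powr (1 + \<delta> / 2) * real N powr (- \<delta> / 2) * ln (real N) powr (\<delta> / 2))) \<and>
         (AE \<omega> in M. A \<omega> \<in> weak_schatten (1 / \<delta>) \<and>
            (\<forall>a>0. ((\<lambda>u. real (singular_value_count (A \<omega>) (a * u)) / real (singular_value_count K u))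
                      \<longlongrightarrow> 0) (at_right 0)))"
proof -
  have \<delta>: "0 < \<delta>" "1 < \<delta>" using assms(6) by auto
  have e: "orthonormal_family {1..} e" and Ce: "\<And>i. 1 \<le> i \<Longrightarrow> C (e i) = c i *\<^sub>R e i"
    and ker: "\<And>x. (\<And>i. 1 \<le> i \<Longrightarrow> x \<bullet> e i = 0) \<Longrightarrow> C x = 0"
    and dec: "\<And>i. 1 \<le> i \<Longrightarrow> c (Suc i) \<le> c i"
    using assms(4) by (auto simp: eigenpairs_def)
  note pos = decay_constants(1)[OF assms(5) \<delta>(2) assms(7) dec]
  obtain R where R: "0 < R" "\<And>k N. (\<Sum>i\<in>{2 ^ k<..N}. c i) \<le> R * (2 ^ k) powr (1 - \<delta>)"
    "\<And>k N. (\<Sum>i\<in>{2 ^ k<..N}. (c i)\<^sup>2) \<le> (\<delta> - 1)\<^sup>2 * (R * (2 ^ k) powr (1 - \<delta>))\<^sup>2 / 2 ^ k"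
    using decay_constants(2)[OF assms(5) \<delta>(2) assms(7) dec] by blast
  define P where "P u = {(i, j). 1 \<le> i \<and> i < j \<and> u < t / 2 * sqrt (c i * c j)}" for u
  define F where "F u = (t * b / 2) powr (2 / \<delta>) / \<delta> * u powr (- 2 / \<delta>) * ln (1 / u)" for u
  note pairs = pair_count_asymp[OF assms(1,5) \<delta>(1) pos assms(7), folded P_def F_def[abs_def]]
  have disc: "discrete_spectrum K" and count: "\<And>u. 0 < u \<Longrightarrow> eigen_count K u = card (P u)"
    unfolding P_def
    using area_kernel_discrete[OF assms(1) pos e assms(8) pairs(1)[unfolded P_def]]
      area_kernel_count[OF assms(1) pos e assms(8) pairs(1)[unfolded P_def]] by auto
  have cK: "singular_value_count K u = card (P u)" if "0 < u" for u
    using singular_value_count_eq[OF disc that] count[OF that] by simp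
  have ev: "\<forall>\<^sub>F u in at_right 0. real (card (P u)) = real (singular_value_count K u)"
    by (rule eventually_mono[OF eventually_at_right_less]) (simp add: cK)
  have 1: "(\<lambda>u. real (singular_value_count K u)) \<sim>[at_right 0] F"
    using asymp_equiv_cong[OF ev, of F F] pairs(2) by simp
  have 2: "singular_value K \<sim>[at_top]
      (\<lambda>N. t * b / 2 powr (1 + \<delta> / 2) * real N powr (- \<delta> / 2) * ln (real N) powr (\<delta> / 2))"
  proof -
    define A0 where "A0 = (t * b / 2) powr (2 / \<delta>) / \<delta>"
    have A0: "0 < A0" using assms(1,5) \<delta> by (simp add: A0_def)
    have "(\<lambda>u. real (singular_value_count K u)) \<sim>[at_right 0] (\<lambda>u. A0 * u powr (- (2 / \<delta>)) * ln (1 / u))"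
      using 1 by (simp add: F_def[abs_def] A0_def)
    moreover have "u < singular_value K n \<longleftrightarrow> n \<le> singular_value_count K u" if "1 \<le> n" "0 < u" for n u
      using singular_value_greater_iff[OF disc that] singular_value_count_eq[OF disc that(2)] by simp
    ultimately have "singular_value K \<sim>[at_top] (\<lambda>n. (A0 / (2 / \<delta>)) powr (1 / (2 / \<delta>)) * real n powr (- 1 / (2 / \<delta>)) * ln (real n) powr (1 / (2 / \<delta>)))"
      using counting_function_inversion[of "singular_value K" "singular_value_count K" A0 "2 / \<delta>"] A0 \<delta> by simp
    moreover have "(A0 / (2 / \<delta>)) powr (1 / (2 / \<delta>)) = t * b / 2 powr (1 + \<delta> / 2)"
    proof -
      define y where "y = t * b / 2"
      have y: "0 < y" using assms(1,5) by (simp add: y_def)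
      have "(A0 / (2 / \<delta>)) powr (1 / (2 / \<delta>)) = (y powr (2 / \<delta>) / 2) powr (\<delta> / 2)"
        using \<delta> by (simp add: A0_def y_def)
      also have "\<dots> = y / 2 powr (\<delta> / 2)" using y \<delta> by (simp add: powr_divide powr_powr)
      finally show ?thesis by (simp add: powr_add y_def)
    qed
    ultimately show ?thesis by simp
  qed
  interpret hilbert_brownian_motion M C B
    using assms(9,10,3) by (simp add: hilbert_brownian_motion_def hilbert_brownian_motion_axioms_def)
  have "AE \<omega> in M. compact_operator (A \<omega>) \<and> discrete_spectrum (A \<omega>) \<and>
      (\<exists>G>0. \<forall>u. 0 < u \<longrightarrow> u \<le> 1 \<longrightarrow> real (eigen_count (A \<omega>) u) \<le> G * u powr (- 1 / \<delta>))"
    by (rule levy_area_decay[OF assms(1) \<delta>(2) e Ce pos ker R assms(11)])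
  then have 3: "AE \<omega> in M. A \<omega> \<in> weak_schatten (1 / \<delta>) \<and>
      (\<forall>a>0. ((\<lambda>u. real (singular_value_count (A \<omega>) (a * u)) / real (singular_value_count K u)) \<longlongrightarrow> 0) (at_right 0))"
  proof eventually_elim
    fix \<omega>
    assume "compact_operator (A \<omega>) \<and> discrete_spectrum (A \<omega>) \<and>
      (\<exists>G>0. \<forall>u. 0 < u \<longrightarrow> u \<le> 1 \<longrightarrow> real (eigen_count (A \<omega>) u) \<le> G * u powr (- 1 / \<delta>))"
    then obtain G where A: "compact_operator (A \<omega>)" "discrete_spectrum (A \<omega>)" and G: "0 < G"
      "\<And>u. 0 < u \<Longrightarrow> u \<le> 1 \<Longrightarrow> real (eigen_count (A \<omega>) u) \<le> G * u powr (- 1 / \<delta>)" by blast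
    have "A \<omega> \<in> weak_schatten (1 / \<delta>)" by (rule weak_schatten_of_count[OF \<delta>(1) A G])
    moreover have "((\<lambda>u. real (singular_value_count (A \<omega>) (a * u)) / real (singular_value_count K u)) \<longlongrightarrow> 0) (at_right 0)"
      if a: "0 < a" for a
    proof (rule count_ratio_tendsto[of "1 / \<delta>" "(t * b / 2) powr (2 / \<delta>) / \<delta>" a G])
      show "(\<lambda>u. real (singular_value_count K u)) \<sim>[at_right 0]
          (\<lambda>u. (t * b / 2) powr (2 / \<delta>) / \<delta> * u powr (- 2 * (1 / \<delta>)) * ln (1 / u))"
        using 1 by (simp add: F_def[abs_def])
      show "real (singular_value_count (A \<omega>) u) \<le> G * u powr (- (1 / \<delta>))" if "0 < u" "u \<le> 1" for u
        using G(2)[OF that] singular_value_count_eq[OF A(2) that(1)] by simp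
    qed (use a G assms(1,5) \<delta> in auto)
    ultimately show "A \<omega> \<in> weak_schatten (1 / \<delta>) \<and>
      (\<forall>a>0. ((\<lambda>u. real (singular_value_count (A \<omega>) (a * u)) / real (singular_value_count K u)) \<longlongrightarrow> 0) (at_right 0))"
      by blast
  qed
  show ?thesis using 1 2 3 unfolding F_def[abs_def] by blast
qed

end
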